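(* Let $(\mathcal A^+,\mathcal C,\varphi,\Omega,\Lambda)$ be a $\mathsf\Lambda$-monoidal categorification. If $M$ and $N$ are reachable simple objects of $\mathcal C$, then $$\Lambda(M,N)=\langle\varphi(M),\varphi(N)\rangle_{\rm trop}\qquad\text{and}\qquad 2\mathfrak d(M,N)=(\varphi(M)\mid\mid\varphi(N))_F.$$
   Context: Fix integers $m\ge n>0$; $[1,r]=\{1,\dots,r\}$, $[a]_+=\max\{a,0\}$. Vectors are columns; matrices are integral. Cluster algebras. A mutation matrix is an $m\times n$ matrix $\widetilde B=(b_{ij})$ whose top $n\times n$ block $B$ is skew-symmetrizable (there is a diagonal matrix $S$ with positive integer diagonal entries with $SB$ skew-symmetric). $\mu_k(\widetilde B)=(b'_{ij})$ ($k\in[1,n]$) with $b'_{ij}=-b_{ij}$ if $i=k$ or $j=k$, and $b'_{ij}=b_{ij}+[b_{ik}]_+[b_{kj}]_+-[-b_{ik}]_+[-b_{kj}]_+$ otherwise. A seed is $(\mathbf x,\widetilde B)$, $\mathbf x=(x_1,\dots,x_m)$ a free generating set over $\mathbb Q$ of the field $\mathbb F$ of rational functions in $m$ variables, $\widetilde B$ a mutation matrix; $\mu_k(\mathbf x,\widetilde B)=(\mathbf x',\mu_k(\widetilde B))$ with $x_i'=x_i$ for $i\ne k$, $x_kx_k'=\prod_jx_j^{[b_{jk}]_+}+\prod_jx_j^{[-b_{jk}]_+}$. $\mathbb T_n$ is the $n$-regular tree with edges labelled $1,\dots,n$, distinct labels at each vertex, root $t_0$. A cluster pattern assigns to each $t\in\mathbb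 T_n$ a seed $(\mathbf x_t,\widetilde B_t)$, seeds at the ends of an edge labelled $k$ being related by $\mu_k$; $\widetilde B_t=(b_{ij;t})$, $\hat y_{k;t}=\prod_jx_{j;t}^{b_{jk;t}}$. $\mathcal A^+=\mathbb Z[x_{1;t},\dots,x_{m;t}\mid t\in\mathbb T_n]$ is the cluster algebra with non-inverted frozen variables $x_{n+1;t},\dots,x_{m;t}$. Cluster monomials of $\mathcal A^+$ are the $\mathbf x_t^{\mathbf a}=\prod_{j=1}^m x_{j;t}^{a_j}$, $\mathbf a\in\mathbb Z_{\ge0}^m$. Compatible pair of type $S=\mathrm{diag}(s_1,\dots,s_n)$, $s_i\in\mathbb Z_{>0}$: $(\widetilde B,\Lambda)$ with $\Lambda$ an $m\times m$ skew-symmetric integer matrix and $\widetilde B^T\Lambda=(S\mid\mathbf0)$. Monoidal categorification. $\mathcal C$ is a $\mathbf k$-linear monoidal abelian category ($\mathbf k$ a field) with all objects of finite length; its Grothendieck group $\mathcal K_0(\mathcal C)$ is a ring via $[M][N]=[M\otimes N]$. $(\mathcal A^+,\mathcal C,\varphi)$ is a monoidal categorification if $\varphi:\mathcal K_0(\mathcal C)\to\mathcal A^+$ is a ring isomorphism such that cluster monomials of $\mathcal A^+$ correspond to a subset of the isomorphism classes of simple objects. Write $\varphi(M)=\varphi([M])$. A simple $M$ is reachable if $\varphi(M)$ is a cluster monomial. $\mathcal M_t=(M_{1;t},\dots,M_{m;t})$, with $M_{i;t}$ simple and $\varphi(M_{i;t})=x_{i;t}$, is the monoidal cluster at $t$.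 A simple $M$ is real if $M\otimes M$ is simple; simples $M,N$ strongly commute if $M\otimes N\cong N\otimes M$ and this is simple. $M\nabla N$ denotes the head of $M\otimes N$. $\mathsf\Lambda$-structure on $\mathcal C$: a pair $(\Omega,\Lambda)$ where $\Omega$ is a class of nonzero objects containing all simples and closed under isomorphism, tensor products and nonzero subquotients, and $\Lambda:\Omega\times\Omega\to\mathbb Z$ satisfies: (a1) $\Lambda(M,N)$ depends only on isomorphism classes; (a2) with $\mathfrak d(M,N):=\frac12(\Lambda(M,N)+\Lambda(N,M))$, one has $\mathfrak d(M,N)=0$ if $M,N$ are real simples that strongly commute; (a3) for $M,N,L\in\Omega$ with $L$ simple, $\Lambda(M\otimes N,L)=\Lambda(M,L)+\Lambda(N,L)$ and $\Lambda(L,M\otimes N)=\Lambda(L,M)+\Lambda(L,N)$; (a4) for simple $M,N,L$ with $L$ real: if $L$ strongly commutes with $N$ then $\Lambda(M\nabla N,L)=\Lambda(M,L)+\Lambda(N,L)$, and if $L$ strongly commutes with $M$ then $\Lambda(L,M\nabla N)=\Lambda(L,M)+\Lambda(L,N)$; (a5) $\Lambda(M',N')\le\Lambda(M,N)$ for nonzero subquotients $M'$ of $M$ and $N'$ of $N$. $(\mathcal A^+,\mathcal C,\varphi,\Omega,\Lambda)$ is a $\mathsf\Lambda$-monoidal categorification if $(\mathcal A^+,\mathcal C,\varphi)$ is a monoidal categorification, $(\Omega,\Lambda)$ is a $\mathsf\Lambda$-structure on $\mathcal C$, and: (c1) for simples $M,N$ at least one of which is real, $M\nabla N$ is simple; (c2)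 for some $w\in\mathbb T_n$, $(\widetilde B_w,\Lambda_w)$ is a compatible pair, where $\Lambda_t:=(\Lambda(M_{i;t},M_{j;t}))_{i,j\in[1,m]}$. Fact: then for all $t$, $(\widetilde B_t,\Lambda_t)$ is a compatible pair (of a common type $S$), and along an edge $t\overset{k}{-}t'$ one has $\Lambda_{t'}=E^T\Lambda_tE$, where $E$ is $I_m$ with $k$th column replaced by $e_k=-1$, $e_i=[-\varepsilon b_{ik;t}]_+$ ($\varepsilon\in\{\pm1\}$ arbitrary). Invariants of cluster monomials. Every cluster monomial $u$ has for every $t$ a unique expression $u=\mathbf x_t^{\mathbf g_u^t}F_u^t(\hat y_{1;t},\dots,\hat y_{n;t})$ with $\mathbf g_u^t\in\mathbb Z^m$, $F_u^t\in\mathbb Z_{\ge0}[y_1,\dots,y_n]$ of constant term $1$. There is a unique semifield homomorphism $\beta_u:\mathbb Q_{\rm sf}(x_{1;t_0},\dots,x_{m;t_0})\to\mathbb Z^{\max}=(\mathbb Z,+,\max)$ (source: nonzero rational functions with subtraction-free expressions) with $(\beta_u(x_{1;t}),\dots,\beta_u(x_{m;t}))=(\Lambda_t\mathbf g_u^t)^T$ for all $t$. For cluster monomials $u,u'$: $\langle u,u'\rangle_{\rm trop}:=\beta_{u'}(u)$, $(u\mid\mid u')_F:=\beta_{u'}(u)+\beta_u(u')$. *)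

theory Defs
  imports
    "HOL-Algebra.QuotRing"
    "HOL-Algebra.Free_Abelian_Groups"
    "HOL-Algebra.Generated_Fields"
    "HOL-Algebra.Algebraic_Closure_Type"
    "HOL-Library.Poly_Mapping"
    "Jordan_Normal_Form.Matrix"
begin

text \<open>Conventions.  The index sets \<open>[1,n]\<close> and \<open>[1,m]\<close> are rendered as \<open>{..<n}\<close> and \<open>{..<m}\<close>
  (the matrix library is 0-based), so the frozen indices are \<open>n, \<dots>, m - 1\<close>.  Families
  \<open>nat \<Rightarrow> _\<close> are only ever inspected on these index sets.\<close>

text \<open>\<open>X\<close> is used below for objects of a category.\<close>
no_notation Polynomials.var (\<open>X\<index>\<close>)

section \<open>Cluster patterns\<close>

definition pos_part :: "int \<Rightarrow> int" where
  "pos_part a = max a 0"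

definition skew_symmetric :: "int mat \<Rightarrow> bool" where
  "skew_symmetric A \<longleftrightarrow> square_mat A \<and> transpose_mat A = - A"

definition principal_part :: "nat \<Rightarrow> int mat \<Rightarrow> int mat" where
  "principal_part n B = mat n n (\<lambda>(i, j). B $$ (i, j))"

definition mutation_matrix :: "nat \<Rightarrow> nat \<Rightarrow> int mat \<Rightarrow> bool" where
  "mutation_matrix m n B \<longleftrightarrow> B \<in> carrier_mat m n \<and>
     (\<exists>s. (\<forall>i<n. s i > 0) \<and> skew_symmetric (mat_diag n s * principal_part n B))"

definition mutate :: "nat \<Rightarrow> nat \<Rightarrow> nat \<Rightarrow> int mat \<Rightarrow> int mat" where
  "mutate m n k B = mat m n (\<lambda>(i, j).
     if i = k \<or> j = k then - B $$ (i, j)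
     else B $$ (i, j) + pos_part (B $$ (i, k)) * pos_part (B $$ (k, j))
          - pos_part (- B $$ (i, k)) * pos_part (- B $$ (k, j)))"

text \<open>Polynomials in \<open>x\<^sub>0, x\<^sub>1, \<dots>\<close> over \<open>'c\<close> are finitely supported maps from exponent vectors
  to coefficients; \<open>h\<close> embeds the coefficients into the target.\<close>

definition poly_in_vars :: "nat \<Rightarrow> ((nat \<Rightarrow>\<^sub>0 nat) \<Rightarrow>\<^sub>0 'c::zero) \<Rightarrow> bool" where
  "poly_in_vars r p \<longleftrightarrow> (\<forall>e \<in> Poly_Mapping.keys p. Poly_Mapping.keys e \<subseteq> {..<r})"

definition poly_eval ::
    "('c::zero \<Rightarrow> 'f::comm_semiring_1) \<Rightarrow> (nat \<Rightarrow> 'f) \<Rightarrow> ((nat \<Rightarrow>\<^sub>0 nat) \<Rightarrow>\<^sub>0 'c) \<Rightarrow> 'f" where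
  "poly_eval h x p = (\<Sum>e \<in> Poly_Mapping.keys p.
     h (Poly_Mapping.lookup p e) * (\<Prod>j \<in> Poly_Mapping.keys e. x j ^ Poly_Mapping.lookup e j))"

definition algebraically_independent :: "nat \<Rightarrow> (nat \<Rightarrow> 'f::field_char_0) \<Rightarrow> bool" where
  "algebraically_independent m x \<longleftrightarrow>
     (\<forall>p :: (nat \<Rightarrow>\<^sub>0 nat) \<Rightarrow>\<^sub>0 rat. poly_in_vars m p \<longrightarrow> poly_eval of_rat x p = 0 \<longrightarrow> p = 0)"

text \<open>The ambient field is an arbitrary field type of characteristic 0.  As soon as it has a free
  generating set of size \<open>m\<close> it is (isomorphic to) the field of rational functions over the
  rationals in \<open>m\<close> variables.\<close>

definition free_generating_set :: "nat \<Rightarrow> (nat \<Rightarrow> 'f::field_char_0) \<Rightarrow> bool" where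
  "free_generating_set m x \<longleftrightarrow> algebraically_independent m x \<and>
     generate_field (ring_of_type_algebra :: 'f ring) (range of_rat \<union> x ` {..<m}) = UNIV"

definition seed :: "nat \<Rightarrow> nat \<Rightarrow> (nat \<Rightarrow> 'f::field_char_0) \<Rightarrow> int mat \<Rightarrow> bool" where
  "seed m n x B \<longleftrightarrow> free_generating_set m x \<and> mutation_matrix m n B"

definition seed_mutation :: "nat \<Rightarrow> nat \<Rightarrow> nat \<Rightarrow>
    (nat \<Rightarrow> 'f::field_char_0) \<Rightarrow> int mat \<Rightarrow> (nat \<Rightarrow> 'f) \<Rightarrow> int mat \<Rightarrow> bool" where
  "seed_mutation m n k x B x' B' \<longleftrightarrow>
     B' = mutate m n k B \<and>
     (\<forall>i<m. i \<noteq> k \<longrightarrow> x' i = x i) \<and>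
     x k * x' k = (\<Prod>j<m. x j ^ nat (pos_part (B $$ (j, k))))
                + (\<Prod>j<m. x j ^ nat (pos_part (- B $$ (j, k))))"

text \<open>The \<open>n\<close>-regular tree with edges labelled by \<open>{..<n}\<close> is realised as the Cayley graph of the
  free product of \<open>n\<close> copies of \<open>\<int>/2\<close>: vertices are the reduced words, and the edge labelled \<open>k\<close>
  at a word is obtained by adding or cancelling an initial letter \<open>k\<close>.  The root is \<open>[]\<close>.\<close>

definition tree_vertices :: "nat \<Rightarrow> nat list set" where
  "tree_vertices n = {t. set t \<subseteq> {..<n} \<and> distinct_adj t}"

definition tree_edge :: "nat \<Rightarrow> nat \<Rightarrow> nat list \<Rightarrow> nat list \<Rightarrow> bool" where
  "tree_edge n k t t' \<longleftrightarrow> t \<in> tree_vertices n \<and> t' \<in> tree_vertices n \<and> k < n \<and>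
     (t' = k # t \<or> t = k # t')"

definition cluster_pattern :: "nat \<Rightarrow> nat \<Rightarrow>
    (nat list \<Rightarrow> nat \<Rightarrow> 'f::field_char_0) \<Rightarrow> (nat list \<Rightarrow> int mat) \<Rightarrow> bool" where
  "cluster_pattern m n x B \<longleftrightarrow>
     (\<forall>t \<in> tree_vertices n. seed m n (x t) (B t)) \<and>
     (\<forall>k t t'. tree_edge n k t t' \<longrightarrow> seed_mutation m n k (x t) (B t) (x t') (B t'))"

definition yhat :: "nat \<Rightarrow>
    (nat list \<Rightarrow> nat \<Rightarrow> 'f::field_char_0) \<Rightarrow> (nat list \<Rightarrow> int mat) \<Rightarrow> nat list \<Rightarrow> nat \<Rightarrow> 'f" where
  "yhat m x B t k = (\<Prod>j<m. x t j powi (B t $$ (j, k)))"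

text \<open>The cluster algebra with non-inverted frozen variables.\<close>

definition cluster_algebra :: "nat \<Rightarrow> nat \<Rightarrow> (nat list \<Rightarrow> nat \<Rightarrow> 'f::field_char_0) \<Rightarrow> 'f ring" where
  "cluster_algebra m n x =
     (ring_of_type_algebra :: 'f ring)
       \<lparr>carrier := generate_ring ring_of_type_algebra {x t i | t i. t \<in> tree_vertices n \<and> i < m}\<rparr>"

definition cluster_monomials ::
    "nat \<Rightarrow> nat \<Rightarrow> (nat list \<Rightarrow> nat \<Rightarrow> 'f::field_char_0) \<Rightarrow> 'f set" where
  "cluster_monomials m n x =
     {\<Prod>j<m. x t j ^ a j | t (a :: nat \<Rightarrow> nat). t \<in> tree_vertices n}"

definition compatible_pair :: "nat \<Rightarrow> nat \<Rightarrow> int mat \<Rightarrow> int mat \<Rightarrow> (nat \<Rightarrow> int) \<Rightarrow> bool" where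
  "compatible_pair m n B L s \<longleftrightarrow>
     mutation_matrix m n B \<and> L \<in> carrier_mat m m \<and> skew_symmetric L \<and> (\<forall>i<n. s i > 0) \<and>
     transpose_mat B * L = mat n m (\<lambda>(i, j). if i = j then s i else 0)"


section \<open>Tropical invariants of cluster monomials\<close>

text \<open>\<open>F\<close> has coefficients in \<open>nat\<close>, i.e. nonnegative integers.\<close>

definition gF_expression :: "nat \<Rightarrow> nat \<Rightarrow>
    (nat list \<Rightarrow> nat \<Rightarrow> 'f::field_char_0) \<Rightarrow> (nat list \<Rightarrow> int mat) \<Rightarrow> nat list \<Rightarrow> 'f \<Rightarrow>
    int vec \<Rightarrow> ((nat \<Rightarrow>\<^sub>0 nat) \<Rightarrow>\<^sub>0 nat) \<Rightarrow> bool" where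
  "gF_expression m n x B t u g F \<longleftrightarrow>
     g \<in> carrier_vec m \<and> poly_in_vars n F \<and> Poly_Mapping.lookup F 0 = 1 \<and>
     u = (\<Prod>j<m. x t j powi (g $ j)) * poly_eval of_nat (yhat m x B t) F"

definition g_vector :: "nat \<Rightarrow> nat \<Rightarrow>
    (nat list \<Rightarrow> nat \<Rightarrow> 'f::field_char_0) \<Rightarrow> (nat list \<Rightarrow> int mat) \<Rightarrow> nat list \<Rightarrow> 'f \<Rightarrow> int vec" where
  "g_vector m n x B t u = fst (THE (g, F). gF_expression m n x B t u g F)"

inductive_set subtraction_free :: "nat \<Rightarrow> (nat \<Rightarrow> 'f::field_char_0) \<Rightarrow> 'f set"
  for m :: nat and z :: "nat \<Rightarrow> 'f" where
  one: "1 \<in> subtraction_free m z"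
| var: "i < m \<Longrightarrow> z i \<in> subtraction_free m z"
| add: "\<lbrakk>p \<in> subtraction_free m z; q \<in> subtraction_free m z\<rbrakk> \<Longrightarrow> p + q \<in> subtraction_free m z"
| mult: "\<lbrakk>p \<in> subtraction_free m z; q \<in> subtraction_free m z\<rbrakk> \<Longrightarrow> p * q \<in> subtraction_free m z"
| divide: "\<lbrakk>p \<in> subtraction_free m z; q \<in> subtraction_free m z\<rbrakk> \<Longrightarrow> p / q \<in> subtraction_free m z"

text \<open>Semifield homomorphisms from \<open>Q\<close> to the max-plus semifield of integers, whose multiplication
  is \<open>+\<close> and whose addition is \<open>max\<close>.  Extensionality makes them functions on \<open>Q\<close>.\<close>

definition max_plus_homs :: "'f::field_char_0 set \<Rightarrow> ('f \<Rightarrow> int) set" where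
  "max_plus_homs Q = {b \<in> extensional Q. \<forall>p \<in> Q. \<forall>q \<in> Q.
     b (p * q) = b p + b q \<and> b (p + q) = max (b p) (b q)}"

definition trop_point :: "nat \<Rightarrow> nat \<Rightarrow>
    (nat list \<Rightarrow> nat \<Rightarrow> 'f::field_char_0) \<Rightarrow> (nat list \<Rightarrow> int mat) \<Rightarrow> (nat list \<Rightarrow> int mat) \<Rightarrow>
    'f \<Rightarrow> 'f \<Rightarrow> int" where
  "trop_point m n x B L u =
     (THE b. b \<in> max_plus_homs (subtraction_free m (x [])) \<and>
        (\<forall>t \<in> tree_vertices n. vec m (\<lambda>i. b (x t i)) = L t *\<^sub>v g_vector m n x B t u))"

definition trop_pairing :: "nat \<Rightarrow> nat \<Rightarrow>
    (nat list \<Rightarrow> nat \<Rightarrow> 'f::field_char_0) \<Rightarrow> (nat list \<Rightarrow> int mat) \<Rightarrow> (nat list \<Rightarrow> int mat) \<Rightarrow>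
    'f \<Rightarrow> 'f \<Rightarrow> int" where
  "trop_pairing m n x B L u u' = trop_point m n x B L u' u"

definition F_pairing :: "nat \<Rightarrow> nat \<Rightarrow>
    (nat list \<Rightarrow> nat \<Rightarrow> 'f::field_char_0) \<Rightarrow> (nat list \<Rightarrow> int mat) \<Rightarrow> (nat list \<Rightarrow> int mat) \<Rightarrow>
    'f \<Rightarrow> 'f \<Rightarrow> int" where
  "F_pairing m n x B L u u' = trop_point m n x B L u' u + trop_point m n x B L u u'"


section \<open>Linear abelian monoidal categories\<close>

text \<open>Hom-spaces are modules over a ring record of scalars; only the additive group and the scalar
  multiplication of the module record are used (its \<open>mult\<close> and \<open>one\<close> are junk).  \<open>Comp g f\<close> is
  \<open>g \<circ> f\<close>.  Source and target of an arrow are always given by membership in a hom-space.\<close>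

record ('o, 'a, 'k) mon_cat =
  Ob :: "'o set"
  Hom :: "'o \<Rightarrow> 'o \<Rightarrow> ('k, 'a) module"
  Id :: "'o \<Rightarrow> 'a"
  Comp :: "'a \<Rightarrow> 'a \<Rightarrow> 'a"
  Tens :: "'o \<Rightarrow> 'o \<Rightarrow> 'o"
  TensA :: "'a \<Rightarrow> 'a \<Rightarrow> 'a"
  Unit :: 'o
  Assoc :: "'o \<Rightarrow> 'o \<Rightarrow> 'o \<Rightarrow> 'a"
  LUnit :: "'o \<Rightarrow> 'a"
  RUnit :: "'o \<Rightarrow> 'a"

abbreviation arrows :: "('o, 'a, 'k) mon_cat \<Rightarrow> 'o \<Rightarrow> 'o \<Rightarrow> 'a set" where
  "arrows C X Y \<equiv> carrier (Hom C X Y)"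

abbreviation zero_arrow :: "('o, 'a, 'k) mon_cat \<Rightarrow> 'o \<Rightarrow> 'o \<Rightarrow> 'a" where
  "zero_arrow C X Y \<equiv> \<zero>\<^bsub>Hom C X Y\<^esub>"

definition iso_arrow :: "('o, 'a, 'k) mon_cat \<Rightarrow> 'o \<Rightarrow> 'o \<Rightarrow> 'a \<Rightarrow> bool" where
  "iso_arrow C X Y f \<longleftrightarrow> f \<in> arrows C X Y \<and>
     (\<exists>g \<in> arrows C Y X. Comp C g f = Id C X \<and> Comp C f g = Id C Y)"

definition isomorphic :: "('o, 'a, 'k) mon_cat \<Rightarrow> 'o \<Rightarrow> 'o \<Rightarrow> bool" where
  "isomorphic C X Y \<longleftrightarrow> X \<in> Ob C \<and> Y \<in> Ob C \<and> (\<exists>f. iso_arrow C X Y f)"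

definition mono_arrow :: "('o, 'a, 'k) mon_cat \<Rightarrow> 'o \<Rightarrow> 'o \<Rightarrow> 'a \<Rightarrow> bool" where
  "mono_arrow C X Y f \<longleftrightarrow> f \<in> arrows C X Y \<and>
     (\<forall>W \<in> Ob C. \<forall>g \<in> arrows C W X. \<forall>h \<in> arrows C W X. Comp C f g = Comp C f h \<longrightarrow> g = h)"

definition epi_arrow :: "('o, 'a, 'k) mon_cat \<Rightarrow> 'o \<Rightarrow> 'o \<Rightarrow> 'a \<Rightarrow> bool" where
  "epi_arrow C X Y f \<longleftrightarrow> f \<in> arrows C X Y \<and>
     (\<forall>W \<in> Ob C. \<forall>g \<in> arrows C Y W. \<forall>h \<in> arrows C Y W. Comp C g f = Comp C h f \<longrightarrow> g = h)"

definition zero_object :: "('o, 'a, 'k) mon_cat \<Rightarrow> 'o \<Rightarrow> bool" where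
  "zero_object C Z \<longleftrightarrow> Z \<in> Ob C \<and>
     (\<forall>X \<in> Ob C. (\<exists>!f. f \<in> arrows C Z X) \<and> (\<exists>!f. f \<in> arrows C X Z))"

text \<open>\<open>k : W \<rightarrow> X\<close> is a kernel of \<open>f : X \<rightarrow> Y\<close>.\<close>

definition is_kernel :: "('o, 'a, 'k) mon_cat \<Rightarrow> 'o \<Rightarrow> 'o \<Rightarrow> 'o \<Rightarrow> 'a \<Rightarrow> 'a \<Rightarrow> bool" where
  "is_kernel C W X Y k f \<longleftrightarrow> k \<in> arrows C W X \<and> f \<in> arrows C X Y \<and>
     Comp C f k = zero_arrow C W Y \<and>
     (\<forall>V \<in> Ob C. \<forall>g \<in> arrows C V X. Comp C f g = zero_arrow C V Y \<longrightarrow>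
        (\<exists>!h. h \<in> arrows C V W \<and> Comp C k h = g))"

text \<open>\<open>c : Y \<rightarrow> W\<close> is a cokernel of \<open>f : X \<rightarrow> Y\<close>.\<close>

definition is_cokernel :: "('o, 'a, 'k) mon_cat \<Rightarrow> 'o \<Rightarrow> 'o \<Rightarrow> 'o \<Rightarrow> 'a \<Rightarrow> 'a \<Rightarrow> bool" where
  "is_cokernel C X Y W f c \<longleftrightarrow> f \<in> arrows C X Y \<and> c \<in> arrows C Y W \<and>
     Comp C c f = zero_arrow C X W \<and>
     (\<forall>V \<in> Ob C. \<forall>g \<in> arrows C Y V. Comp C g f = zero_arrow C X V \<longrightarrow>
        (\<exists>!h. h \<in> arrows C W V \<and> Comp C h c = g))"

definition biproduct :: "('o, 'a, 'k) mon_cat \<Rightarrow> 'o \<Rightarrow> 'o \<Rightarrow> 'o \<Rightarrow> bool" where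
  "biproduct C X Y P \<longleftrightarrow> P \<in> Ob C \<and>
     (\<exists>i \<in> arrows C X P. \<exists>j \<in> arrows C Y P. \<exists>p \<in> arrows C P X. \<exists>q \<in> arrows C P Y.
        Comp C p i = Id C X \<and> Comp C q j = Id C Y \<and>
        Comp C p j = zero_arrow C Y X \<and> Comp C q i = zero_arrow C X Y \<and>
        Comp C i p \<oplus>\<^bsub>Hom C P P\<^esub> Comp C j q = Id C P)"

definition short_exact :: "('o, 'a, 'k) mon_cat \<Rightarrow> 'o \<Rightarrow> 'o \<Rightarrow> 'o \<Rightarrow> bool" where
  "short_exact C X Y Z \<longleftrightarrow> X \<in> Ob C \<and> Y \<in> Ob C \<and> Z \<in> Ob C \<and>
     (\<exists>f g. is_kernel C X Y Z f g \<and> is_cokernel C X Y Z f g)"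

locale linear_category =
  fixes K :: "'k ring" and C :: "('o, 'a, 'k) mon_cat"
  assumes scalars_field: "field K"
    and hom_module: "\<lbrakk>X \<in> Ob C; Y \<in> Ob C\<rbrakk> \<Longrightarrow> module K (Hom C X Y)"
    and Id_arrow: "X \<in> Ob C \<Longrightarrow> Id C X \<in> arrows C X X"
    and Comp_arrow: "\<lbrakk>X \<in> Ob C; Y \<in> Ob C; Z \<in> Ob C; f \<in> arrows C X Y; g \<in> arrows C Y Z\<rbrakk>
          \<Longrightarrow> Comp C g f \<in> arrows C X Z"
    and Comp_Id: "\<lbrakk>X \<in> Ob C; Y \<in> Ob C; f \<in> arrows C X Y\<rbrakk>
          \<Longrightarrow> Comp C f (Id C X) = f \<and> Comp C (Id C Y) f = f"
    and Comp_assoc: "\<lbrakk>W \<in> Ob C; X \<in> Ob C; Y \<in> Ob C; Z \<in> Ob C;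
          f \<in> arrows C W X; g \<in> arrows C X Y; h \<in> arrows C Y Z\<rbrakk>
          \<Longrightarrow> Comp C h (Comp C g f) = Comp C (Comp C h g) f"
    and Comp_add_right: "\<lbrakk>X \<in> Ob C; Y \<in> Ob C; Z \<in> Ob C;
          f \<in> arrows C X Y; f' \<in> arrows C X Y; g \<in> arrows C Y Z\<rbrakk>
          \<Longrightarrow> Comp C g (f \<oplus>\<^bsub>Hom C X Y\<^esub> f') = Comp C g f \<oplus>\<^bsub>Hom C X Z\<^esub> Comp C g f'"
    and Comp_add_left: "\<lbrakk>X \<in> Ob C; Y \<in> Ob C; Z \<in> Ob C;
          f \<in> arrows C X Y; g \<in> arrows C Y Z; g' \<in> arrows C Y Z\<rbrakk>
          \<Longrightarrow> Comp C (g \<oplus>\<^bsub>Hom C Y Z\<^esub> g') f = Comp C g f \<oplus>\<^bsub>Hom C X Z\<^esub> Comp C g' f"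
    and Comp_smult: "\<lbrakk>X \<in> Ob C; Y \<in> Ob C; Z \<in> Ob C;
          f \<in> arrows C X Y; g \<in> arrows C Y Z; c \<in> carrier K\<rbrakk>
          \<Longrightarrow> Comp C g (c \<odot>\<^bsub>Hom C X Y\<^esub> f) = c \<odot>\<^bsub>Hom C X Z\<^esub> Comp C g f \<and>
              Comp C (c \<odot>\<^bsub>Hom C Y Z\<^esub> g) f = c \<odot>\<^bsub>Hom C X Z\<^esub> Comp C g f"

locale linear_abelian_category = linear_category +
  assumes has_zero_object: "\<exists>Z. zero_object C Z"
    and has_biproducts: "\<lbrakk>X \<in> Ob C; Y \<in> Ob C\<rbrakk> \<Longrightarrow> \<exists>P. biproduct C X Y P"
    and has_kernels: "\<lbrakk>X \<in> Ob C; Y \<in> Ob C; f \<in> arrows C X Y\<rbrakk>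
          \<Longrightarrow> \<exists>W \<in> Ob C. \<exists>k. is_kernel C W X Y k f"
    and has_cokernels: "\<lbrakk>X \<in> Ob C; Y \<in> Ob C; f \<in> arrows C X Y\<rbrakk>
          \<Longrightarrow> \<exists>W \<in> Ob C. \<exists>c. is_cokernel C X Y W f c"
    and mono_is_kernel: "\<lbrakk>X \<in> Ob C; Y \<in> Ob C; mono_arrow C X Y f\<rbrakk>
          \<Longrightarrow> \<exists>Z \<in> Ob C. \<exists>g. is_kernel C X Y Z f g"
    and epi_is_cokernel: "\<lbrakk>X \<in> Ob C; Y \<in> Ob C; epi_arrow C X Y f\<rbrakk>
          \<Longrightarrow> \<exists>W \<in> Ob C. \<exists>g. is_cokernel C W X Y g f"

locale linear_monoidal_abelian_category = linear_abelian_category +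
  assumes Tens_Ob: "\<lbrakk>X \<in> Ob C; Y \<in> Ob C\<rbrakk> \<Longrightarrow> Tens C X Y \<in> Ob C"
    and Unit_Ob: "Unit C \<in> Ob C"
    and TensA_arrow: "\<lbrakk>X \<in> Ob C; X' \<in> Ob C; Y \<in> Ob C; Y' \<in> Ob C;
          f \<in> arrows C X X'; g \<in> arrows C Y Y'\<rbrakk>
          \<Longrightarrow> TensA C f g \<in> arrows C (Tens C X Y) (Tens C X' Y')"
    and TensA_Id: "\<lbrakk>X \<in> Ob C; Y \<in> Ob C\<rbrakk> \<Longrightarrow> TensA C (Id C X) (Id C Y) = Id C (Tens C X Y)"
    and TensA_Comp: "\<lbrakk>X \<in> Ob C; X' \<in> Ob C; X'' \<in> Ob C; Y \<in> Ob C; Y' \<in> Ob C; Y'' \<in> Ob C;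
          f \<in> arrows C X X'; f' \<in> arrows C X' X''; g \<in> arrows C Y Y'; g' \<in> arrows C Y' Y''\<rbrakk>
          \<Longrightarrow> TensA C (Comp C f' f) (Comp C g' g) = Comp C (TensA C f' g') (TensA C f g)"
    and TensA_add_left: "\<lbrakk>X \<in> Ob C; X' \<in> Ob C; Y \<in> Ob C; Y' \<in> Ob C;
          f \<in> arrows C X X'; f' \<in> arrows C X X'; g \<in> arrows C Y Y'\<rbrakk>
          \<Longrightarrow> TensA C (f \<oplus>\<^bsub>Hom C X X'\<^esub> f') g =
              TensA C f g \<oplus>\<^bsub>Hom C (Tens C X Y) (Tens C X' Y')\<^esub> TensA C f' g"
    and TensA_add_right: "\<lbrakk>X \<in> Ob C; X' \<in> Ob C; Y \<in> Ob C; Y' \<in> Ob C;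
          f \<in> arrows C X X'; g \<in> arrows C Y Y'; g' \<in> arrows C Y Y'\<rbrakk>
          \<Longrightarrow> TensA C f (g \<oplus>\<^bsub>Hom C Y Y'\<^esub> g') =
              TensA C f g \<oplus>\<^bsub>Hom C (Tens C X Y) (Tens C X' Y')\<^esub> TensA C f g'"
    and TensA_smult: "\<lbrakk>X \<in> Ob C; X' \<in> Ob C; Y \<in> Ob C; Y' \<in> Ob C;
          f \<in> arrows C X X'; g \<in> arrows C Y Y'; c \<in> carrier K\<rbrakk>
          \<Longrightarrow> TensA C (c \<odot>\<^bsub>Hom C X X'\<^esub> f) g =
                c \<odot>\<^bsub>Hom C (Tens C X Y) (Tens C X' Y')\<^esub> TensA C f g \<and>
              TensA C f (c \<odot>\<^bsub>Hom C Y Y'\<^esub> g) =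
                c \<odot>\<^bsub>Hom C (Tens C X Y) (Tens C X' Y')\<^esub> TensA C f g"
    and Assoc_iso: "\<lbrakk>X \<in> Ob C; Y \<in> Ob C; Z \<in> Ob C\<rbrakk>
          \<Longrightarrow> iso_arrow C (Tens C (Tens C X Y) Z) (Tens C X (Tens C Y Z)) (Assoc C X Y Z)"
    and Assoc_natural: "\<lbrakk>X \<in> Ob C; X' \<in> Ob C; Y \<in> Ob C; Y' \<in> Ob C; Z \<in> Ob C; Z' \<in> Ob C;
          f \<in> arrows C X X'; g \<in> arrows C Y Y'; h \<in> arrows C Z Z'\<rbrakk>
          \<Longrightarrow> Comp C (Assoc C X' Y' Z') (TensA C (TensA C f g) h) =
              Comp C (TensA C f (TensA C g h)) (Assoc C X Y Z)"
    and LUnit_iso: "X \<in> Ob C \<Longrightarrow> iso_arrow C (Tens C (Unit C) X) X (LUnit C X)"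
    and LUnit_natural: "\<lbrakk>X \<in> Ob C; Y \<in> Ob C; f \<in> arrows C X Y\<rbrakk>
          \<Longrightarrow> Comp C (LUnit C Y) (TensA C (Id C (Unit C)) f) = Comp C f (LUnit C X)"
    and RUnit_iso: "X \<in> Ob C \<Longrightarrow> iso_arrow C (Tens C X (Unit C)) X (RUnit C X)"
    and RUnit_natural: "\<lbrakk>X \<in> Ob C; Y \<in> Ob C; f \<in> arrows C X Y\<rbrakk>
          \<Longrightarrow> Comp C (RUnit C Y) (TensA C f (Id C (Unit C))) = Comp C f (RUnit C X)"
    and pentagon: "\<lbrakk>W \<in> Ob C; X \<in> Ob C; Y \<in> Ob C; Z \<in> Ob C\<rbrakk>
          \<Longrightarrow> Comp C (TensA C (Id C W) (Assoc C X Y Z))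
                (Comp C (Assoc C W (Tens C X Y) Z) (TensA C (Assoc C W X Y) (Id C Z))) =
              Comp C (Assoc C W X (Tens C Y Z)) (Assoc C (Tens C W X) Y Z)"
    and triangle: "\<lbrakk>X \<in> Ob C; Y \<in> Ob C\<rbrakk>
          \<Longrightarrow> Comp C (TensA C (Id C X) (LUnit C Y)) (Assoc C X (Unit C) Y) =
              TensA C (RUnit C X) (Id C Y)"

definition simple :: "('o, 'a, 'k) mon_cat \<Rightarrow> 'o \<Rightarrow> bool" where
  "simple C M \<longleftrightarrow> M \<in> Ob C \<and> \<not> zero_object C M \<and>
     (\<forall>X \<in> Ob C. \<forall>f. mono_arrow C X M f \<longrightarrow> zero_object C X \<or> iso_arrow C X M f)"

inductive finite_length :: "('o, 'a, 'k) mon_cat \<Rightarrow> 'o \<Rightarrow> bool"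
  for C :: "('o, 'a, 'k) mon_cat" where
  "zero_object C Z \<Longrightarrow> finite_length C Z"
| "\<lbrakk>finite_length C X; simple C S; short_exact C X Y S\<rbrakk> \<Longrightarrow> finite_length C Y"

text \<open>Finite direct sums of simple objects.\<close>

inductive semisimple :: "('o, 'a, 'k) mon_cat \<Rightarrow> 'o \<Rightarrow> bool"
  for C :: "('o, 'a, 'k) mon_cat" where
  "zero_object C Z \<Longrightarrow> semisimple C Z"
| "\<lbrakk>semisimple C X; simple C S; biproduct C X S Y\<rbrakk> \<Longrightarrow> semisimple C Y"

definition subquotient :: "('o, 'a, 'k) mon_cat \<Rightarrow> 'o \<Rightarrow> 'o \<Rightarrow> bool" where
  "subquotient C M' M \<longleftrightarrow> M' \<in> Ob C \<and> M \<in> Ob C \<and>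
     (\<exists>X \<in> Ob C. \<exists>i p. mono_arrow C X M i \<and> epi_arrow C X M' p)"

text \<open>The head is the largest semisimple quotient; it is determined up to isomorphism, and
  \<open>head_obj\<close> picks a representative.\<close>

definition is_head :: "('o, 'a, 'k) mon_cat \<Rightarrow> 'o \<Rightarrow> 'o \<Rightarrow> bool" where
  "is_head C X H \<longleftrightarrow> H \<in> Ob C \<and> semisimple C H \<and>
     (\<exists>p. epi_arrow C X H p \<and>
        (\<forall>Q \<in> Ob C. \<forall>q. semisimple C Q \<longrightarrow> epi_arrow C X Q q \<longrightarrow>
           (\<exists>r \<in> arrows C H Q. Comp C r p = q)))"

definition head_obj :: "('o, 'a, 'k) mon_cat \<Rightarrow> 'o \<Rightarrow> 'o" where
  "head_obj C X = (SOME H. is_head C X H)"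

definition head_prod :: "('o, 'a, 'k) mon_cat \<Rightarrow> 'o \<Rightarrow> 'o \<Rightarrow> 'o" where
  "head_prod C M N = head_obj C (Tens C M N)"

definition real_simple :: "('o, 'a, 'k) mon_cat \<Rightarrow> 'o \<Rightarrow> bool" where
  "real_simple C M \<longleftrightarrow> simple C M \<and> simple C (Tens C M M)"

definition strongly_commute :: "('o, 'a, 'k) mon_cat \<Rightarrow> 'o \<Rightarrow> 'o \<Rightarrow> bool" where
  "strongly_commute C M N \<longleftrightarrow> simple C M \<and> simple C N \<and>
     isomorphic C (Tens C M N) (Tens C N M) \<and> simple C (Tens C M N)"


section \<open>Grothendieck ring\<close>

text \<open>The free abelian group on the objects, with the biadditive extension of the tensor product
  as (in general non-associative) multiplication.\<close>

definition free_tensor_ring :: "('o, 'a, 'k) mon_cat \<Rightarrow> ('o \<Rightarrow>\<^sub>0 int) ring" where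
  "free_tensor_ring C =
     \<lparr>carrier = carrier (free_Abelian_group (Ob C)),
      monoid.mult = (\<lambda>p q. frag_extend (\<lambda>M. frag_extend (\<lambda>N. frag_of (Tens C M N)) q) p),
      one = frag_of (Unit C), zero = 0, add = (+)\<rparr>"

definition exact_relations :: "('o, 'a, 'k) mon_cat \<Rightarrow> ('o \<Rightarrow>\<^sub>0 int) set" where
  "exact_relations C = generate (free_Abelian_group (Ob C))
     {frag_of Y - frag_of X - frag_of Z | X Y Z. short_exact C X Y Z}"

text \<open>The multiplication of a library quotient ring sends two cosets to the union of the cosets of
  all products of representatives.  Hence \<open>ring (K0 C)\<close> says precisely that
  \<open>[M][N] = [M \<otimes> N]\<close> is a well-defined multiplication making \<open>K0 C\<close> a ring.\<close>

definition K0 :: "('o, 'a, 'k) mon_cat \<Rightarrow> ('o \<Rightarrow>\<^sub>0 int) set ring" where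
  "K0 C = FactRing (free_tensor_ring C) (exact_relations C)"

definition K0_class :: "('o, 'a, 'k) mon_cat \<Rightarrow> 'o \<Rightarrow> ('o \<Rightarrow>\<^sub>0 int) set" where
  "K0_class C M = a_r_coset (free_tensor_ring C) (exact_relations C) (frag_of M)"


section \<open>Monoidal categorification\<close>

definition monoidal_categorification :: "nat \<Rightarrow> nat \<Rightarrow> (nat list \<Rightarrow> nat \<Rightarrow> 'f::field_char_0) \<Rightarrow>
    'k ring \<Rightarrow> ('o, 'a, 'k) mon_cat \<Rightarrow> (('o \<Rightarrow>\<^sub>0 int) set \<Rightarrow> 'f) \<Rightarrow> bool" where
  "monoidal_categorification m n x K C \<phi> \<longleftrightarrow>
     linear_monoidal_abelian_category K C \<and> (\<forall>X \<in> Ob C. finite_length C X) \<and>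
     ring (K0 C) \<and> \<phi> \<in> ring_iso (K0 C) (cluster_algebra m n x) \<and>
     (\<forall>u \<in> cluster_monomials m n x. \<exists>M. simple C M \<and> \<phi> (K0_class C M) = u)"

definition reachable :: "nat \<Rightarrow> nat \<Rightarrow> (nat list \<Rightarrow> nat \<Rightarrow> 'f::field_char_0) \<Rightarrow>
    ('o, 'a, 'k) mon_cat \<Rightarrow> (('o \<Rightarrow>\<^sub>0 int) set \<Rightarrow> 'f) \<Rightarrow> 'o \<Rightarrow> bool" where
  "reachable m n x C \<phi> M \<longleftrightarrow> simple C M \<and> \<phi> (K0_class C M) \<in> cluster_monomials m n x"

definition monoidal_cluster :: "(nat list \<Rightarrow> nat \<Rightarrow> 'f::field_char_0) \<Rightarrow>
    ('o, 'a, 'k) mon_cat \<Rightarrow> (('o \<Rightarrow>\<^sub>0 int) set \<Rightarrow> 'f) \<Rightarrow> nat list \<Rightarrow> nat \<Rightarrow> 'o" where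
  "monoidal_cluster x C \<phi> t i = (SOME M. simple C M \<and> \<phi> (K0_class C M) = x t i)"

definition Lambda_mat :: "nat \<Rightarrow> (nat list \<Rightarrow> nat \<Rightarrow> 'f::field_char_0) \<Rightarrow>
    ('o, 'a, 'k) mon_cat \<Rightarrow> (('o \<Rightarrow>\<^sub>0 int) set \<Rightarrow> 'f) \<Rightarrow> ('o \<Rightarrow> 'o \<Rightarrow> int) \<Rightarrow>
    nat list \<Rightarrow> int mat" where
  "Lambda_mat m x C \<phi> \<Lambda> t =
     mat m m (\<lambda>(i, j). \<Lambda> (monoidal_cluster x C \<phi> t i) (monoidal_cluster x C \<phi> t j))"

definition dfun :: "('o \<Rightarrow> 'o \<Rightarrow> int) \<Rightarrow> 'o \<Rightarrow> 'o \<Rightarrow> rat" where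
  "dfun \<Lambda> M N = of_int (\<Lambda> M N + \<Lambda> N M) / 2"

locale Lambda_structure =
  fixes C :: "('o, 'a, 'k) mon_cat" and \<Omega> :: "'o set" and \<Lambda> :: "'o \<Rightarrow> 'o \<Rightarrow> int"
  assumes Omega_nonzero: "M \<in> \<Omega> \<Longrightarrow> M \<in> Ob C \<and> \<not> zero_object C M"
    and Omega_simple: "simple C M \<Longrightarrow> M \<in> \<Omega>"
    and Omega_iso: "\<lbrakk>M \<in> \<Omega>; isomorphic C M M'\<rbrakk> \<Longrightarrow> M' \<in> \<Omega>"
    and Omega_Tens: "\<lbrakk>M \<in> \<Omega>; N \<in> \<Omega>\<rbrakk> \<Longrightarrow> Tens C M N \<in> \<Omega>"
    and Omega_subquotient: "\<lbrakk>M \<in> \<Omega>; subquotient C M' M; \<not> zero_object C M'\<rbrakk> \<Longrightarrow> M' \<in> \<Omega>"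
    and Lambda_iso: "\<lbrakk>M \<in> \<Omega>; N \<in> \<Omega>; isomorphic C M M'; isomorphic C N N'\<rbrakk>
          \<Longrightarrow> \<Lambda> M N = \<Lambda> M' N'"
    and Lambda_commute: "\<lbrakk>real_simple C M; real_simple C N; strongly_commute C M N\<rbrakk>
          \<Longrightarrow> dfun \<Lambda> M N = 0"
    and Lambda_Tens: "\<lbrakk>M \<in> \<Omega>; N \<in> \<Omega>; L \<in> \<Omega>; simple C L\<rbrakk>
          \<Longrightarrow> \<Lambda> (Tens C M N) L = \<Lambda> M L + \<Lambda> N L \<and> \<Lambda> L (Tens C M N) = \<Lambda> L M + \<Lambda> L N"
    and Lambda_head_left: "\<lbrakk>simple C M; simple C N; real_simple C L; strongly_commute C L N\<rbrakk>
          \<Longrightarrow> \<Lambda> (head_prod C M N) L = \<Lambda> M L + \<Lambda> N L"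
    and Lambda_head_right: "\<lbrakk>simple C M; simple C N; real_simple C L; strongly_commute C L M\<rbrakk>
          \<Longrightarrow> \<Lambda> L (head_prod C M N) = \<Lambda> L M + \<Lambda> L N"
    and Lambda_subquotient: "\<lbrakk>M \<in> \<Omega>; N \<in> \<Omega>; subquotient C M' M; \<not> zero_object C M';
          subquotient C N' N; \<not> zero_object C N'\<rbrakk> \<Longrightarrow> \<Lambda> M' N' \<le> \<Lambda> M N"

definition Lambda_monoidal_categorification :: "nat \<Rightarrow> nat \<Rightarrow>
    (nat list \<Rightarrow> nat \<Rightarrow> 'f::field_char_0) \<Rightarrow> (nat list \<Rightarrow> int mat) \<Rightarrow>
    'k ring \<Rightarrow> ('o, 'a, 'k) mon_cat \<Rightarrow> (('o \<Rightarrow>\<^sub>0 int) set \<Rightarrow> 'f) \<Rightarrow>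
    'o set \<Rightarrow> ('o \<Rightarrow> 'o \<Rightarrow> int) \<Rightarrow> bool" where
  "Lambda_monoidal_categorification m n x B K C \<phi> \<Omega> \<Lambda> \<longleftrightarrow>
     monoidal_categorification m n x K C \<phi> \<and> Lambda_structure C \<Omega> \<Lambda> \<and>
     (\<forall>M N. simple C M \<and> simple C N \<and> (real_simple C M \<or> real_simple C N) \<longrightarrow>
        simple C (head_prod C M N)) \<and>
     (\<exists>w \<in> tree_vertices n. \<exists>s. compatible_pair m n (B w) (Lambda_mat m x C \<phi> \<Lambda> w) s)"

end

theory Submission
  imports Defs
begin

text \<open>Fix a reachable simple object with class \<open>u\<close>.  Since \<open>\<phi>\<close> identifies the cluster algebra with a
  Grothendieck ring, classes of simple objects form a basis with nonnegative structure constants.  If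
  \<open>x\<^sub>t\<^sup>a u\<close> expands in monomials of the cluster at \<open>t\<close>, multiplying by a power of \<open>x\<^sub>k'\<close> and using the exchange
  relation \<open>x\<^sub>k x\<^sub>k' = X + Y\<close> turns it into a sum of classes of objects; by positivity every summand
  expands in monomials of the adjacent cluster, and the Laurent expansion of \<open>u\<close> is carried along the
  tree.  By (a4) and (a5) the head of the product of \<open>x\<^sub>t\<^sup>a\<close> and \<open>u\<close> maximises all \<open>\<Lambda>(x\<^sub>i, _)\<close> among
  these monomials, so compatibility of \<open>\<Lambda>\<close> with the exchange matrix makes the expansion pointed at the
  head: this yields the g-vector and \<open>(\<Lambda>\<^sub>t g)\<^sub>i = \<Lambda>(x\<^sub>i, u)\<close>.  The multiplicity of the head does not change across an
  edge, and is 1 at a cluster of which \<open>u\<close> is a monomial.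

  Across an edge labelled \<open>k\<close> the vector \<open>a\<close> may be chosen with \<open>a\<^sub>k = 0\<close>, in which case both \<open>x\<^sub>k\<close> and
  \<open>x\<^sub>k'\<close> commute with \<open>x\<^sub>t\<^sup>a\<close>; this gives the tropical exchange relation for \<open>\<Lambda>(_, u)\<close>.  Hence the
  max-plus homomorphism that agrees with \<open>\<Lambda>(_, u)\<close> on the initial cluster agrees with it on
  every cluster, and it is the tropical point of \<open>u\<close>.\<close>

section \<open>Linear abelian categories\<close>

text \<open>Neither Laurent positivity nor pointedness of cluster monomials is assumed, and
  g-vector, F-polynomial and tropical point are given by definite descriptions, so existence and
  uniqueness of all three have to come out of the categorification itself. The substitute for
  positivity is absence of cancellation: in a sum of object classes every composition factor of a
  summand survives. One head serves all i because x_i commutes with x^a: (a4) gives \<Lambda>(x_i,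
  head) = \<Lambda>(x_i, x^a) + \<Lambda>(x_i, u), and (a5) bounds every other factor by the same
  value. A factor whose exponent vector exceeds that of the head by B_t v has \<Lambda>(x_i, _)
  smaller by s_i v_i, which forces v_i to be nonnegative for mutable i. The price of a_k = 0 is that
  the factors of x^a u may be monomials of either of the two adjacent clusters. Crossing an edge
  passes through this mixed situation, where the head may sit at either end; the symmetry between
  the ends, with X and Y exchanged, reduces one case to the other.\<close>

context linear_category
begin

lemma hom_group: "\<lbrakk>X \<in> Ob C; Y \<in> Ob C\<rbrakk> \<Longrightarrow> abelian_group (Hom C X Y)"
  using hom_module module.axioms(2) by blast

lemma zero_arrow_closed [simp]: "\<lbrakk>X \<in> Ob C; Y \<in> Ob C\<rbrakk> \<Longrightarrow> zero_arrow C X Y \<in> arrows C X Y"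
  using abelian_groupE(2) hom_group by blast

lemma Comp_zero_right [simp]:
  assumes "X \<in> Ob C" "Y \<in> Ob C" "Z \<in> Ob C" "g \<in> arrows C Y Z"
  shows "Comp C g (zero_arrow C X Y) = zero_arrow C X Z"
proof -
  interpret XY: abelian_group "Hom C X Y" using assms hom_group by blast
  interpret XZ: abelian_group "Hom C X Z" using assms hom_group by blast
  let ?a = "Comp C g (zero_arrow C X Y)"
  have a: "?a \<in> arrows C X Z" using assms Comp_arrow by auto
  have "?a \<oplus>\<^bsub>Hom C X Z\<^esub> ?a = ?a"
    using Comp_add_right[OF assms(1-3) _ _ assms(4), of "zero_arrow C X Y" "zero_arrow C X Y"] by simp
  then show ?thesis using a XZ.add.l_cancel_one' by metis
qed

lemma Comp_zero_left [simp]: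
  assumes "X \<in> Ob C" "Y \<in> Ob C" "Z \<in> Ob C" "f \<in> arrows C X Y"
  shows "Comp C (zero_arrow C Y Z) f = zero_arrow C X Z"
proof -
  interpret YZ: abelian_group "Hom C Y Z" using assms hom_group by blast
  interpret XZ: abelian_group "Hom C X Z" using assms hom_group by blast
  let ?a = "Comp C (zero_arrow C Y Z) f"
  have a: "?a \<in> arrows C X Z" using assms Comp_arrow by auto
  have "?a \<oplus>\<^bsub>Hom C X Z\<^esub> ?a = ?a"
    using Comp_add_left[OF assms(1-4), of "zero_arrow C Y Z" "zero_arrow C Y Z"] by simp
  then show ?thesis using a XZ.add.l_cancel_one' by metis
qed

lemma arrow_diff_eq_zero:
  assumes "X \<in> Ob C" "Y \<in> Ob C" "f \<in> arrows C X Y" "g \<in> arrows C X Y"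
  shows "f \<ominus>\<^bsub>Hom C X Y\<^esub> g \<in> arrows C X Y"
    and "f \<ominus>\<^bsub>Hom C X Y\<^esub> g = zero_arrow C X Y \<longleftrightarrow> f = g"
proof -
  interpret XY: abelian_group "Hom C X Y" using assms hom_group by blast
  show "f \<ominus>\<^bsub>Hom C X Y\<^esub> g \<in> arrows C X Y" using assms by simp
  show "f \<ominus>\<^bsub>Hom C X Y\<^esub> g = zero_arrow C X Y \<longleftrightarrow> f = g"
    using assms by (metis XY.add.inv_closed XY.add.inv_solve_right XY.minus_eq XY.l_zero XY.r_neg XY.zero_closed)
qed

lemma Comp_diff_right:
  assumes "X \<in> Ob C" "Y \<in> Ob C" "Z \<in> Ob C" "f \<in> arrows C X Y" "f' \<in> arrows C X Y" "g \<in> arrows C Y Z"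
  shows "Comp C g (f \<ominus>\<^bsub>Hom C X Y\<^esub> f') = Comp C g f \<ominus>\<^bsub>Hom C X Z\<^esub> Comp C g f'"
proof -
  interpret XY: abelian_group "Hom C X Y" using assms hom_group by blast
  interpret XZ: abelian_group "Hom C X Z" using assms hom_group by blast
  let ?d = "f \<ominus>\<^bsub>Hom C X Y\<^esub> f'"
  have d: "?d \<in> arrows C X Y" "?d \<oplus>\<^bsub>Hom C X Y\<^esub> f' = f"
    using assms by (auto simp: XY.minus_eq XY.a_assoc XY.l_neg)
  have "Comp C g ?d \<oplus>\<^bsub>Hom C X Z\<^esub> Comp C g f' = Comp C g f"
    using Comp_add_right[OF assms(1-3) d(1) assms(5,6)] d(2) by simp
  moreover have "Comp C g ?d \<in> arrows C X Z" "Comp C g f' \<in> arrows C X Z"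
    using assms d Comp_arrow by auto
  ultimately show ?thesis by (metis XZ.add.m_assoc XZ.add.inv_closed XZ.minus_eq XZ.r_neg XZ.r_zero)
qed

lemma Comp_diff_left:
  assumes "X \<in> Ob C" "Y \<in> Ob C" "Z \<in> Ob C" "f \<in> arrows C X Y" "g \<in> arrows C Y Z" "g' \<in> arrows C Y Z"
  shows "Comp C (g \<ominus>\<^bsub>Hom C Y Z\<^esub> g') f = Comp C g f \<ominus>\<^bsub>Hom C X Z\<^esub> Comp C g' f"
proof -
  interpret YZ: abelian_group "Hom C Y Z" using assms hom_group by blast
  interpret XZ: abelian_group "Hom C X Z" using assms hom_group by blast
  let ?d = "g \<ominus>\<^bsub>Hom C Y Z\<^esub> g'"
  have d: "?d \<in> arrows C Y Z" "?d \<oplus>\<^bsub>Hom C Y Z\<^esub> g' = g"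
    using assms by (auto simp: YZ.minus_eq YZ.a_assoc YZ.l_neg)
  have "Comp C ?d f \<oplus>\<^bsub>Hom C X Z\<^esub> Comp C g' f = Comp C g f"
    using Comp_add_left[OF assms(1-4) d(1) assms(6)] d(2) by simp
  moreover have "Comp C ?d f \<in> arrows C X Z" "Comp C g' f \<in> arrows C X Z"
    using assms d Comp_arrow by auto
  ultimately show ?thesis by (metis XZ.add.m_assoc XZ.add.inv_closed XZ.minus_eq XZ.r_neg XZ.r_zero)
qed

lemma mono_arrowI:
  assumes "X \<in> Ob C" "Y \<in> Ob C" "f \<in> arrows C X Y"
    and "\<And>W g. \<lbrakk>W \<in> Ob C; g \<in> arrows C W X; Comp C f g = zero_arrow C W Y\<rbrakk> \<Longrightarrow> g = zero_arrow C W X"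
  shows "mono_arrow C X Y f"
  unfolding mono_arrow_def
proof (intro conjI ballI impI)
  fix W g h assume *: "W \<in> Ob C" "g \<in> arrows C W X" "h \<in> arrows C W X" "Comp C f g = Comp C f h"
  then have "Comp C f (g \<ominus>\<^bsub>Hom C W X\<^esub> h) = zero_arrow C W Y"
    using assms Comp_diff_right[of W X Y g h f] arrow_diff_eq_zero Comp_arrow by metis
  then show "g = h" using * assms arrow_diff_eq_zero by metis
qed (use assms in auto)

lemma epi_arrowI:
  assumes "X \<in> Ob C" "Y \<in> Ob C" "f \<in> arrows C X Y"
    and "\<And>W g. \<lbrakk>W \<in> Ob C; g \<in> arrows C Y W; Comp C g f = zero_arrow C X W\<rbrakk> \<Longrightarrow> g = zero_arrow C Y W"
  shows "epi_arrow C X Y f"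
  unfolding epi_arrow_def
proof (intro conjI ballI impI)
  fix W g h assume *: "W \<in> Ob C" "g \<in> arrows C Y W" "h \<in> arrows C Y W" "Comp C g f = Comp C h f"
  then have "Comp C (g \<ominus>\<^bsub>Hom C Y W\<^esub> h) f = zero_arrow C X W"
    using assms Comp_diff_left[of X Y W f g h] arrow_diff_eq_zero Comp_arrow by metis
  then show "g = h" using * assms arrow_diff_eq_zero by metis
qed (use assms in auto)

lemma mono_arrow_cancel:
  "\<lbrakk>mono_arrow C X Y f; W \<in> Ob C; g \<in> arrows C W X; h \<in> arrows C W X; Comp C f g = Comp C f h\<rbrakk> \<Longrightarrow> g = h"
  unfolding mono_arrow_def by blast

lemma epi_arrow_cancel:
  "\<lbrakk>epi_arrow C X Y f; W \<in> Ob C; g \<in> arrows C Y W; h \<in> arrows C Y W; Comp C g f = Comp C h f\<rbrakk> \<Longrightarrow> g = h"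
  unfolding epi_arrow_def by blast

lemma mono_arrow_cancel_zero:
  "\<lbrakk>mono_arrow C X Y f; W \<in> Ob C; X \<in> Ob C; Y \<in> Ob C; g \<in> arrows C W X; Comp C f g = zero_arrow C W Y\<rbrakk>
    \<Longrightarrow> g = zero_arrow C W X"
  by (rule mono_arrow_cancel) (auto simp: mono_arrow_def)

lemma epi_arrow_cancel_zero:
  "\<lbrakk>epi_arrow C X Y f; W \<in> Ob C; X \<in> Ob C; Y \<in> Ob C; g \<in> arrows C Y W; Comp C g f = zero_arrow C X W\<rbrakk>
    \<Longrightarrow> g = zero_arrow C Y W"
  by (rule epi_arrow_cancel) (auto simp: epi_arrow_def)

lemma mono_arrow_Comp:
  assumes "X \<in> Ob C" "Y \<in> Ob C" "Z \<in> Ob C" "mono_arrow C X Y f" "mono_arrow C Y Z g"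
  shows "mono_arrow C X Z (Comp C g f)"
proof -
  have fg: "f \<in> arrows C X Y" "g \<in> arrows C Y Z" using assms unfolding mono_arrow_def by auto
  show ?thesis
  proof (rule mono_arrowI)
    fix W h assume h: "W \<in> Ob C" "h \<in> arrows C W X" "Comp C (Comp C g f) h = zero_arrow C W Z"
    then have "Comp C g (Comp C f h) = zero_arrow C W Z"
      using Comp_assoc[OF h(1) assms(1-3) h(2) fg] by simp
    then have "Comp C f h = zero_arrow C W Y"
      using mono_arrow_cancel_zero[OF assms(5)] assms h fg Comp_arrow by blast
    then show "h = zero_arrow C W X" using mono_arrow_cancel_zero[OF assms(4)] assms h by blast
  qed (use assms fg Comp_arrow in auto)
qed

lemma epi_arrow_Comp:
  assumes "X \<in> Ob C" "Y \<in> Ob C" "Z \<in> Ob C" "epi_arrow C X Y f" "epi_arrow C Y Z g"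
  shows "epi_arrow C X Z (Comp C g f)"
proof -
  have fg: "f \<in> arrows C X Y" "g \<in> arrows C Y Z" using assms unfolding epi_arrow_def by auto
  show ?thesis
  proof (rule epi_arrowI)
    fix W h assume h: "W \<in> Ob C" "h \<in> arrows C Z W" "Comp C h (Comp C g f) = zero_arrow C X W"
    then have "Comp C (Comp C h g) f = zero_arrow C X W"
      using Comp_assoc[OF assms(1-3) h(1) fg h(2)] by simp
    then have "Comp C h g = zero_arrow C Y W"
      using epi_arrow_cancel_zero[OF assms(4)] assms h fg Comp_arrow by blast
    then show "h = zero_arrow C Z W" using epi_arrow_cancel_zero[OF assms(5)] assms h by blast
  qed (use assms fg Comp_arrow in auto)
qed

lemma iso_arrow_mono:
  assumes "X \<in> Ob C" "Y \<in> Ob C" "iso_arrow C X Y f"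
  shows "mono_arrow C X Y f"
proof -
  obtain g where g: "f \<in> arrows C X Y" "g \<in> arrows C Y X" "Comp C g f = Id C X"
    using assms unfolding iso_arrow_def by blast
  show ?thesis
  proof (rule mono_arrowI)
    fix W h assume h: "W \<in> Ob C" "h \<in> arrows C W X" "Comp C f h = zero_arrow C W Y"
    have "h = Comp C (Comp C g f) h" using g h assms Comp_Id by metis
    also have "\<dots> = Comp C g (Comp C f h)" using Comp_assoc g h assms by metis
    finally show "h = zero_arrow C W X" using h g assms Comp_zero_right by metis
  qed (use assms g in auto)
qed

lemma iso_arrow_epi:
  assumes "X \<in> Ob C" "Y \<in> Ob C" "iso_arrow C X Y f"
  shows "epi_arrow C X Y f"
proof -
  obtain g where g: "f \<in> arrows C X Y" "g \<in> arrows C Y X" "Comp C f g = Id C Y"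
    using assms unfolding iso_arrow_def by blast
  show ?thesis
  proof (rule epi_arrowI)
    fix W h assume h: "W \<in> Ob C" "h \<in> arrows C Y W" "Comp C h f = zero_arrow C X W"
    have "h = Comp C h (Comp C f g)" using g h assms Comp_Id by metis
    also have "\<dots> = Comp C (Comp C h f) g" using Comp_assoc g h assms by metis
    finally show "h = zero_arrow C Y W" using h g assms Comp_zero_left by metis
  qed (use assms g in auto)
qed

lemma isomorphic_refl: "X \<in> Ob C \<Longrightarrow> isomorphic C X X"
  unfolding isomorphic_def iso_arrow_def using Id_arrow Comp_Id by blast

lemma isomorphic_sym: "isomorphic C X Y \<Longrightarrow> isomorphic C Y X"
  unfolding isomorphic_def iso_arrow_def by blast

lemma isomorphic_trans:
  assumes "isomorphic C X Y" "isomorphic C Y Z"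
  shows "isomorphic C X Z"
proof -
  obtain f f' where f: "f \<in> arrows C X Y" "f' \<in> arrows C Y X" "Comp C f' f = Id C X" "Comp C f f' = Id C Y"
    using assms(1) unfolding isomorphic_def iso_arrow_def by blast
  obtain g g' where g: "g \<in> arrows C Y Z" "g' \<in> arrows C Z Y" "Comp C g' g = Id C Y" "Comp C g g' = Id C Z"
    using assms(2) unfolding isomorphic_def iso_arrow_def by blast
  have ob: "X \<in> Ob C" "Y \<in> Ob C" "Z \<in> Ob C" using assms unfolding isomorphic_def by auto
  have gf: "Comp C g f \<in> arrows C X Z" and fg': "Comp C f' g' \<in> arrows C Z X"
    using Comp_arrow ob f g by blast+
  have "Comp C (Comp C f' g') (Comp C g f) = Comp C f' (Comp C (Comp C g' g) f)"
    using Comp_assoc[OF ob(1,2,3) ob(2) f(1) g(1,2)] Comp_assoc[OF ob(1,3,2,1) gf g(2) f(2)] by simp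
  also have "\<dots> = Id C X" using f g ob Comp_Id by metis
  finally have 1: "Comp C (Comp C f' g') (Comp C g f) = Id C X" .
  have "Comp C (Comp C g f) (Comp C f' g') = Comp C g (Comp C (Comp C f f') g')"
    using Comp_assoc[OF ob(3,2,1,2) g(2) f(2,1)] Comp_assoc[OF ob(3,1,2,3) fg' f(1) g(1)] by simp
  also have "\<dots> = Id C Z" using f g ob Comp_Id by metis
  finally show ?thesis unfolding isomorphic_def iso_arrow_def using 1 gf fg' ob by blast
qed

lemma zero_object_iff: "X \<in> Ob C \<Longrightarrow> zero_object C X \<longleftrightarrow> Id C X = zero_arrow C X X"
proof
  assume X: "X \<in> Ob C" and "zero_object C X"
  then show "Id C X = zero_arrow C X X" unfolding zero_object_def using Id_arrow zero_arrow_closed by metis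
next
  assume X: "X \<in> Ob C" and I: "Id C X = zero_arrow C X X"
  have 1: "f = zero_arrow C X Y" if "Y \<in> Ob C" "f \<in> arrows C X Y" for f Y
    using that X I Comp_Id Comp_zero_right by metis
  have 2: "f = zero_arrow C Y X" if "Y \<in> Ob C" "f \<in> arrows C Y X" for f Y
    using that X I Comp_Id Comp_zero_left by metis
  show "zero_object C X" unfolding zero_object_def using X 1 2 zero_arrow_closed by metis
qed

lemma zero_object_arrow_to:
  "\<lbrakk>zero_object C X; Y \<in> Ob C; f \<in> arrows C Y X\<rbrakk> \<Longrightarrow> f = zero_arrow C Y X"
  unfolding zero_object_def using zero_arrow_closed by metis

lemma zero_object_arrow_from:
  "\<lbrakk>zero_object C X; Y \<in> Ob C; f \<in> arrows C X Y\<rbrakk> \<Longrightarrow> f = zero_arrow C X Y"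
  unfolding zero_object_def using zero_arrow_closed by metis

lemma is_kernelD:
  assumes "is_kernel C W X Y k f"
  shows "k \<in> arrows C W X" "f \<in> arrows C X Y" "Comp C f k = zero_arrow C W Y"
  using assms unfolding is_kernel_def by auto

lemma is_kernel_factor:
  assumes "is_kernel C W X Y k f" "V \<in> Ob C" "g \<in> arrows C V X" "Comp C f g = zero_arrow C V Y"
  obtains h where "h \<in> arrows C V W" "Comp C k h = g"
  using assms unfolding is_kernel_def by blast

lemma is_cokernelD:
  assumes "is_cokernel C X Y W f c"
  shows "f \<in> arrows C X Y" "c \<in> arrows C Y W" "Comp C c f = zero_arrow C X W"
  using assms unfolding is_cokernel_def by auto

lemma is_cokernel_factor:
  assumes "is_cokernel C X Y W f c" "V \<in> Ob C" "g \<in> arrows C Y V" "Comp C g f = zero_arrow C X V"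
  obtains h where "h \<in> arrows C W V" "Comp C h c = g"
  using assms unfolding is_cokernel_def by blast

lemma is_kernel_mono:
  assumes "W \<in> Ob C" "X \<in> Ob C" "Y \<in> Ob C" "is_kernel C W X Y k f"
  shows "mono_arrow C W X k"
proof (rule mono_arrowI)
  fix V g assume g: "V \<in> Ob C" "g \<in> arrows C V W" "Comp C k g = zero_arrow C V X"
  have "Comp C f (zero_arrow C V X) = zero_arrow C V Y" using is_kernelD(2)[OF assms(4)] assms g by simp
  then have "\<exists>!h. h \<in> arrows C V W \<and> Comp C k h = zero_arrow C V X"
    using assms(4) g(1) assms(2) unfolding is_kernel_def by (metis zero_arrow_closed)
  moreover have "Comp C k (zero_arrow C V W) = zero_arrow C V X"
    using is_kernelD(1)[OF assms(4)] assms g by simp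
  ultimately show "g = zero_arrow C V W" using g assms zero_arrow_closed by metis
qed (use assms is_kernelD in auto)

lemma is_cokernel_epi:
  assumes "X \<in> Ob C" "Y \<in> Ob C" "W \<in> Ob C" "is_cokernel C X Y W f c"
  shows "epi_arrow C Y W c"
proof (rule epi_arrowI)
  fix V g assume g: "V \<in> Ob C" "g \<in> arrows C W V" "Comp C g c = zero_arrow C Y V"
  have "Comp C (zero_arrow C Y V) f = zero_arrow C X V" using is_cokernelD(1)[OF assms(4)] assms g by simp
  then have "\<exists>!h. h \<in> arrows C W V \<and> Comp C h c = zero_arrow C Y V"
    using assms(4) g(1) assms(2) unfolding is_cokernel_def by (metis zero_arrow_closed)
  moreover have "Comp C (zero_arrow C W V) c = zero_arrow C Y V"
    using is_cokernelD(2)[OF assms(4)] assms g by simp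
  ultimately show "g = zero_arrow C W V" using g assms zero_arrow_closed by metis
qed (use assms is_cokernelD in auto)

lemma is_kernelI:
  assumes "W \<in> Ob C" "X \<in> Ob C" "Y \<in> Ob C" "mono_arrow C W X k" "f \<in> arrows C X Y"
    and "Comp C f k = zero_arrow C W Y"
    and "\<And>V g. \<lbrakk>V \<in> Ob C; g \<in> arrows C V X; Comp C f g = zero_arrow C V Y\<rbrakk>
            \<Longrightarrow> \<exists>h. h \<in> arrows C V W \<and> Comp C k h = g"
  shows "is_kernel C W X Y k f"
  unfolding is_kernel_def
proof (intro conjI ballI impI)
  fix V g assume g: "V \<in> Ob C" "g \<in> arrows C V X" "Comp C f g = zero_arrow C V Y"
  then show "\<exists>!h. h \<in> arrows C V W \<and> Comp C k h = g"
    using assms(7)[OF g] mono_arrow_cancel[OF assms(4) g(1)] by metis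
qed (use assms in \<open>auto simp: mono_arrow_def\<close>)

lemma is_cokernelI:
  assumes "X \<in> Ob C" "Y \<in> Ob C" "W \<in> Ob C" "epi_arrow C Y W c" "f \<in> arrows C X Y"
    and "Comp C c f = zero_arrow C X W"
    and "\<And>V g. \<lbrakk>V \<in> Ob C; g \<in> arrows C Y V; Comp C g f = zero_arrow C X V\<rbrakk>
            \<Longrightarrow> \<exists>h. h \<in> arrows C W V \<and> Comp C h c = g"
  shows "is_cokernel C X Y W f c"
  unfolding is_cokernel_def
proof (intro conjI ballI impI)
  fix V g assume g: "V \<in> Ob C" "g \<in> arrows C Y V" "Comp C g f = zero_arrow C X V"
  then show "\<exists>!h. h \<in> arrows C W V \<and> Comp C h c = g"
    using assms(7)[OF g] epi_arrow_cancel[OF assms(4) g(1)] by metis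
qed (use assms in \<open>auto simp: epi_arrow_def\<close>)

end

section \<open>Short exact sequences and simple objects\<close>

context linear_abelian_category
begin

text \<open>An epimorphism is the cokernel of some \<open>g\<close>, and \<open>g\<close> factors
  through the kernel \<open>k\<close>. So whatever kills \<open>k\<close> kills \<open>g\<close> and
  descends along \<open>f\<close>, which makes \<open>f\<close> the cokernel of its own
  kernel.\<close>

lemma short_exact_of_epi_kernel:
  assumes ob: "W \<in> Ob C" "X \<in> Ob C" "Y \<in> Ob C" and f: "epi_arrow C X Y f" and k: "is_kernel C W X Y k f"
  shows "short_exact C W X Y"
proof -
  note fa = is_kernelD[OF k]
  obtain V g where V: "V \<in> Ob C" and g: "is_cokernel C V X Y g f" using epi_is_cokernel[OF ob(2,3) f] by blast
  note ga = is_cokernelD[OF g]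
  obtain h where h: "h \<in> arrows C V W" "Comp C k h = g"
    using is_kernel_factor[OF k V ga(1,3)] by blast
  have "is_cokernel C W X Y k f"
  proof (rule is_cokernelI)
    fix U q assume q: "U \<in> Ob C" "q \<in> arrows C X U" "Comp C q k = zero_arrow C W U"
    have "Comp C q g = Comp C (Comp C q k) h"
      using Comp_assoc[OF V ob(1,2) q(1) h(1) fa(1) q(2)] h by simp
    then have "Comp C q g = zero_arrow C V U" using q h V ob by simp
    then show "\<exists>r. r \<in> arrows C Y U \<and> Comp C r f = q" using is_cokernel_factor[OF g q(1,2)] by blast
  qed (use ob f fa in auto)
  then show ?thesis unfolding short_exact_def using ob k by blast
qed

lemma short_exact_of_epi:
  assumes ob: "X \<in> Ob C" "Y \<in> Ob C" and f: "epi_arrow C X Y f"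
  obtains W k where "W \<in> Ob C" "is_kernel C W X Y k f" "short_exact C W X Y"
proof -
  have "f \<in> arrows C X Y" using f unfolding epi_arrow_def by auto
  then obtain W k where "W \<in> Ob C" "is_kernel C W X Y k f" using has_kernels ob by blast
  then show ?thesis using that short_exact_of_epi_kernel[OF _ ob f] by blast
qed

text \<open>The monomorphism is a kernel of some \<open>g\<close>, and \<open>g\<close> is zero
  because \<open>f\<close> is epi. The identity then factors through \<open>f\<close>, giving a
  right inverse, which cancellation of \<open>f\<close> turns into a two-sided one.\<close>

lemma mono_epi_iso:
  assumes ob: "X \<in> Ob C" "Y \<in> Ob C" and m: "mono_arrow C X Y f" and e: "epi_arrow C X Y f"
  shows "iso_arrow C X Y f"
proof -
  have f: "f \<in> arrows C X Y" using m unfolding mono_arrow_def by auto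
  obtain Z g where Z: "Z \<in> Ob C" and k: "is_kernel C X Y Z f g" using mono_is_kernel[OF ob m] by blast
  note g = is_kernelD[OF k]
  have "g = zero_arrow C Y Z" using epi_arrow_cancel_zero[OF e Z ob g(2,3)] .
  then have "Comp C g (Id C Y) = zero_arrow C Y Z" using ob Z Id_arrow by simp
  then obtain h where h: "h \<in> arrows C Y X" "Comp C f h = Id C Y"
    using is_kernel_factor[OF k ob(2)] Id_arrow[OF ob(2)] by blast
  have "Comp C f (Comp C h f) = f"
    using Comp_assoc[OF ob(1,2,1,2) f h(1) f] h Comp_Id[OF ob f] by simp
  then have "Comp C f (Comp C h f) = Comp C f (Id C X)" using Comp_Id[OF ob f] by simp
  then have "Comp C h f = Id C X"
    using mono_arrow_cancel[OF m ob(1)] Comp_arrow[OF ob(1,2,1) f h(1)] Id_arrow[OF ob(1)] by blast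
  then show ?thesis unfolding iso_arrow_def using f h by blast
qed

lemma simple_Ob: "simple C S \<Longrightarrow> S \<in> Ob C"
  unfolding simple_def by auto

text \<open>The image of \<open>f\<close>, taken as the kernel \<open>V\<close> of its cokernel, is
  a nonzero subobject of \<open>S\<close> and hence all of it; the cokernel therefore
  vanishes.\<close>

lemma nonzero_to_simple_epi:
  assumes X: "X \<in> Ob C" and S: "simple C S" and f: "f \<in> arrows C X S" "f \<noteq> zero_arrow C X S"
  shows "epi_arrow C X S f"
proof -
  note So = simple_Ob[OF S]
  obtain W c where W: "W \<in> Ob C" and c: "is_cokernel C X S W f c" using has_cokernels[OF X So f(1)] by blast
  note cD = is_cokernelD[OF c]
  obtain V k where V: "V \<in> Ob C" and k: "is_kernel C V S W k c" using has_kernels[OF So W cD(2)] by blast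
  note kD = is_kernelD[OF k]
  obtain f' where f': "f' \<in> arrows C X V" "Comp C k f' = f" using is_kernel_factor[OF k X f(1) cD(3)] by blast
  have "\<not> zero_object C V"
  proof
    assume "zero_object C V"
    then have "f' = zero_arrow C X V" using zero_object_arrow_to X f' by blast
    then show False using f' f kD X V So by simp
  qed
  then have "iso_arrow C V S k" using S is_kernel_mono[OF V So W k] V unfolding simple_def by blast
  then have "epi_arrow C V S k" using iso_arrow_epi V So by blast
  then have c0: "c = zero_arrow C S W" using epi_arrow_cancel_zero kD V So W by blast
  show ?thesis
  proof (rule epi_arrowI)
    fix U g assume g: "U \<in> Ob C" "g \<in> arrows C S U" "Comp C g f = zero_arrow C X U"
    obtain h where "h \<in> arrows C W U" "Comp C h c = g" using is_cokernel_factor[OF c g] by blast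
    then show "g = zero_arrow C S U" using c0 So W g(1) by simp
  qed (use X So f in auto)
qed

text \<open>Schur's argument: the kernel is zero or all of \<open>S\<close>, and in the latter case
  the epimorphism \<open>f\<close> is zero, contradicting that \<open>T\<close> is nonzero.\<close>

lemma epi_simple_simple_iso:
  assumes S: "simple C S" and T: "simple C T" and f: "epi_arrow C S T f"
  shows "iso_arrow C S T f"
proof -
  have fa: "f \<in> arrows C S T" using f unfolding epi_arrow_def by auto
  note ob = simple_Ob[OF S] simple_Ob[OF T]
  obtain W k where W: "W \<in> Ob C" and k: "is_kernel C W S T k f" using has_kernels[OF ob fa] by blast
  note kD = is_kernelD[OF k]
  have "zero_object C W \<or> iso_arrow C W S k"
    using S is_kernel_mono[OF W ob k] W unfolding simple_def by blast
  then show ?thesis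
  proof
    assume Z: "zero_object C W"
    have "mono_arrow C S T f"
    proof (rule mono_arrowI)
      fix V g assume g: "V \<in> Ob C" "g \<in> arrows C V S" "Comp C f g = zero_arrow C V T"
      obtain h where h: "h \<in> arrows C V W" "Comp C k h = g" using is_kernel_factor[OF k g] by blast
      then have "h = zero_arrow C V W" using zero_object_arrow_to Z g by blast
      then show "g = zero_arrow C V S" using h kD g ob W by simp
    qed (use ob fa in auto)
    then show ?thesis using mono_epi_iso ob f by blast
  next
    assume "iso_arrow C W S k"
    then have "epi_arrow C W S k" using iso_arrow_epi W ob by blast
    then have "f = zero_arrow C S T" using epi_arrow_cancel_zero kD W ob by blast
    then have "Comp C (Id C T) f = zero_arrow C S T" using ob Comp_Id fa by metis
    then have "Id C T = zero_arrow C T T" using epi_arrow_cancel_zero[OF f ob(2) ob] Id_arrow ob by blast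
    then show ?thesis using T zero_object_iff ob unfolding simple_def by blast
  qed
qed

text \<open>Each kernel arrow factors through the other, and the two factors are mutually inverse
  because both kernels are mono. This identifies two maximal subobjects as soon as each lies in the
  other.\<close>

lemma kernels_isomorphic:
  assumes ob: "X \<in> Ob C" "X' \<in> Ob C" "Y \<in> Ob C" "S \<in> Ob C" "S' \<in> Ob C"
    and k: "is_kernel C X Y S k g" and k': "is_kernel C X' Y S' k' g'"
    and 1: "Comp C g k' = zero_arrow C X' S" and 2: "Comp C g' k = zero_arrow C X S'"
  shows "isomorphic C X X'"
proof -
  note kD = is_kernelD[OF k] is_kernelD[OF k']
  obtain h where h: "h \<in> arrows C X' X" "Comp C k h = k'" using is_kernel_factor[OF k ob(2) kD(4) 1] by blast
  obtain h' where h': "h' \<in> arrows C X X'" "Comp C k' h' = k" using is_kernel_factor[OF k' ob(1) kD(1) 2] by blast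
  have "Comp C k (Comp C h h') = Comp C k (Id C X)"
    using Comp_assoc[OF ob(1,2,1,3) h'(1) h(1) kD(1)] h h' Comp_Id[OF ob(1,3) kD(1)] by simp
  then have a: "Comp C h h' = Id C X"
    using mono_arrow_cancel[OF is_kernel_mono[OF ob(1,3,4) k] ob(1)] Comp_arrow[OF ob(1,2,1) h'(1) h(1)] Id_arrow[OF ob(1)]
    by blast
  have "Comp C k' (Comp C h' h) = Comp C k' (Id C X')"
    using Comp_assoc[OF ob(2,1,2,3) h(1) h'(1) kD(4)] h h' Comp_Id[OF ob(2,3) kD(4)] by simp
  then have "Comp C h' h = Id C X'"
    using mono_arrow_cancel[OF is_kernel_mono[OF ob(2,3,5) k'] ob(2)] Comp_arrow[OF ob(2,1,2) h(1) h'(1)] Id_arrow[OF ob(2)]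
    by blast
  then show ?thesis unfolding isomorphic_def iso_arrow_def using a h h' ob by blast
qed

lemma short_exactE:
  assumes "short_exact C X Y Z"
  obtains f g where "X \<in> Ob C" "Y \<in> Ob C" "Z \<in> Ob C" "is_kernel C X Y Z f g" "is_cokernel C X Y Z f g"
    "mono_arrow C X Y f" "epi_arrow C Y Z g"
  using assms is_kernel_mono is_cokernel_epi unfolding short_exact_def by metis

lemma short_exact_Ob:
  "short_exact C X Y Z \<Longrightarrow> X \<in> Ob C \<and> Y \<in> Ob C \<and> Z \<in> Ob C"
  unfolding short_exact_def by blast

lemma short_exact_iso_middle:
  assumes "short_exact C X Y Z" "isomorphic C Y Y'"
  shows "short_exact C X Y' Z"
proof -
  obtain f g where fg: "X \<in> Ob C" "Y \<in> Ob C" "Z \<in> Ob C" "is_kernel C X Y Z f g" 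
    "mono_arrow C X Y f" "epi_arrow C Y Z g" using short_exactE[OF assms(1)] by metis
  obtain i j where ij: "Y' \<in> Ob C" "i \<in> arrows C Y Y'" "j \<in> arrows C Y' Y" "Comp C j i = Id C Y" "Comp C i j = Id C Y'"
    using assms(2) unfolding isomorphic_def iso_arrow_def by blast
  have iso: "iso_arrow C Y Y' i" "iso_arrow C Y' Y j" unfolding iso_arrow_def using ij by blast+
  have arr: "f \<in> arrows C X Y" "g \<in> arrows C Y Z" "Comp C g f = zero_arrow C X Z" using is_kernelD[OF fg(4)] .
  have m: "mono_arrow C X Y' (Comp C i f)" using mono_arrow_Comp[OF fg(1,2) ij(1) fg(5) iso_arrow_mono] fg ij iso by blast
  have e: "epi_arrow C Y' Z (Comp C g j)" using epi_arrow_Comp[OF ij(1) fg(2,3) iso_arrow_epi] fg ij iso by blast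
  have gj: "Comp C g j \<in> arrows C Y' Z" using e unfolding epi_arrow_def by auto
  have if_arr: "Comp C i f \<in> arrows C X Y'" using m unfolding mono_arrow_def by auto
  have "is_kernel C X Y' Z (Comp C i f) (Comp C g j)"
  proof (rule is_kernelI)
    have "Comp C j (Comp C i f) = f"
      using Comp_assoc[OF fg(1,2) ij(1) fg(2) arr(1) ij(2,3)] ij Comp_Id[OF fg(1,2) arr(1)] by simp
    then show "Comp C (Comp C g j) (Comp C i f) = zero_arrow C X Z"
      using Comp_assoc[OF fg(1) ij(1) fg(2,3) if_arr ij(3) arr(2)] arr(3) by simp
  next
    fix V q assume q: "V \<in> Ob C" "q \<in> arrows C V Y'" "Comp C (Comp C g j) q = zero_arrow C V Z"
    have jq: "Comp C j q \<in> arrows C V Y" using Comp_arrow[OF q(1) ij(1) fg(2) q(2) ij(3)] .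
    have "Comp C g (Comp C j q) = zero_arrow C V Z" using Comp_assoc[OF q(1) ij(1) fg(2,3) q(2) ij(3) arr(2)] q by simp
    then obtain h where h: "h \<in> arrows C V X" "Comp C f h = Comp C j q" using is_kernel_factor[OF fg(4) q(1) jq] by blast
    have "Comp C (Comp C i f) h = Comp C i (Comp C j q)" using Comp_assoc[OF q(1) fg(1,2) ij(1) h(1) arr(1) ij(2)] h by simp
    also have "\<dots> = q" using Comp_assoc[OF q(1) ij(1) fg(2) ij(1) q(2) ij(3,2)] ij Comp_Id[OF q(1) ij(1) q(2)] by simp
    finally show "\<exists>h. h \<in> arrows C V X \<and> Comp C (Comp C i f) h = q" using h by blast
  qed (use fg ij m gj in auto)
  then show ?thesis using short_exact_of_epi_kernel[OF fg(1) ij(1) fg(3) e] by blast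
qed

lemma zero_object_iso:
  assumes "zero_object C X" "isomorphic C X Y"
  shows "zero_object C Y"
proof -
  obtain i j where ij: "X \<in> Ob C" "Y \<in> Ob C" "i \<in> arrows C X Y" "j \<in> arrows C Y X" "Comp C i j = Id C Y"
    using assms(2) unfolding isomorphic_def iso_arrow_def by blast
  have "i = zero_arrow C X Y" using zero_object_arrow_from assms(1) ij by blast
  then show ?thesis using ij zero_object_iff by simp
qed

lemma short_exact_zero_quotient:
  assumes "short_exact C X Y Z" "zero_object C Z"
  shows "isomorphic C X Y"
proof -
  obtain f g where fg: "X \<in> Ob C" "Y \<in> Ob C" "Z \<in> Ob C" "is_kernel C X Y Z f g" 
    "mono_arrow C X Y f" using short_exactE[OF assms(1)] by metis
  note D = is_kernelD[OF fg(4)]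
  have g0: "g = zero_arrow C Y Z" using zero_object_arrow_to assms(2) fg D by blast
  have "is_kernel C Y Y Z (Id C Y) g"
  proof (rule is_kernelI)
    show "mono_arrow C Y Y (Id C Y)" using iso_arrow_mono fg(2) Id_arrow Comp_Id unfolding iso_arrow_def by blast
    show "Comp C g (Id C Y) = zero_arrow C Y Z" using g0 fg Id_arrow by simp
    show "\<exists>h. h \<in> arrows C V Y \<and> Comp C (Id C Y) h = q" if "V \<in> Ob C" "q \<in> arrows C V Y" for V q
      using that Comp_Id fg by blast
  qed (use fg D in auto)
  then show ?thesis using kernels_isomorphic[OF fg(1,2,2,3,3) fg(4)] D g0 fg Id_arrow by simp
qed

lemma short_exact_zero_sub:
  assumes "short_exact C X Y Z" "zero_object C X"
  shows "isomorphic C Y Z"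
proof -
  obtain f g where fg: "X \<in> Ob C" "Y \<in> Ob C" "Z \<in> Ob C" "is_kernel C X Y Z f g" 
    "epi_arrow C Y Z g" using short_exactE[OF assms(1)] by metis
  note D = is_kernelD[OF fg(4)]
  have "mono_arrow C Y Z g"
  proof (rule mono_arrowI)
    fix W q assume q: "W \<in> Ob C" "q \<in> arrows C W Y" "Comp C g q = zero_arrow C W Z"
    obtain h where h: "h \<in> arrows C W X" "Comp C f h = q" using is_kernel_factor[OF fg(4) q] by blast
    then have "h = zero_arrow C W X" using zero_object_arrow_to assms(2) q by blast
    then show "q = zero_arrow C W Y" using h fg D q by simp
  qed (use fg D in auto)
  then show ?thesis unfolding isomorphic_def using mono_epi_iso fg by blast
qed

lemma short_exact_zero_middle:
  assumes "short_exact C X Y Z" "zero_object C Y"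
  shows "zero_object C Z"
proof -
  obtain f g where fg: "X \<in> Ob C" "Y \<in> Ob C" "Z \<in> Ob C" "is_kernel C X Y Z f g"
    "epi_arrow C Y Z g" using short_exactE[OF assms(1)] by metis
  note D = is_kernelD[OF fg(4)]
  have g: "g = zero_arrow C Y Z" using zero_object_arrow_from assms(2) fg D by blast
  have "Comp C (Id C Z) g = zero_arrow C Y Z" using Comp_Id[OF fg(2,3) D(2)] g by simp
  then have "Id C Z = zero_arrow C Z Z" using epi_arrow_cancel_zero[OF fg(5,3,2,3)] Id_arrow[OF fg(3)] by blast
  then show ?thesis using zero_object_iff fg by blast
qed

text \<open>The third isomorphism theorem; the point is that the pullback of an epimorphism is an
  epimorphism, seen from the biproduct of the two sources.\<close>

lemma short_exact_pullback:
  assumes "short_exact C X Y Z" "short_exact C Z' Z S"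
  obtains Y' where "short_exact C Y' Y S" "short_exact C X Y' Z'"
proof -
  obtain f g where fg: "X \<in> Ob C" "Y \<in> Ob C" "Z \<in> Ob C" "is_kernel C X Y Z f g"
    "mono_arrow C X Y f" "epi_arrow C Y Z g" using short_exactE[OF assms(1)] by metis
  obtain i p where ip: "Z' \<in> Ob C" "S \<in> Ob C" "is_kernel C Z' Z S i p"
    "mono_arrow C Z' Z i" "epi_arrow C Z S p" using short_exactE[OF assms(2)] by metis
  note D = is_kernelD[OF fg(4)] and D' = is_kernelD[OF ip(3)]
  let ?pg = "Comp C p g"
  have pg: "epi_arrow C Y S ?pg" using epi_arrow_Comp fg ip by blast
  have pga: "?pg \<in> arrows C Y S" using pg unfolding epi_arrow_def by auto
  \<comment> \<open>The preimage of \<open>Z'\<close> in \<open>Y\<close> is realised as the kernel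
    of the composite onto \<open>S\<close>.\<close>
  obtain Y' k where Y': "Y' \<in> Ob C" and k: "is_kernel C Y' Y S k ?pg" and s: "short_exact C Y' Y S"
    using short_exact_of_epi[OF fg(2) ip(2) pg] by blast
  note kD = is_kernelD[OF k] and km = is_kernel_mono[OF Y' fg(2) ip(2) k]
  have pgk: "Comp C p (Comp C g k) = zero_arrow C Y' S"
    using Comp_assoc[OF Y' fg(2,3) ip(2) kD(1) D(2) D'(2)] kD(3) by simp
  have gk: "Comp C g k \<in> arrows C Y' Z" using Comp_arrow[OF Y' fg(2,3) kD(1) D(2)] .
  obtain q where q: "q \<in> arrows C Y' Z'" "Comp C i q = Comp C g k"
    using is_kernel_factor[OF ip(3) Y' gk pgk] by blast
  have "Comp C ?pg f = zero_arrow C X S"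
    using Comp_assoc[OF fg(1,2,3) ip(2) D(1,2) D'(2)] D(3) D'(2) fg ip by simp
  then obtain f' where f': "f' \<in> arrows C X Y'" "Comp C k f' = f" using is_kernel_factor[OF k fg(1) D(1)] by blast
  have "epi_arrow C Y' Z' q"
  proof (rule epi_arrowI)
    fix W w assume w: "W \<in> Ob C" "w \<in> arrows C Z' W" "Comp C w q = zero_arrow C Y' W"
    obtain P where "biproduct C Y Z' P" using has_biproducts[OF fg(2) ip(1)] by blast
    then obtain j1 j2 p1 p2 where P: "P \<in> Ob C" "j1 \<in> arrows C Y P" "j2 \<in> arrows C Z' P"
      "p1 \<in> arrows C P Y" "p2 \<in> arrows C P Z'" "Comp C p1 j1 = Id C Y" "Comp C p2 j2 = Id C Z'"
      "Comp C p2 j1 = zero_arrow C Y Z'"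
      unfolding biproduct_def by blast
    let ?u = "Comp C g p1" and ?v = "Comp C i p2"
    \<comment> \<open>The kernel of \<open>?d\<close> is the pullback of \<open>g\<close> and
      \<open>i\<close>, and \<open>?d\<close> is epi because its restriction along \<open>j1\<close>
      is \<open>g\<close>.\<close>
    let ?d = "?u \<ominus>\<^bsub>Hom C P Z\<^esub> ?v"
    have uv: "?u \<in> arrows C P Z" "?v \<in> arrows C P Z"
      using Comp_arrow[OF P(1) fg(2,3) P(4) D(2)] Comp_arrow[OF P(1) ip(1) fg(3) P(5) D'(1)] .
    have d: "?d \<in> arrows C P Z" using arrow_diff_eq_zero[OF P(1) fg(3) uv] by simp
    have uj: "Comp C ?u j1 = g"
      using Comp_assoc[OF fg(2) P(1) fg(2,3) P(2,4) D(2)] P(6) Comp_Id[OF fg(2,3) D(2)] by simp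
    have vj: "Comp C ?v j1 = zero_arrow C Y Z"
      using Comp_assoc[OF fg(2) P(1) ip(1) fg(3) P(2,5) D'(1)] P(8) D'(1) fg ip by simp
    interpret YZ: abelian_group "Hom C Y Z" using hom_group fg by blast
    have dj: "Comp C ?d j1 = g"
      using Comp_diff_left[OF fg(2) P(1) fg(3) P(2) uv] uj vj D(2) by (simp add: YZ.minus_eq)
    have de: "epi_arrow C P Z ?d"
    proof (rule epi_arrowI)
      fix U r assume r: "U \<in> Ob C" "r \<in> arrows C Z U" "Comp C r ?d = zero_arrow C P U"
      have "Comp C r g = Comp C (Comp C r ?d) j1" using Comp_assoc[OF fg(2) P(1) fg(3) r(1) P(2) d r(2)] dj by simp
      then have "Comp C r g = zero_arrow C Y U" using r P fg by simp
      then show "r = zero_arrow C Z U" using epi_arrow_cancel_zero[OF fg(6) r(1) fg(2,3) r(2)] by blast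
    qed (use P fg d in auto)
    obtain E e where E: "E \<in> Ob C" and e: "is_kernel C E P Z e ?d" and se: "short_exact C E P Z"
      using short_exact_of_epi[OF P(1) fg(3) de] by blast
    \<comment> \<open>As an epimorphism \<open>?d\<close> is the cokernel of some \<open>h0\<close>,
      whose two components agree in \<open>Z\<close> and so lift to an arrow \<open>y\<close> into
      \<open>Y'\<close>. Since \<open>w\<close> kills \<open>q\<close>, the arrow
      \<open>Comp C w p2\<close> kills \<open>h0\<close> and descends to \<open>Z\<close>; composing
      with \<open>g\<close> shows that the descended arrow is zero.\<close>
    obtain V h0 where V: "V \<in> Ob C" and h0: "is_cokernel C V P Z h0 ?d" using epi_is_cokernel[OF P(1) fg(3) de] by blast
    note h0D = is_cokernelD[OF h0]
    have p1h: "Comp C p1 h0 \<in> arrows C V Y" and p2h: "Comp C p2 h0 \<in> arrows C V Z'"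
      using Comp_arrow[OF V P(1) fg(2) h0D(1) P(4)] Comp_arrow[OF V P(1) ip(1) h0D(1) P(5)] .
    have "Comp C ?u h0 = Comp C ?v h0"
      using Comp_diff_left[OF V P(1) fg(3) h0D(1) uv] h0D(3) arrow_diff_eq_zero(2)[OF V fg(3)]
        Comp_arrow[OF V P(1) fg(3) h0D(1)] uv by metis
    then have eqh: "Comp C g (Comp C p1 h0) = Comp C i (Comp C p2 h0)"
      using Comp_assoc[OF V P(1) fg(2,3) h0D(1) P(4) D(2)] Comp_assoc[OF V P(1) ip(1) fg(3) h0D(1) P(5) D'(1)] by simp
    have "Comp C ?pg (Comp C p1 h0) = Comp C p (Comp C i (Comp C p2 h0))"
      using Comp_assoc[OF V fg(2,3) ip(2) p1h D(2) D'(2)] eqh by simp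
    also have "\<dots> = zero_arrow C V S"
      using Comp_assoc[OF V ip(1) fg(3) ip(2) p2h D'(1,2)] D'(3) p2h V ip by simp
    finally obtain y where y: "y \<in> arrows C V Y'" "Comp C k y = Comp C p1 h0" using is_kernel_factor[OF k V p1h] by blast
    have "Comp C i (Comp C q y) = Comp C i (Comp C p2 h0)"
      using Comp_assoc[OF V Y' ip(1) fg(3) y(1) q(1) D'(1)] Comp_assoc[OF V Y' fg(2,3) y(1) kD(1) D(2)] q(2) y(2) eqh by simp
    then have qy: "Comp C q y = Comp C p2 h0"
      using mono_arrow_cancel[OF ip(4) V] Comp_arrow[OF V Y' ip(1) y(1) q(1)] p2h by blast
    have wp: "Comp C w p2 \<in> arrows C P W" using Comp_arrow[OF P(1) ip(1) w(1) P(5) w(2)] .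
    have "Comp C (Comp C w p2) h0 = Comp C (Comp C w q) y"
      using Comp_assoc[OF V P(1) ip(1) w(1) h0D(1) P(5) w(2)] Comp_assoc[OF V Y' ip(1) w(1) y(1) q(1) w(2)] qy by simp
    then have "Comp C (Comp C w p2) h0 = zero_arrow C V W" using w y V Y' by simp
    then obtain h where h: "h \<in> arrows C Z W" "Comp C h ?d = Comp C w p2"
      using is_cokernel_factor[OF h0 w(1) wp] by blast
    have "Comp C h g = Comp C (Comp C w p2) j1" using Comp_assoc[OF fg(2) P(1) fg(3) w(1) P(2) d h(1)] dj h by simp
    also have "\<dots> = zero_arrow C Y W" using Comp_assoc[OF fg(2) P(1) ip(1) w(1) P(2,5) w(2)] P(8) w fg ip by simp
    finally have "h = zero_arrow C Z W" using epi_arrow_cancel_zero[OF fg(6) w(1) fg(2,3) h(1)] by blast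
    then have wp0: "Comp C w p2 = zero_arrow C P W" using h d P fg w by simp
    have "w = Comp C (Comp C w p2) j2"
      using Comp_assoc[OF ip(1) P(1) ip(1) w(1) P(3,5) w(2)] P(7) Comp_Id[OF ip(1) w(1,2)] by simp
    then show "w = zero_arrow C Z' W" using wp0 P ip w by simp
  qed (use Y' ip q in auto)
  moreover have "is_kernel C X Y' Z' f' q"
  proof (rule is_kernelI)
    show "mono_arrow C X Y' f'"
    proof (rule mono_arrowI)
      fix W r assume r: "W \<in> Ob C" "r \<in> arrows C W X" "Comp C f' r = zero_arrow C W Y'"
      have "Comp C f r = zero_arrow C W Y" using Comp_assoc[OF r(1) fg(1) Y' fg(2) r(2) f'(1) kD(1)] f' r kD Y' fg by simp
      then show "r = zero_arrow C W X" using mono_arrow_cancel_zero[OF fg(5) r(1) fg(1,2) r(2)] by blast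
    qed (use fg Y' f' in auto)
    have "Comp C i (Comp C q f') = zero_arrow C X Z"
      using Comp_assoc[OF fg(1) Y' ip(1) fg(3) f'(1) q(1) D'(1)] Comp_assoc[OF fg(1) Y' fg(2,3) f'(1) kD(1) D(2)] q f' D(3) by simp
    then show "Comp C q f' = zero_arrow C X Z'"
      using mono_arrow_cancel_zero[OF ip(4) fg(1) ip(1) fg(3)] Comp_arrow[OF fg(1) Y' ip(1) f'(1) q(1)] by blast
    fix V r assume r: "V \<in> Ob C" "r \<in> arrows C V Y'" "Comp C q r = zero_arrow C V Z'"
    have kr: "Comp C k r \<in> arrows C V Y" using Comp_arrow[OF r(1) Y' fg(2) r(2) kD(1)] .
    have "Comp C g (Comp C k r) = zero_arrow C V Z"
      using Comp_assoc[OF r(1) Y' ip(1) fg(3) r(2) q(1) D'(1)] Comp_assoc[OF r(1) Y' fg(2,3) r(2) kD(1) D(2)] q r D' ip fg by simp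
    then obtain h where h: "h \<in> arrows C V X" "Comp C f h = Comp C k r" using is_kernel_factor[OF fg(4) r(1) kr] by blast
    have "Comp C k (Comp C f' h) = Comp C k r" using Comp_assoc[OF r(1) fg(1) Y' fg(2) h(1) f'(1) kD(1)] f' h by simp
    then have "Comp C f' h = r" using mono_arrow_cancel[OF km r(1)] Comp_arrow[OF r(1) fg(1) Y' h(1) f'(1)] r by blast
    then show "\<exists>h. h \<in> arrows C V X \<and> Comp C f' h = r" using h by blast
  qed (use fg Y' ip q in auto)
  ultimately have "short_exact C X Y' Z'" using short_exact_of_epi_kernel fg Y' ip by blast
  then show ?thesis using that s by blast
qed

end

section \<open>Composition multiplicities\<close>

inductive comp_series :: "('o, 'a, 'k) mon_cat \<Rightarrow> 'o \<Rightarrow> 'o list \<Rightarrow> bool"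
  for C :: "('o, 'a, 'k) mon_cat" where
  zero: "zero_object C Z \<Longrightarrow> comp_series C Z []"
| step: "\<lbrakk>comp_series C X Ss; simple C S; short_exact C X Y S\<rbrakk> \<Longrightarrow> comp_series C Y (S # Ss)"

definition iso_count :: "('o, 'a, 'k) mon_cat \<Rightarrow> 'o list \<Rightarrow> 'o \<Rightarrow> nat" where
  "iso_count C Ss T = length (filter (\<lambda>S. isomorphic C S T) Ss)"

lemma iso_count_Nil [simp]: "iso_count C [] T = 0"
  and iso_count_Cons: "iso_count C (S # Ss) T = (if isomorphic C S T then 1 else 0) + iso_count C Ss T"
  and iso_count_append: "iso_count C (Ss @ Ts) T = iso_count C Ss T + iso_count C Ts T"
  unfolding iso_count_def by auto

text \<open>The choice of the series is immaterial by \<open>Jordan_Hoelder\<close>.\<close>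

definition comp_mult :: "('o, 'a, 'k) mon_cat \<Rightarrow> 'o \<Rightarrow> 'o \<Rightarrow> nat" where
  "comp_mult C X T = iso_count C (SOME Ss. comp_series C X Ss) T"

definition comp_length :: "('o, 'a, 'k) mon_cat \<Rightarrow> 'o \<Rightarrow> nat" where
  "comp_length C X = length (SOME Ss. comp_series C X Ss)"

locale finite_length_category = linear_abelian_category +
  assumes finite_length_Ob: "X \<in> Ob C \<Longrightarrow> finite_length C X"
begin

lemma ex_comp_series:
  assumes "X \<in> Ob C"
  shows "\<exists>Ss. comp_series C X Ss"
proof -
  have "finite_length C X" by (rule finite_length_Ob[OF assms])
  then show ?thesis by induction (blast intro: comp_series.intros)+
qed

lemma comp_series_iso:
  assumes "comp_series C X Ss" "isomorphic C X X'"
  shows "comp_series C X' Ss"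
  using assms(1)
proof cases
  case zero
  then show ?thesis using zero_object_iso assms(2) comp_series.zero by metis
next
  case (step W Ss' S)
  then show ?thesis using short_exact_iso_middle assms(2) comp_series.step by metis
qed

lemma comp_series_simple: "comp_series C X Ss \<Longrightarrow> S \<in> set Ss \<Longrightarrow> simple C S"
  by (induction rule: comp_series.induct) auto

lemma isomorphic_cong: "isomorphic C S S' \<Longrightarrow> isomorphic C S T \<longleftrightarrow> isomorphic C S' T"
  using isomorphic_sym isomorphic_trans by blast

text \<open>\<open>W\<close> is the intersection of the maximal subobjects \<open>X\<close> and \<open>X'\<close> of \<open>Y\<close>.\<close>

lemma short_exact_two_simple_quotients:
  assumes "short_exact C X Y S" "short_exact C X' Y S'" "simple C S" "simple C S'"
  shows "(isomorphic C X X' \<and> isomorphic C S S') \<or> (\<exists>W. short_exact C W X S' \<and> short_exact C W X' S)"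
proof -
  obtain f g where fg: "X \<in> Ob C" "Y \<in> Ob C" "S \<in> Ob C" "is_kernel C X Y S f g" "is_cokernel C X Y S f g"
    "mono_arrow C X Y f" "epi_arrow C Y S g" using short_exactE[OF assms(1)] by metis
  obtain f' g' where fg': "X' \<in> Ob C" "Y \<in> Ob C" "S' \<in> Ob C" "is_kernel C X' Y S' f' g'" "is_cokernel C X' Y S' f' g'"
    "mono_arrow C X' Y f'" "epi_arrow C Y S' g'" using short_exactE[OF assms(2)] by metis
  note D = is_kernelD[OF fg(4)] and D' = is_kernelD[OF fg'(4)]
  let ?r = "Comp C g f'" and ?r' = "Comp C g' f"
  have r: "?r \<in> arrows C X' S" and r': "?r' \<in> arrows C X S'"
    using Comp_arrow[OF fg'(1,2) fg(3) D'(1) D(2)] Comp_arrow[OF fg(1,2) fg'(3) D(1) D'(2)] .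
  have quot: "\<exists>h. h \<in> arrows C T' T \<and> Comp C h q' = q \<and> iso_arrow C T' T h"
    if T: "simple C T" "simple C T'" and q': "is_cokernel C U' Y T' e' q'" and q: "epi_arrow C Y T q"
      and 0: "Comp C q e' = zero_arrow C U' T"
    for T T' U' e' q' q
  proof -
    have ob: "T \<in> Ob C" "T' \<in> Ob C" using T simple_Ob by auto
    note e = is_cokernelD[OF q']
    have qa: "q \<in> arrows C Y T" using q unfolding epi_arrow_def by auto
    obtain h where h: "h \<in> arrows C T' T" "Comp C h q' = q" using is_cokernel_factor[OF q' ob(1) qa 0] .
    have "h \<noteq> zero_arrow C T' T"
    proof
      assume "h = zero_arrow C T' T"
      then have "q = zero_arrow C Y T" using h e fg(2) ob by simp
      then have "Comp C (Id C T) q = zero_arrow C Y T" using qa ob fg(2) Comp_Id by simp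
      then have "Id C T = zero_arrow C T T" using epi_arrow_cancel_zero[OF q ob(1) fg(2) ob(1)] Id_arrow ob by blast
      then show False using T(1) zero_object_iff ob unfolding simple_def by blast
    qed
    then have "epi_arrow C T' T h" using nonzero_to_simple_epi[OF ob(2) T(1) h(1)] by blast
    then show ?thesis using epi_simple_simple_iso T h by blast
  qed
  have ker0: "Comp C q0 e = zero_arrow C U T0"
    if "iso_arrow C T0 T h" "Comp C h q0 = q" "Comp C q e = zero_arrow C U T" "U \<in> Ob C" "T0 \<in> Ob C" "T \<in> Ob C"
      "q0 \<in> arrows C Y T0" "e \<in> arrows C U Y" for T T0 U h q0 q e
  proof -
    have h: "h \<in> arrows C T0 T" using that unfolding iso_arrow_def by auto
    have "Comp C h (Comp C q0 e) = zero_arrow C U T" using Comp_assoc[OF that(4) fg(2) that(5,6,8,7) h] that by simp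
    then show ?thesis
      using mono_arrow_cancel_zero[OF iso_arrow_mono[OF that(5,6,1)] that(4,5,6)] Comp_arrow[OF that(4) fg(2) that(5,8,7)]
      by blast
  qed
  show ?thesis
  \<comment> \<open>Vanishing of \<open>?r\<close> or \<open>?r'\<close> means that one maximal
    subobject lies in the other; they then coincide. Otherwise both arrows are epi onto simple
    objects, and the kernel of \<open>?r\<close> is the required \<open>W\<close>.\<close>
  proof (cases "?r = zero_arrow C X' S \<or> ?r' = zero_arrow C X S'")
    case True
    then show ?thesis
    proof
      assume 0: "?r = zero_arrow C X' S"
      obtain h where h: "h \<in> arrows C S' S" "Comp C h g' = g" "iso_arrow C S' S h"
        using quot[OF assms(3,4) fg'(5) fg(7) 0] by blast
      have "?r' = zero_arrow C X S'" using ker0[OF h(3,2) D(3) fg(1) fg'(3) fg(3) D'(2) D(1)] .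
      then have "isomorphic C X X'" using kernels_isomorphic[OF fg(1) fg'(1,2) fg(3) fg'(3) fg(4) fg'(4) 0] by blast
      then show ?thesis using h isomorphic_sym fg fg' unfolding isomorphic_def by blast
    next
      assume 0: "?r' = zero_arrow C X S'"
      obtain h where h: "h \<in> arrows C S S'" "Comp C h g = g'" "iso_arrow C S S' h"
        using quot[OF assms(4,3) fg(5) fg'(7) 0] by blast
      have "?r = zero_arrow C X' S" using ker0[OF h(3,2) D'(3) fg'(1) fg(3) fg'(3) D(2) D'(1)] .
      then have "isomorphic C X X'" using kernels_isomorphic[OF fg(1) fg'(1,2) fg(3) fg'(3) fg(4) fg'(4)] 0 by blast
      then show ?thesis using h fg fg' unfolding isomorphic_def by blast
    qed
  next
    case False
    have e: "epi_arrow C X' S ?r" using nonzero_to_simple_epi[OF fg'(1) assms(3) r] False by blast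
    have e': "epi_arrow C X S' ?r'" using nonzero_to_simple_epi[OF fg(1) assms(4) r'] False by blast
    obtain W k where W: "W \<in> Ob C" "is_kernel C W X' S k ?r" and s: "short_exact C W X' S"
      using short_exact_of_epi[OF fg'(1) fg(3) e] by blast
    note kD = is_kernelD[OF W(2)]
    have fk: "Comp C f' k \<in> arrows C W Y" using Comp_arrow[OF W(1) fg'(1,2) kD(1) D'(1)] .
    have gfk: "Comp C g (Comp C f' k) = zero_arrow C W S"
      using Comp_assoc[OF W(1) fg'(1,2) fg(3) kD(1) D'(1) D(2)] kD(3) by simp
    obtain k' where k': "k' \<in> arrows C W X" "Comp C f k' = Comp C f' k"
      using is_kernel_factor[OF fg(4) W(1) fk gfk] .
    have "is_kernel C W X S' k' ?r'"
    proof (rule is_kernelI)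
      show "mono_arrow C W X k'"
      proof (rule mono_arrowI)
        fix V q assume q: "V \<in> Ob C" "q \<in> arrows C V W" "Comp C k' q = zero_arrow C V X"
        have "Comp C (Comp C f' k) q = zero_arrow C V Y"
          using Comp_assoc[OF q(1) W(1) fg(1,2) q(2) k'(1) D(1)] k'(2) q(3) D(1) fg q(1) by simp
        then show "q = zero_arrow C V W"
          using mono_arrow_cancel_zero[OF mono_arrow_Comp[OF W(1) fg'(1,2) is_kernel_mono[OF W(1) fg'(1) fg(3) W(2)] fg'(6)]
              q(1) W(1) fg'(2) q(2)] by blast
      qed (use W fg k' in auto)
      show "Comp C ?r' k' = zero_arrow C W S'"
        using Comp_assoc[OF W(1) fg(1,2) fg'(3) k'(1) D(1) D'(2)] k'(2)
          Comp_assoc[OF W(1) fg'(1,2,3) kD(1) D'(1,2)] D'(3) kD(1) W(1) fg' by simp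
      fix V q assume q: "V \<in> Ob C" "q \<in> arrows C V X" "Comp C ?r' q = zero_arrow C V S'"
      have fq: "Comp C f q \<in> arrows C V Y" using Comp_arrow[OF q(1) fg(1,2) q(2) D(1)] .
      have "Comp C g' (Comp C f q) = zero_arrow C V S'"
        using Comp_assoc[OF q(1) fg(1,2) fg'(3) q(2) D(1) D'(2)] q(3) by simp
      then obtain p where p: "p \<in> arrows C V X'" "Comp C f' p = Comp C f q"
        using is_kernel_factor[OF fg'(4) q(1) fq] by blast
      have "Comp C ?r p = Comp C (Comp C g f) q"
        using Comp_assoc[OF q(1) fg'(1,2) fg(3) p(1) D'(1) D(2)] p(2) Comp_assoc[OF q(1) fg(1,2,3) q(2) D(1,2)] by simp
      then have "Comp C ?r p = zero_arrow C V S" using D(3) q fg by simp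
      then obtain h where h: "h \<in> arrows C V W" "Comp C k h = p" using is_kernel_factor[OF W(2) q(1) p(1)] by blast
      have "Comp C f (Comp C k' h) = Comp C f q"
        using Comp_assoc[OF q(1) W(1) fg(1,2) h(1) k'(1) D(1)] Comp_assoc[OF q(1) W(1) fg'(1,2) h(1) kD(1) D'(1)] k' h p by simp
      then have "Comp C k' h = q"
        using mono_arrow_cancel[OF fg(6) q(1)] Comp_arrow[OF q(1) W(1) fg(1) h(1) k'(1)] q(2) by blast
      then show "\<exists>h. h \<in> arrows C V W \<and> Comp C k' h = q" using h by blast
    qed (use W fg fg' r' in auto)
    then have "short_exact C W X S'" using short_exact_of_epi_kernel[OF W(1) fg(1) fg'(3) e'] by blast
    then show ?thesis using s by blast
  qed
qed

lemma comp_series_Nil_iff: "comp_series C X [] \<longleftrightarrow> zero_object C X"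
  by (auto elim: comp_series.cases intro: comp_series.intros)

text \<open>Induction on the length of the first series. If the maximal subobjects differ, a series
  \<open>Us\<close> of their intersection extends to \<open>S' # Us\<close> and
  \<open>S # Us\<close>. These are compared with the two given tails, and the second comparison is
  available because the first one has fixed the length of \<open>Us\<close>.\<close>

theorem Jordan_Hoelder:
  assumes "comp_series C Y Ss" "comp_series C Y Ts"
  shows "length Ss = length Ts" and "iso_count C Ss T = iso_count C Ts T"
proof -
  have "length Ss = length Ts \<and> (\<forall>T. iso_count C Ss T = iso_count C Ts T)"
    using assms
  proof (induction "length Ss" arbitrary: Y Ss Ts rule: less_induct)
    case less
    show ?case using less.prems(1)
    proof cases
      case zero
      have "\<not> comp_series C Y (S # Ts')" for S Ts'
      proof
        assume "comp_series C Y (S # Ts')"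
        then show False
          by cases (use zero short_exact_zero_middle in \<open>auto simp: simple_def\<close>)
      qed
      then show ?thesis using zero less.prems by (cases Ts) auto
    next
      case (step X Ss' S)
      note Ss = step
      show ?thesis using less.prems(2)
      proof cases
        case zero
        then have "zero_object C S" using short_exact_zero_middle[OF Ss(4)] by simp
        then show ?thesis using Ss(3) unfolding simple_def by simp
      next
        case (step X' Ts' S')
        have IH: "length Us = length Vs \<and> (\<forall>T. iso_count C Us T = iso_count C Vs T)"
          if "length Us = length Ss'" "comp_series C Z Us" "comp_series C Z Vs" for Us Vs Z
          using less.hyps[of Us Z Vs] that Ss(1) by simp
        show ?thesis
          using short_exact_two_simple_quotients[OF Ss(4) step(4) Ss(3) step(3)]
        proof (elim disjE conjE exE)
          assume iso: "isomorphic C X X'" "isomorphic C S S'"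
          have "comp_series C X Ts'" using comp_series_iso step(2) iso isomorphic_sym by blast
          then have "length Ss' = length Ts' \<and> (\<forall>T. iso_count C Ss' T = iso_count C Ts' T)" using IH Ss(2) by blast
          then show ?thesis using Ss(1) step(1) isomorphic_cong[OF iso(2)] by (simp add: iso_count_Cons)
        next
          fix W assume W: "short_exact C W X S'" "short_exact C W X' S"
          then obtain Us where Us: "comp_series C W Us" using ex_comp_series short_exact_Ob by metis
          have a: "comp_series C X (S' # Us)" "comp_series C X' (S # Us)"
            using comp_series.step[OF Us step(3) W(1)] comp_series.step[OF Us Ss(3) W(2)] .
          have 1: "length Ss' = length (S' # Us) \<and> (\<forall>T. iso_count C Ss' T = iso_count C (S' # Us) T)"
            using IH[OF _ Ss(2) a(1)] by simp
          have 2: "length (S # Us) = length Ts' \<and> (\<forall>T. iso_count C (S # Us) T = iso_count C Ts' T)"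
            using IH[OF _ a(2) step(2)] 1 by simp
          show ?thesis using 1 2 Ss(1) step(1) by (auto simp: iso_count_Cons)
        qed
      qed
    qed
  qed
  then show "length Ss = length Ts" and "iso_count C Ss T = iso_count C Ts T" by auto
qed

lemma comp_mult_eq: "comp_series C X Ss \<Longrightarrow> comp_mult C X T = iso_count C Ss T"
  unfolding comp_mult_def using Jordan_Hoelder(2) someI[of "comp_series C X"] by metis

lemma comp_length_eq: "comp_series C X Ss \<Longrightarrow> comp_length C X = length Ss"
  unfolding comp_length_def using Jordan_Hoelder(1) someI[of "comp_series C X"] by metis

text \<open>A series of \<open>Z\<close> lifts to \<open>Y\<close>: the maximal subobject of
  \<open>Z\<close> is pulled back along the quotient map, and at the bottom of the series an object
  isomorphic to \<open>X\<close> remains.\<close>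

lemma comp_series_short_exact:
  assumes "comp_series C Z Us" "short_exact C X Y Z" "comp_series C X Ss"
  shows "comp_series C Y (Us @ Ss)"
  using assms
proof (induction arbitrary: X Y Ss rule: comp_series.induct)
  case (zero Z)
  then show ?case using short_exact_zero_quotient comp_series_iso by simp
next
  case (step Z' Us S Z)
  obtain Y' where "short_exact C Y' Y S" "short_exact C X Y' Z'"
    using short_exact_pullback step by blast
  then show ?case using step comp_series.step by fastforce
qed

lemma comp_mult_short_exact:
  assumes "short_exact C X Y Z"
  shows "comp_mult C Y T = comp_mult C X T + comp_mult C Z T"
    and "comp_length C Y = comp_length C X + comp_length C Z"
proof -
  obtain Ss Us where *: "comp_series C X Ss" "comp_series C Z Us"
    using ex_comp_series short_exact_Ob assms by blast
  then have "comp_series C Y (Us @ Ss)" using comp_series_short_exact assms by blast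
  then show "comp_mult C Y T = comp_mult C X T + comp_mult C Z T" "comp_length C Y = comp_length C X + comp_length C Z"
    using * comp_mult_eq comp_length_eq by (simp_all add: iso_count_append)
qed

lemma comp_series_of_simple:
  assumes "simple C S"
  shows "comp_series C S [S]"
proof -
  have S: "S \<in> Ob C" using simple_Ob assms by blast
  have "iso_arrow C S S (Id C S)" unfolding iso_arrow_def using Id_arrow Comp_Id S by blast
  then have e: "epi_arrow C S S (Id C S)" and m: "mono_arrow C S S (Id C S)"
    using iso_arrow_epi iso_arrow_mono S by blast+
  obtain W k where W: "W \<in> Ob C" "is_kernel C W S S k (Id C S)" "short_exact C W S S" using short_exact_of_epi[OF S S e] .
  note D = is_kernelD[OF W(2)]
  have "k = zero_arrow C W S" using mono_arrow_cancel_zero[OF m W(1) S S D(1,3)] .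
  then have "Comp C k (Id C W) = zero_arrow C W S" using D W Comp_Id S by simp
  then have "zero_object C W"
    using mono_arrow_cancel_zero[OF is_kernel_mono[OF W(1) S S W(2)] W(1,1) S Id_arrow[OF W(1)]] zero_object_iff W by blast
  then show ?thesis using comp_series.intros W(3) assms by metis
qed

lemma comp_mult_simple: "simple C S \<Longrightarrow> comp_mult C S T = (if isomorphic C S T then 1 else 0)"
  using comp_mult_eq[OF comp_series_of_simple] by (simp add: iso_count_Cons)

text \<open>A series of \<open>X\<close> has only factors isomorphic to \<open>S\<close>, and their
  number is 1. This is what lets the Grothendieck ring recognise a simple object up to
  isomorphism.\<close>

lemma isomorphic_of_comp_mult:
  assumes X: "X \<in> Ob C" and S: "simple C S" and eq: "\<And>T. comp_mult C X T = comp_mult C S T"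
  shows "isomorphic C X S"
proof -
  obtain Ss where Ss: "comp_series C X Ss" using ex_comp_series X by blast
  have cnt: "iso_count C Ss T = (if isomorphic C S T then 1 else 0)" for T
    using eq[of T] comp_mult_simple[OF S] comp_mult_eq[OF Ss] by simp
  have "isomorphic C T S" if "T \<in> set Ss" for T
  proof -
    have "iso_count C Ss T > 0"
      using that isomorphic_refl simple_Ob comp_series_simple[OF Ss] unfolding iso_count_def
      by (auto simp: filter_empty_conv)
    then show ?thesis using cnt[of T] isomorphic_sym by (auto split: if_splits)
  qed
  then have "length Ss = iso_count C Ss S" unfolding iso_count_def by simp
  then have "length Ss = 1" using cnt isomorphic_refl simple_Ob S by simp
  then obtain T where T: "Ss = [T]" by (auto simp: length_Suc_conv)
  from Ss T obtain W where "comp_series C W []" "simple C T" "short_exact C W X T"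
    by (auto elim: comp_series.cases)
  then have "isomorphic C X T" using short_exact_zero_sub comp_series_Nil_iff by blast
  then show ?thesis using \<open>\<And>T. T \<in> set Ss \<Longrightarrow> isomorphic C T S\<close> T isomorphic_trans by auto
qed

lemma comp_mult_cong:
  assumes "isomorphic C S T"
  shows "comp_mult C X S = comp_mult C X T"
  using assms isomorphic_sym isomorphic_trans unfolding comp_mult_def iso_count_def
  by (metis (no_types, lifting))

text \<open>Every entry of a composition series is a quotient of a term of the series, and the terms
  are subobjects. In this form (a5) applies to composition factors.\<close>

lemma subquotient_of_comp_mult:
  assumes X: "X \<in> Ob C" and S: "simple C S" and pos: "comp_mult C X S > 0"
  shows "subquotient C S X"
proof -
  have sub: "\<exists>U \<in> Ob C. \<exists>i p. mono_arrow C U X i \<and> epi_arrow C U S p"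
    if "comp_series C X Ss" "T \<in> set Ss" "isomorphic C T S" for Ss X T
    using that
  proof (induction rule: comp_series.induct)
    case (step X Ss T' Y)
    obtain f g where fg: "X \<in> Ob C" "Y \<in> Ob C" "T' \<in> Ob C" "mono_arrow C X Y f" "epi_arrow C Y T' g"
      using short_exactE[OF step.hyps(3)] by metis
    show ?case
    proof (cases "T = T'")
      case True
      have "iso_arrow C Y Y (Id C Y)" unfolding iso_arrow_def using Id_arrow Comp_Id fg by blast
      then have "mono_arrow C Y Y (Id C Y)" using iso_arrow_mono fg by blast
      moreover obtain h where h: "iso_arrow C T' S h" using step.prems True unfolding isomorphic_def by blast
      ultimately show ?thesis
        using epi_arrow_Comp[OF fg(2,3) simple_Ob[OF S] fg(5) iso_arrow_epi[OF fg(3) simple_Ob[OF S] h]] fg(2) by blast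
    next
      case False
      then obtain U i p where "U \<in> Ob C" "mono_arrow C U X i" "epi_arrow C U S p" using step by auto
      then show ?thesis using mono_arrow_Comp fg by blast
    qed
  qed simp
  obtain Ss where Ss: "comp_series C X Ss" using ex_comp_series X by blast
  then obtain T where "T \<in> set Ss" "isomorphic C T S"
    using pos comp_mult_eq[OF Ss, of S] unfolding iso_count_def by (auto simp: filter_empty_conv)
  then show ?thesis unfolding subquotient_def using sub Ss X simple_Ob[OF S] by blast
qed

lemma subquotient_refl:
  assumes "X \<in> Ob C"
  shows "subquotient C X X"
proof -
  have "iso_arrow C X X (Id C X)" unfolding iso_arrow_def using Id_arrow Comp_Id assms by blast
  then show ?thesis unfolding subquotient_def using iso_arrow_mono iso_arrow_epi assms by blast
qed

lemma comp_mult_simple_quotient: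
  assumes "X \<in> Ob C" "simple C S" "epi_arrow C X S p"
  shows "comp_mult C X S > 0"
proof -
  obtain W where "short_exact C W X S" using short_exact_of_epi simple_Ob assms by metis
  then show ?thesis using comp_mult_short_exact(1)[of W X S S] comp_mult_simple[OF assms(2), of S] isomorphic_refl simple_Ob assms by simp
qed

section \<open>Heads\<close>

lemma biproduct_short_exact:
  assumes "biproduct C X Y P" "X \<in> Ob C" "Y \<in> Ob C"
  shows "short_exact C X P Y"
proof -
  from assms obtain i j p q where P: "P \<in> Ob C" and a: "i \<in> arrows C X P" "j \<in> arrows C Y P" "p \<in> arrows C P X" "q \<in> arrows C P Y"
    and e: "Comp C p i = Id C X" "Comp C q j = Id C Y" "Comp C p j = zero_arrow C Y X" "Comp C q i = zero_arrow C X Y"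
      "Comp C i p \<oplus>\<^bsub>Hom C P P\<^esub> Comp C j q = Id C P" unfolding biproduct_def by blast
  note X = assms(2) and Y = assms(3)
  have "is_kernel C X P Y i q"
  proof (rule is_kernelI)
    show "mono_arrow C X P i"
    proof (rule mono_arrowI)
      fix W g assume g: "W \<in> Ob C" "g \<in> arrows C W X" "Comp C i g = zero_arrow C W P"
      have "g = Comp C p (Comp C i g)" using Comp_assoc[OF g(1) X P X g(2) a(1,3)] e(1) Comp_Id[OF g(1) X g(2)] by simp
      then show "g = zero_arrow C W X" using g P X a by simp
    qed (use X P a in auto)
    fix V g assume g: "V \<in> Ob C" "g \<in> arrows C V P" "Comp C q g = zero_arrow C V Y"
    interpret VP: abelian_group "Hom C V P" using hom_group g P by blast
    have ip: "Comp C i p \<in> arrows C P P" "Comp C j q \<in> arrows C P P" "Comp C p g \<in> arrows C V X"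
      using Comp_arrow[OF P X P a(3,1)] Comp_arrow[OF P Y P a(4,2)] Comp_arrow[OF g(1) P X g(2) a(3)] .
    have "Comp C (Comp C j q) g = zero_arrow C V P" using Comp_assoc[OF g(1) P Y P g(2) a(4,2)] g(3) a g P Y by simp
    moreover have "Comp C (Comp C i p) g = Comp C i (Comp C p g)" using Comp_assoc[OF g(1) P X P g(2) a(3,1)] by simp
    ultimately have "g = Comp C i (Comp C p g)"
      using Comp_add_left[OF g(1) P P g(2) ip(1,2)] e(5) Comp_Id[OF g(1) P g(2)] Comp_arrow[OF g(1) X P ip(3) a(1)] by simp
    then show "\<exists>h. h \<in> arrows C V X \<and> Comp C i h = g" using ip(3) by metis
  qed (use X P Y a e in auto)
  moreover have "epi_arrow C P Y q"
  proof (rule epi_arrowI)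
    fix W g assume g: "W \<in> Ob C" "g \<in> arrows C Y W" "Comp C g q = zero_arrow C P W"
    have "g = Comp C (Comp C g q) j" using Comp_assoc[OF Y P Y g(1) a(2,4) g(2)] e(2) Comp_Id[OF Y g(1,2)] by simp
    then show "g = zero_arrow C Y W" using g P Y a by simp
  qed (use P Y a in auto)
  ultimately show ?thesis using short_exact_of_epi_kernel X P Y by blast
qed

lemma semisimple_Ob: "semisimple C X \<Longrightarrow> X \<in> Ob C"
  by (induction rule: semisimple.induct) (auto simp: zero_object_def biproduct_def)

text \<open>A semisimple quotient of maximal length is a head: adding a simple quotient that does not
  factor through it would give a longer one.\<close>

lemma ex_head:
  assumes X: "X \<in> Ob C"
  shows "\<exists>H. is_head C X H"
proof -
  let ?P = "\<lambda>l. \<exists>H p. semisimple C H \<and> epi_arrow C X H p \<and> comp_length C H = l"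
  obtain Z where Z: "zero_object C Z" using has_zero_object by blast
  then have Zo: "Z \<in> Ob C" unfolding zero_object_def by blast
  have "epi_arrow C X Z (zero_arrow C X Z)"
    by (rule epi_arrowI[OF X Zo zero_arrow_closed[OF X Zo]]) (rule zero_object_arrow_from[OF Z])
  then have P0: "?P (comp_length C Z)" using semisimple.intros(1)[OF Z] by metis
  have bound: "l \<le> comp_length C X" if Pl: "?P l" for l
  proof -
    obtain H p where H: "semisimple C H" "epi_arrow C X H p" "comp_length C H = l" using Pl by blast
    then obtain W where "short_exact C W X H" using short_exact_of_epi X semisimple_Ob by metis
    then show ?thesis using comp_mult_short_exact(2) H by fastforce
  qed
  define l where "l = Greatest ?P"
  have l1: "?P l" unfolding l_def by (rule GreatestI_nat[of ?P, OF P0 bound])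
  have l2: "k \<le> l" if "?P k" for k
    unfolding l_def by (rule Greatest_le_nat[of ?P, OF that bound])
  from l1 obtain H p where H: "semisimple C H" and p: "epi_arrow C X H p" and len: "comp_length C H = l" by blast
  have Ho: "H \<in> Ob C" using semisimple_Ob H by blast
  have pa: "p \<in> arrows C X H" using p unfolding epi_arrow_def by auto
  have simp_case: "\<exists>r \<in> arrows C H S. Comp C r p = q" if S: "simple C S" and q: "q \<in> arrows C X S" for S q
  proof (rule ccontr)
    assume no: "\<not> (\<exists>r \<in> arrows C H S. Comp C r p = q)"
    have So: "S \<in> Ob C" using simple_Ob S by blast
    obtain W k where W: "W \<in> Ob C" "is_kernel C W X H k p" "short_exact C W X H" using short_exact_of_epi[OF X Ho p] .
    note kD = is_kernelD[OF W(2)]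
    obtain V g where V: "V \<in> Ob C" and g: "is_cokernel C V X H g p" using epi_is_cokernel[OF X Ho p] by blast
    note gD = is_cokernelD[OF g]
    obtain h where h: "h \<in> arrows C V W" "Comp C k h = g" using is_kernel_factor[OF W(2) V gD(1,3)] .
    \<comment> \<open>\<open>p\<close> is the cokernel of an arrow that factors through
      \<open>k\<close>, so an arrow killing \<open>k\<close> would factor through \<open>p\<close>,
      against \<open>no\<close>.\<close>
    have "Comp C q k \<noteq> zero_arrow C W S"
    proof
      assume "Comp C q k = zero_arrow C W S"
      then have "Comp C q g = zero_arrow C V S" using Comp_assoc[OF V W(1) X So h(1) kD(1) q] h V W(1) So by simp
      then obtain r where "r \<in> arrows C H S" "Comp C r p = q" by (rule is_cokernel_factor[OF g So q])
      then show False using no by blast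
    qed
    then have eqk: "epi_arrow C W S (Comp C q k)"
      using nonzero_to_simple_epi[OF W(1) S] Comp_arrow[OF W(1) X So kD(1) q] by blast
    obtain P where P: "biproduct C H S P" using has_biproducts Ho So by blast
    then obtain i j p1 q1 where Po: "P \<in> Ob C" and a: "i \<in> arrows C H P" "j \<in> arrows C S P" "p1 \<in> arrows C P H" "q1 \<in> arrows C P S"
      and e: "Comp C i p1 \<oplus>\<^bsub>Hom C P P\<^esub> Comp C j q1 = Id C P" unfolding biproduct_def by blast
    have ss: "semisimple C P" by (rule semisimple.intros(2)[OF H S P])
    have ar: "Comp C i p \<in> arrows C X P" "Comp C j q \<in> arrows C X P"
      using Comp_arrow[OF X Ho Po pa a(1)] Comp_arrow[OF X So Po q a(2)] .
    let ?m = "Comp C i p \<oplus>\<^bsub>Hom C X P\<^esub> Comp C j q"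
    interpret XP: abelian_group "Hom C X P" using hom_group X Po by blast
    have m: "?m \<in> arrows C X P" using ar by simp
    \<comment> \<open>If \<open>r\<close> kills \<open>?m\<close>, restriction to the kernel
      \<open>W\<close> of \<open>p\<close> leaves only the component through \<open>q\<close>, which
      is epi there; so \<open>r\<close> vanishes on \<open>S\<close> and then on
      \<open>H\<close>.\<close>
    have "epi_arrow C X P ?m"
    proof (rule epi_arrowI)
      fix U r assume r: "U \<in> Ob C" "r \<in> arrows C P U" "Comp C r ?m = zero_arrow C X U"
      interpret XU: abelian_group "Hom C X U" using hom_group X r by blast
      interpret WU: abelian_group "Hom C W U" using hom_group W r by blast
      interpret PU: abelian_group "Hom C P U" using hom_group Po r by blast
      have ri: "Comp C r i \<in> arrows C H U" "Comp C r j \<in> arrows C S U"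
        using Comp_arrow[OF Ho Po r(1) a(1) r(2)] Comp_arrow[OF So Po r(1) a(2) r(2)] .
      have ri2: "Comp C (Comp C r i) p \<in> arrows C X U" "Comp C (Comp C r j) q \<in> arrows C X U"
        using Comp_arrow[OF X Ho r(1) pa ri(1)] Comp_arrow[OF X So r(1) q ri(2)] .
      have sum: "Comp C (Comp C r i) p \<oplus>\<^bsub>Hom C X U\<^esub> Comp C (Comp C r j) q = zero_arrow C X U"
        using Comp_add_right[OF X Po r(1) ar r(2)] r(3) Comp_assoc[OF X Ho Po r(1) pa a(1) r(2)]
          Comp_assoc[OF X So Po r(1) q a(2) r(2)] by simp
      have "Comp C (Comp C (Comp C r i) p) k = zero_arrow C W U"
        using Comp_assoc[OF W(1) X Ho r(1) kD(1) pa ri(1)] kD(3) ri r(1) W(1) Ho by simp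
      then have "Comp C (Comp C (Comp C r j) q) k = zero_arrow C W U"
        using Comp_add_left[OF W(1) X r(1) kD(1) ri2] sum kD(1) W(1) X r(1)
          Comp_arrow[OF W(1) X r(1) kD(1) ri2(2)] by simp
      then have "Comp C (Comp C r j) (Comp C q k) = zero_arrow C W U"
        using Comp_assoc[OF W(1) X So r(1) kD(1) q ri(2)] by simp
      then have rj: "Comp C r j = zero_arrow C S U" using epi_arrow_cancel_zero[OF eqk r(1) W(1) So ri(2)] by blast
      then have "Comp C (Comp C r i) p = zero_arrow C X U" using sum ri2 q X So r(1) by simp
      then have ri0: "Comp C r i = zero_arrow C H U" using epi_arrow_cancel_zero[OF p r(1) X Ho ri(1)] by blast
      have "r = Comp C r (Comp C i p1 \<oplus>\<^bsub>Hom C P P\<^esub> Comp C j q1)" using e Comp_Id[OF Po r(1,2)] by simp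
      also have "\<dots> = Comp C (Comp C r i) p1 \<oplus>\<^bsub>Hom C P U\<^esub> Comp C (Comp C r j) q1"
        using Comp_add_right[OF Po Po r(1) Comp_arrow[OF Po Ho Po a(3,1)] Comp_arrow[OF Po So Po a(4,2)] r(2)]
          Comp_assoc[OF Po Ho Po r(1) a(3,1) r(2)] Comp_assoc[OF Po So Po r(1) a(4,2) r(2)] by simp
      also have "\<dots> = zero_arrow C P U" using ri0 rj a Po Ho So r(1) by simp
      finally show "r = zero_arrow C P U" .
    qed (use X Po m in auto)
    then have "comp_length C P \<le> l" using l2 ss by metis
    moreover have "comp_length C P = l + 1"
      using comp_mult_short_exact(2)[OF biproduct_short_exact[OF P Ho So]] len comp_length_eq[OF comp_series_of_simple[OF S]] by simp
    ultimately show False by simp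
  qed
  \<comment> \<open>Both components of an arrow to a biproduct factor through \<open>p\<close>, so
    the case of a simple target extends along the inductive construction of semisimple
    objects.\<close>
  have fac: "\<exists>r \<in> arrows C H Q. Comp C r p = q" if "semisimple C Q" "q \<in> arrows C X Q" for Q q
    using that
  proof (induction arbitrary: q rule: semisimple.induct)
    case (1 Z)
    then have "Z \<in> Ob C" unfolding zero_object_def by blast
    then show ?case using 1 zero_object_arrow_to[OF 1(1)] X Ho pa
      by (metis Comp_zero_left zero_arrow_closed)
  next
    case (2 Q' S Q)
    have ob: "Q' \<in> Ob C" "S \<in> Ob C" using 2 semisimple_Ob simple_Ob by auto
    from 2 obtain i j p1 q1 where Qo: "Q \<in> Ob C" and a: "i \<in> arrows C Q' Q" "j \<in> arrows C S Q" "p1 \<in> arrows C Q Q'" "q1 \<in> arrows C Q S"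
      and e: "Comp C i p1 \<oplus>\<^bsub>Hom C Q Q\<^esub> Comp C j q1 = Id C Q" unfolding biproduct_def by blast
    have qa: "Comp C p1 q \<in> arrows C X Q'" "Comp C q1 q \<in> arrows C X S"
      using Comp_arrow[OF X Qo ob(1) 2(5) a(3)] Comp_arrow[OF X Qo ob(2) 2(5) a(4)] .
    obtain r1 where r1: "r1 \<in> arrows C H Q'" "Comp C r1 p = Comp C p1 q" using 2 qa by blast
    obtain r2 where r2: "r2 \<in> arrows C H S" "Comp C r2 p = Comp C q1 q" using simp_case[OF 2(2)] qa by blast
    interpret HQ: abelian_group "Hom C H Q" using hom_group Ho Qo by blast
    have ar: "Comp C i r1 \<in> arrows C H Q" "Comp C j r2 \<in> arrows C H Q"
      using Comp_arrow[OF Ho ob(1) Qo r1(1) a(1)] Comp_arrow[OF Ho ob(2) Qo r2(1) a(2)] .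
    have "Comp C (Comp C i r1 \<oplus>\<^bsub>Hom C H Q\<^esub> Comp C j r2) p = Comp C i (Comp C r1 p) \<oplus>\<^bsub>Hom C X Q\<^esub> Comp C j (Comp C r2 p)"
      using Comp_add_left[OF X Ho Qo pa ar] Comp_assoc[OF X Ho ob(1) Qo pa r1(1) a(1)] Comp_assoc[OF X Ho ob(2) Qo pa r2(1) a(2)] by simp
    also have "\<dots> = Comp C (Comp C i p1 \<oplus>\<^bsub>Hom C Q Q\<^esub> Comp C j q1) q"
      using Comp_add_left[OF X Qo Qo 2(5) Comp_arrow[OF Qo ob(1) Qo a(3,1)] Comp_arrow[OF Qo ob(2) Qo a(4,2)]]
        Comp_assoc[OF X Qo ob(1) Qo 2(5) a(3,1)] Comp_assoc[OF X Qo ob(2) Qo 2(5) a(4,2)] r1 r2 by simp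
    also have "\<dots> = q" using e Comp_Id[OF X Qo 2(5)] by simp
    finally show ?case using ar by blast
  qed
  have "is_head C X H" unfolding is_head_def
    using Ho H p fac unfolding epi_arrow_def by blast
  then show ?thesis by blast
qed

lemma head_obj_epi:
  assumes "X \<in> Ob C"
  obtains p where "epi_arrow C X (head_obj C X) p"
proof -
  have "is_head C X (head_obj C X)" unfolding head_obj_def by (rule someI_ex[OF ex_head[OF assms]])
  then show ?thesis using that unfolding is_head_def by blast
qed

end

section \<open>Rings with a positive basis\<close>

text \<open>\<open>Sm\<close> and \<open>Pc\<close> are the classes of simple and of arbitrary objects, and \<open>coef p w\<close> is the multiplicity of
  \<open>w\<close> in \<open>p\<close>.  In the locale \<open>Lambda_basis\<close>, \<open>hd u w\<close> is the class of the head of the tensor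
  product, and \<open>u * u \<in> Sm\<close> says that \<open>u\<close> is the class of a real simple object.\<close>

locale simple_basis =
  fixes Sm Pc :: "'f::field_char_0 set" and coef :: "'f \<Rightarrow> 'f \<Rightarrow> nat"
  assumes Pc_zero: "0 \<in> Pc"
    and Pc_add: "\<lbrakk>p \<in> Pc; q \<in> Pc\<rbrakk> \<Longrightarrow> p + q \<in> Pc"
    and Pc_mult: "\<lbrakk>p \<in> Pc; q \<in> Pc\<rbrakk> \<Longrightarrow> p * q \<in> Pc"
    and Sm_Pc: "u \<in> Sm \<Longrightarrow> u \<in> Pc"
    and coef_add: "\<lbrakk>p \<in> Pc; q \<in> Pc\<rbrakk> \<Longrightarrow> coef (p + q) w = coef p w + coef q w"
    and coef_Sm: "u \<in> Sm \<Longrightarrow> coef u w = (if w = u then 1 else 0)"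
    and coef_finite: "p \<in> Pc \<Longrightarrow> finite {w. coef p w \<noteq> 0}"
    and coef_nonzero: "\<lbrakk>p \<in> Pc; coef p w \<noteq> 0\<rbrakk> \<Longrightarrow> w \<in> Sm"
    and coef_expand: "p \<in> Pc \<Longrightarrow> p = (\<Sum>w | coef p w \<noteq> 0. of_nat (coef p w) * w)"
begin

definition supp :: "'f \<Rightarrow> 'f set" where
  "supp p = {w. coef p w \<noteq> 0}"

lemma supp_finite: "p \<in> Pc \<Longrightarrow> finite (supp p)"
  unfolding supp_def by (rule coef_finite)

lemma supp_Sm: "\<lbrakk>p \<in> Pc; w \<in> supp p\<rbrakk> \<Longrightarrow> w \<in> Sm"
  unfolding supp_def using coef_nonzero by blast

lemma coef_zero: "coef 0 w = 0"
  using coef_add[OF Pc_zero Pc_zero, of w] by simp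

lemma supp_simple: "u \<in> Sm \<Longrightarrow> supp u = {u}"
  unfolding supp_def by (auto simp: coef_Sm)

lemma supp_add: "\<lbrakk>p \<in> Pc; q \<in> Pc\<rbrakk> \<Longrightarrow> supp (p + q) = supp p \<union> supp q"
  unfolding supp_def by (auto simp: coef_add)

lemma Pc_sum: "(\<And>a. a \<in> A \<Longrightarrow> f a \<in> Pc) \<Longrightarrow> sum f A \<in> Pc"
  by (induction A rule: infinite_finite_induct) (auto simp: Pc_zero Pc_add)

lemma coef_sum: "(\<And>a. a \<in> A \<Longrightarrow> f a \<in> Pc) \<Longrightarrow> coef (sum f A) w = (\<Sum>a\<in>A. coef (f a) w)"
  by (induction A rule: infinite_finite_induct) (auto simp: coef_zero coef_add Pc_sum)

lemma Pc_of_nat_mult: "p \<in> Pc \<Longrightarrow> of_nat c * p \<in> Pc"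
  by (induction c) (auto simp: Pc_zero Pc_add distrib_right)

lemma coef_of_nat_mult: "p \<in> Pc \<Longrightarrow> coef (of_nat c * p) w = c * coef p w"
  by (induction c) (auto simp: coef_zero coef_add distrib_right Pc_of_nat_mult)

lemma expand: "p \<in> Pc \<Longrightarrow> p = (\<Sum>w\<in>supp p. of_nat (coef p w) * w)"
  unfolding supp_def by (rule coef_expand)

lemma coef_mult:
  assumes "p \<in> Pc" "q \<in> Pc"
  shows "coef (p * q) z = (\<Sum>w\<in>supp p. coef p w * coef (w * q) z)"
proof -
  have wq: "w * q \<in> Pc" if "w \<in> supp p" for w
    using that assms Pc_mult supp_Sm Sm_Pc by blast
  have "p * q = (\<Sum>w\<in>supp p. of_nat (coef p w) * (w * q))"
    by (subst expand[OF assms(1)]) (simp add: sum_distrib_right mult.assoc)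
  then have "coef (p * q) z = (\<Sum>w\<in>supp p. coef (of_nat (coef p w) * (w * q)) z)"
    using coef_sum[of "supp p" "\<lambda>w. of_nat (coef p w) * (w * q)"] wq Pc_of_nat_mult by simp
  then show ?thesis using wq by (simp add: coef_of_nat_mult)
qed

text \<open>Coefficients are natural numbers, so nothing cancels: a composition factor of any
  summand is one of the whole product.\<close>

lemma supp_mult:
  assumes "p \<in> Pc" "q \<in> Pc"
  shows "supp (p * q) = (\<Union>w\<in>supp p. supp (w * q))"
proof -
  have "z \<in> supp (p * q) \<longleftrightarrow> (\<exists>w\<in>supp p. coef (w * q) z \<noteq> 0)" for z
    using supp_finite[OF assms(1)] unfolding supp_def by (simp add: coef_mult[OF assms, unfolded supp_def])
  then show ?thesis unfolding supp_def by blast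
qed

lemma supp_of_nat_mult: "p \<in> Pc \<Longrightarrow> c > 0 \<Longrightarrow> supp (of_nat c * p) = supp p"
  unfolding supp_def by (simp add: coef_of_nat_mult)

lemma supp_sum:
  assumes "finite A" "\<And>a. a \<in> A \<Longrightarrow> f a \<in> Pc"
  shows "supp (sum f A) = (\<Union>a\<in>A. supp (f a))"
  using assms unfolding supp_def by (auto simp: coef_sum)

end

locale Lambda_basis = simple_basis +
  fixes LL :: "'a \<Rightarrow> 'a \<Rightarrow> int" and hd :: "'a \<Rightarrow> 'a \<Rightarrow> 'a"
  assumes hd_supp: "\<lbrakk>u \<in> Sm; w \<in> Sm; u * u \<in> Sm \<or> w * w \<in> Sm\<rbrakk> \<Longrightarrow> hd u w \<in> supp (u * w)"
    and LL_commute: "\<lbrakk>u \<in> Sm; w \<in> Sm; u * u \<in> Sm; w * w \<in> Sm; u * w \<in> Sm\<rbrakk> \<Longrightarrow> LL u w + LL w u = 0"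
    and LL_mult: "\<lbrakk>u \<in> Sm; w \<in> Sm; l \<in> Sm; u * w \<in> Sm\<rbrakk>
          \<Longrightarrow> LL (u * w) l = LL u l + LL w l \<and> LL l (u * w) = LL l u + LL l w"
    and LL_le: "\<lbrakk>u \<in> Sm; w \<in> Sm; l \<in> Sm; z \<in> supp (u * w)\<rbrakk>
          \<Longrightarrow> LL z l \<le> LL u l + LL w l \<and> LL l z \<le> LL l u + LL l w"
    and LL_hd_left: "\<lbrakk>u \<in> Sm; w \<in> Sm; l \<in> Sm; l * l \<in> Sm; l * w \<in> Sm; u * u \<in> Sm \<or> w * w \<in> Sm\<rbrakk>
          \<Longrightarrow> LL (hd u w) l = LL u l + LL w l"
    and LL_hd_right: "\<lbrakk>u \<in> Sm; w \<in> Sm; l \<in> Sm; l * l \<in> Sm; l * u \<in> Sm; u * u \<in> Sm \<or> w * w \<in> Sm\<rbrakk>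
          \<Longrightarrow> LL l (hd u w) = LL l u + LL l w"

section \<open>Monomials and exchange relations\<close>

definition col_comb :: "nat \<Rightarrow> int mat \<Rightarrow> (nat \<Rightarrow> int) \<Rightarrow> nat \<Rightarrow> int" where
  "col_comb n A v i = (\<Sum>k<n. A $$ (i, k) * v k)"

definition col_cong :: "nat \<Rightarrow> nat \<Rightarrow> int mat \<Rightarrow> (nat \<Rightarrow> int) \<Rightarrow> (nat \<Rightarrow> int) \<Rightarrow> bool" where
  "col_cong m n A e e' \<longleftrightarrow> (\<exists>v. \<forall>i<m. e i = e' i + col_comb n A v i)"

lemma col_comb_add: "col_comb n A (\<lambda>k. v k + w k) i = col_comb n A v i + col_comb n A w i"
  and col_comb_uminus: "col_comb n A (\<lambda>k. - v k) i = - col_comb n A v i"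
  by (simp_all add: col_comb_def sum.distrib sum_negf algebra_simps)

lemma col_comb_single: "k < n \<Longrightarrow> col_comb n A (\<lambda>l. if l = k then c else 0) i = c * A $$ (i, k)"
  unfolding col_comb_def by (simp add: if_distrib cong: if_cong)

lemma col_congI: "(\<And>i. i < m \<Longrightarrow> e i = e' i + col_comb n A v i) \<Longrightarrow> col_cong m n A e e'"
  unfolding col_cong_def by blast

lemma col_cong_refl: "(\<And>i. i < m \<Longrightarrow> e i = e' i) \<Longrightarrow> col_cong m n A e e'"
  by (rule col_congI[of _ _ _ _ _ "\<lambda>_. 0"]) (simp add: col_comb_def)

lemma col_cong_single:
  "k < n \<Longrightarrow> (\<And>i. i < m \<Longrightarrow> e i = e' i + c * A $$ (i, k)) \<Longrightarrow> col_cong m n A e e'"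
  by (rule col_congI[of _ _ _ _ _ "\<lambda>l. if l = k then c else 0"]) (simp add: col_comb_single)

lemma col_cong_sym: "col_cong m n A e e' \<Longrightarrow> col_cong m n A e' e"
  unfolding col_cong_def
proof (elim exE)
  fix v assume "\<forall>i<m. e i = e' i + col_comb n A v i"
  then show "\<exists>v. \<forall>i<m. e' i = e i + col_comb n A v i"
    by (intro exI[of _ "\<lambda>k. - v k"]) (simp add: col_comb_uminus)
qed

lemma col_cong_add:
  assumes "col_cong m n A e e'" "col_cong m n A f f'"
  shows "col_cong m n A (\<lambda>i. e i + f i) (\<lambda>i. e' i + f' i)"
proof -
  obtain v w where "\<forall>i<m. e i = e' i + col_comb n A v i" "\<forall>i<m. f i = f' i + col_comb n A w i"
    using assms unfolding col_cong_def by blast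
  then show ?thesis by (intro col_congI[of _ _ _ _ _ "\<lambda>k. v k + w k"]) (simp add: col_comb_add)
qed

lemma col_cong_trans:
  assumes "col_cong m n A e e'" "col_cong m n A e' e''"
  shows "col_cong m n A e e''"
proof -
  obtain v w where "\<forall>i<m. e i = e' i + col_comb n A v i" "\<forall>i<m. e' i = e'' i + col_comb n A w i"
    using assms unfolding col_cong_def by blast
  then show ?thesis by (intro col_congI[of _ _ _ _ _ "\<lambda>k. v k + w k"]) (simp add: col_comb_add)
qed

definition pos_col :: "int mat \<Rightarrow> nat \<Rightarrow> nat \<Rightarrow> nat" where
  "pos_col A k i = nat (pos_part (A $$ (i, k)))"

definition neg_col :: "int mat \<Rightarrow> nat \<Rightarrow> nat \<Rightarrow> nat" where
  "neg_col A k i = nat (pos_part (- A $$ (i, k)))"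

lemma pos_minus_neg_col: "int (pos_col A k i) - int (neg_col A k i) = A $$ (i, k)"
  unfolding pos_col_def neg_col_def pos_part_def by auto

text \<open>The change of exponents under the substitution of \<open>\<Prod>\<^sub>j x\<^sub>j ^ [b\<^sub>j\<^sub>k]\<^sub>+ / x\<^sub>k\<close> for \<open>x\<^sub>k\<close>.\<close>

definition exp_mutate :: "int mat \<Rightarrow> nat \<Rightarrow> (nat \<Rightarrow> int) \<Rightarrow> nat \<Rightarrow> int" where
  "exp_mutate A k e i = (if i = k then - e k else e i + e k * int (pos_col A k i))"

text \<open>This is the monomial part of the mutation of the \<open>yhat\<close>, up to powers of a
  binomial. The coefficient of column k is [-A_kj]_+, here written as [A_kj]_+ - A_kj, and the -1
  for j = k is the inversion of the k-th \<open>yhat\<close>.\<close>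

lemma exp_mutate_col:
  assumes k: "k < n" and zero: "A $$ (k, k) = 0" and j: "j < n" and i: "i < m"
  shows "exp_mutate A k (\<lambda>i. A $$ (i, j)) i = col_comb n (mutate m n k A)
     (\<lambda>l. (if l = j then if j = k then -1 else 1 else 0)
        + (if l = k then pos_part (A $$ (k, j)) - A $$ (k, j) else 0)) i"
proof -
  have A': "mutate m n k A $$ (i, l) = (if i = k \<or> l = k then - A $$ (i, l)
     else A $$ (i, l) + pos_part (A $$ (i, k)) * pos_part (A $$ (k, l))
          - pos_part (- A $$ (i, k)) * pos_part (- A $$ (k, l)))" if "l < n" for l
    using i that unfolding mutate_def by simp
  have pc: "int (pos_col A k i) = pos_part (A $$ (i, k))" unfolding pos_col_def pos_part_def by simp
  have nc: "pos_part (- c) = pos_part c - c" for c unfolding pos_part_def by auto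
  show ?thesis
    using zero by (simp add: col_comb_add col_comb_single[OF j] col_comb_single[OF k] A'[OF j] A'[OF k]
        exp_mutate_def pc nc algebra_simps) (auto simp: pos_part_def)
qed

text \<open>\<open>exp_mutate\<close> is linear in the exponents, so it is enough that it maps the
  columns of \<open>A\<close> into the column lattice of the mutated matrix.\<close>

lemma col_cong_mutate:
  assumes k: "k < n" and zero: "A $$ (k, k) = 0" and m: "n \<le> m" and e: "col_cong m n A e e'"
  shows "col_cong m n (mutate m n k A) (exp_mutate A k e) (exp_mutate A k e')"
proof -
  obtain v where v: "\<And>i. i < m \<Longrightarrow> e i = e' i + col_comb n A v i" using e unfolding col_cong_def by blast
  define w where "w j = (\<lambda>l. (if l = j then if j = k then -1 else 1 else 0)
        + (if l = k then pos_part (A $$ (k, j)) - A $$ (k, j) else (0::int)))" for j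
  show ?thesis
  proof (rule col_congI[of _ _ _ _ _ "\<lambda>l. \<Sum>j<n. v j * w j l"])
    fix i assume i: "i < m"
    have "exp_mutate A k e i = exp_mutate A k e' i + exp_mutate A k (col_comb n A v) i"
      using v[OF i] v[of k] k m by (simp add: exp_mutate_def algebra_simps)
    also have "exp_mutate A k (col_comb n A v) i = (\<Sum>j<n. v j * exp_mutate A k (\<lambda>i. A $$ (i, j)) i)"
      by (simp add: exp_mutate_def col_comb_def sum_negf sum.distrib sum_distrib_left sum_distrib_right algebra_simps)
    also have "\<dots> = (\<Sum>j<n. v j * col_comb n (mutate m n k A) (w j) i)"
      using exp_mutate_col[where A = A and i = i and m = m and n = n and k = k] k zero i unfolding w_def by simp
    also have "\<dots> = col_comb n (mutate m n k A) (\<lambda>l. \<Sum>j<n. v j * w j l) i"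
      unfolding col_comb_def sum_distrib_left by (subst sum.swap) (simp add: mult.left_commute)
    finally show "exp_mutate A k e i = exp_mutate A k e' i + \<dots>" .
  qed
qed

section \<open>The Grothendieck ring\<close>

context linear_abelian_category
begin

lemma exact_relations_subgroup: "subgroup (exact_relations C) (free_Abelian_group (Ob C))"
  unfolding exact_relations_def
proof (rule group.generate_is_subgroup[OF group_free_Abelian_group])
  show "{frag_of Y - frag_of X - frag_of Z |X Y Z. short_exact C X Y Z} \<subseteq> carrier (free_Abelian_group (Ob C))"
  proof
    fix p assume "p \<in> {frag_of Y - frag_of X - frag_of Z |X Y Z. short_exact C X Y Z}"
    then obtain X Y Z where p: "p = frag_of Y - frag_of X - frag_of Z" "short_exact C X Y Z" by blast
    have "Poly_Mapping.keys p \<subseteq> Poly_Mapping.keys (frag_of Y - frag_of X) \<union> Poly_Mapping.keys (frag_of Z)"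
      unfolding p(1) by (rule keys_diff)
    moreover have "Poly_Mapping.keys (frag_of Y - frag_of X) \<subseteq> Poly_Mapping.keys (frag_of Y) \<union> Poly_Mapping.keys (frag_of X)"
      by (rule keys_diff)
    ultimately show "p \<in> carrier (free_Abelian_group (Ob C))"
      using short_exact_Ob[OF p(2)] by auto
  qed
qed

lemma exact_relations_closed:
  shows "0 \<in> exact_relations C"
    and "\<lbrakk>p \<in> exact_relations C; q \<in> exact_relations C\<rbrakk> \<Longrightarrow> p + q \<in> exact_relations C"
    and "p \<in> exact_relations C \<Longrightarrow> - p \<in> exact_relations C"
proof -
  note s = exact_relations_subgroup
  show "0 \<in> exact_relations C" using subgroup.one_closed[OF s] by simp
  show "p + q \<in> exact_relations C" if "p \<in> exact_relations C" "q \<in> exact_relations C" for p q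
    using subgroup.m_closed[OF s that] by simp
  show "- p \<in> exact_relations C" if "p \<in> exact_relations C" for p
    using subgroup.m_inv_closed[OF s that] subgroup.mem_carrier[OF s that] by simp
qed

definition K0_coset :: "('b \<Rightarrow>\<^sub>0 int) \<Rightarrow> ('b \<Rightarrow>\<^sub>0 int) set" where
  "K0_coset p = {h + p | h. h \<in> exact_relations C}"

lemma K0_coset_eq_iff: "K0_coset p = K0_coset q \<longleftrightarrow> p - q \<in> exact_relations C"
proof
  assume "K0_coset p = K0_coset q"
  moreover have "p \<in> K0_coset p" unfolding K0_coset_def using exact_relations_closed(1) by force
  ultimately obtain h where "p = h + q" "h \<in> exact_relations C" unfolding K0_coset_def by blast
  then show "p - q \<in> exact_relations C" by simp
next
  have sub: "K0_coset p \<subseteq> K0_coset q" if "p - q \<in> exact_relations C" for p q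
  proof
    fix r assume "r \<in> K0_coset p"
    then obtain h where h: "r = h + p" "h \<in> exact_relations C" unfolding K0_coset_def by blast
    have "r = (h + (p - q)) + q" using h by simp
    then show "r \<in> K0_coset q" unfolding K0_coset_def using exact_relations_closed(2)[OF h(2) that] by blast
  qed
  assume pq: "p - q \<in> exact_relations C"
  then have "q - p \<in> exact_relations C" using exact_relations_closed(3)[OF pq] by simp
  then show "K0_coset p = K0_coset q" using sub pq by blast
qed

lemma K0_coset_self: "p \<in> K0_coset p"
  unfolding K0_coset_def using exact_relations_closed(1) by force

lemma K0_coset_mem: "p \<in> K0_coset q \<Longrightarrow> K0_coset p = K0_coset q"
  unfolding K0_coset_eq_iff by (auto simp: K0_coset_def)

lemma K0_class_eq: "K0_class C X = K0_coset (frag_of X)"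
  and a_r_coset_K0_coset: "a_r_coset (free_tensor_ring C) (exact_relations C) p = K0_coset p"
  unfolding K0_class_def K0_coset_def a_r_coset_def' free_tensor_ring_def by auto

lemma carrier_K0: "carrier (K0 C) = K0_coset ` carrier (free_Abelian_group (Ob C))"
proof -
  have "carrier (K0 C) = (\<Union>a\<in>carrier (free_tensor_ring C). {a_r_coset (free_tensor_ring C) (exact_relations C) a})"
    unfolding K0_def FactRing_def A_RCOSETS_def' by (simp add: a_r_coset_def')
  then show ?thesis unfolding a_r_coset_K0_coset by (auto simp: free_tensor_ring_def)
qed

lemma K0_class_carrier: "X \<in> Ob C \<Longrightarrow> K0_class C X \<in> carrier (K0 C)"
  unfolding K0_class_eq carrier_K0 by auto

lemma K0_add_coset: "K0_coset p \<oplus>\<^bsub>K0 C\<^esub> K0_coset q = K0_coset (p + q)"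
proof -
  have "K0_coset p \<oplus>\<^bsub>K0 C\<^esub> K0_coset q = {a + b | a b. a \<in> K0_coset p \<and> b \<in> K0_coset q}"
    unfolding K0_def FactRing_def by (auto simp: set_add_def' free_tensor_ring_def)
  also have "\<dots> = K0_coset (p + q)"
  proof (intro equalityI subsetI)
    fix r assume "r \<in> {a + b | a b. a \<in> K0_coset p \<and> b \<in> K0_coset q}"
    then obtain h h' where h: "h \<in> exact_relations C" "h' \<in> exact_relations C" "r = (h + p) + (h' + q)"
      unfolding K0_coset_def by blast
    then have "r = (h + h') + (p + q)" by (simp add: algebra_simps)
    then show "r \<in> K0_coset (p + q)" unfolding K0_coset_def using exact_relations_closed(2)[OF h(1,2)] by blast
  next
    fix r assume "r \<in> K0_coset (p + q)"
    then obtain h where h: "h \<in> exact_relations C" "r = (h + p) + q" unfolding K0_coset_def by (auto simp: add.assoc)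
    have "h + p \<in> K0_coset p" unfolding K0_coset_def using h(1) by blast
    then show "r \<in> {a + b | a b. a \<in> K0_coset p \<and> b \<in> K0_coset q}" using h(2) K0_coset_self by blast
  qed
  finally show ?thesis .
qed

lemma K0_class_short_exact:
  assumes "short_exact C X Y Z"
  shows "K0_class C Y = K0_class C X \<oplus>\<^bsub>K0 C\<^esub> K0_class C Z"
proof -
  have "frag_of Y - frag_of X - frag_of Z \<in> exact_relations C"
    unfolding exact_relations_def by (rule generate.incl) (use assms in blast)
  then show ?thesis unfolding K0_class_eq K0_add_coset K0_coset_eq_iff by (simp add: algebra_simps)
qed

text \<open>The product of two cosets in the quotient record is a union of cosets. Closure of the
  ring makes it a single coset, and it contains \<open>frag_of (Tens C M N)\<close>.\<close>

lemma K0_class_Tens: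
  assumes r: "ring (K0 C)" and ob: "M \<in> Ob C" "N \<in> Ob C"
  shows "K0_class C M \<otimes>\<^bsub>K0 C\<^esub> K0_class C N = K0_class C (Tens C M N)"
proof -
  have "K0_class C M \<otimes>\<^bsub>K0 C\<^esub> K0_class C N \<in> carrier (K0 C)"
    using ringE(2)[OF r] K0_class_carrier ob monoid.m_closed by metis
  then obtain p where p: "K0_class C M \<otimes>\<^bsub>K0 C\<^esub> K0_class C N = K0_coset p" unfolding carrier_K0 by blast
  have "K0_coset (frag_of (Tens C M N)) \<subseteq> K0_class C M \<otimes>\<^bsub>K0 C\<^esub> K0_class C N"
  proof -
    have "frag_of M \<otimes>\<^bsub>free_tensor_ring C\<^esub> frag_of N = frag_of (Tens C M N)" unfolding free_tensor_ring_def by simp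
    then have "K0_coset (frag_of (Tens C M N)) \<subseteq> (\<Union>a\<in>K0_coset (frag_of M). \<Union>b\<in>K0_coset (frag_of N). K0_coset (a \<otimes>\<^bsub>free_tensor_ring C\<^esub> b))"
      by (intro subsetI UN_I[OF K0_coset_self] UN_I[OF K0_coset_self]) simp
    then have "K0_coset (frag_of (Tens C M N)) \<subseteq> rcoset_mult (free_tensor_ring C) (exact_relations C) (K0_class C M) (K0_class C N)"
      unfolding rcoset_mult_def a_r_coset_K0_coset K0_class_eq .
    then show ?thesis unfolding K0_def FactRing_def by simp
  qed
  then have "frag_of (Tens C M N) \<in> K0_coset p" using p K0_coset_self by blast
  then show ?thesis using p K0_coset_mem K0_class_eq by simp
qed

end

context finite_length_category
begin

lemma comp_mult_K0_class:
  assumes eq: "K0_class C X = K0_class C Y"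
  shows "comp_mult C X T = comp_mult C Y T"
proof -
  \<comment> \<open>The multiplicity of \<open>T\<close>, extended additively to the free abelian
    group: \<open>frag_extend\<close> takes values in finitely supported maps, so the number is
    carried as a multiple of \<open>frag_of T\<close> and read off at \<open>T\<close>. It vanishes
    on the exact relations because multiplicities are additive.\<close>
  define \<psi> where "\<psi> p = Poly_Mapping.lookup (frag_extend (\<lambda>X. frag_cmul (int (comp_mult C X T)) (frag_of T)) p) T" for p
  have \<psi>: "\<psi> (frag_of X) = int (comp_mult C X T)" "\<psi> (p + q) = \<psi> p + \<psi> q" "\<psi> (p - q) = \<psi> p - \<psi> q" "\<psi> (- p) = - \<psi> p" "\<psi> 0 = 0" for p q X
    unfolding \<psi>_def by (simp_all add: frag_extend_add frag_extend_diff frag_extend_minus lookup_add lookup_minus)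
  have "\<psi> p = 0" if "p \<in> exact_relations C" for p
  proof -
    note s = exact_relations_subgroup
    have car: "q \<in> carrier (free_Abelian_group (Ob C))"
      if "q \<in> {frag_of Y - frag_of X - frag_of Z |X Y Z. short_exact C X Y Z}" for q
      using subgroup.mem_carrier[OF s] generate.incl[OF that, of "free_Abelian_group (Ob C)"] unfolding exact_relations_def by blast
    have gen: "\<psi> q = 0" if "q \<in> {frag_of Y - frag_of X - frag_of Z |X Y Z. short_exact C X Y Z}" for q
      using that \<psi>(1,3) comp_mult_short_exact(1) by fastforce
    show ?thesis using that unfolding exact_relations_def
    proof (induction rule: generate.induct)
      case (inv h)
      then show ?case using gen[OF inv] car[OF inv] \<psi>(4) by simp
    qed (use gen \<psi> in auto)
  qed
  then have "\<psi> (frag_of X - frag_of Y) = 0" using eq unfolding K0_class_eq K0_coset_eq_iff by blast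
  then show ?thesis using \<psi> by simp
qed

end

section \<open>Simple classes as a positive basis\<close>

locale field_valued_K0 = finite_length_category K C + linear_monoidal_abelian_category K C
  for K :: "'k ring" and C :: "('o, 'a, 'k) mon_cat" +
  fixes \<phi> :: "('o \<Rightarrow>\<^sub>0 int) set \<Rightarrow> 'f::field_char_0"
  assumes K0_ring: "ring (K0 C)"
    and \<phi>_add: "\<lbrakk>p \<in> carrier (K0 C); q \<in> carrier (K0 C)\<rbrakk> \<Longrightarrow> \<phi> (p \<oplus>\<^bsub>K0 C\<^esub> q) = \<phi> p + \<phi> q"
    and \<phi>_mult: "\<lbrakk>p \<in> carrier (K0 C); q \<in> carrier (K0 C)\<rbrakk> \<Longrightarrow> \<phi> (p \<otimes>\<^bsub>K0 C\<^esub> q) = \<phi> p * \<phi> q"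
    and \<phi>_inj: "inj_on \<phi> (carrier (K0 C))"
begin

definition cls :: "'o \<Rightarrow> 'f" where "cls X = \<phi> (K0_class C X)"

definition simple_classes :: "'f set" where "simple_classes = cls ` {S. simple C S}"

definition object_classes :: "'f set" where "object_classes = cls ` Ob C"

text \<open>The choice is the one made in \<open>monoidal_cluster\<close>, so
  \<open>Lambda_mat\<close> becomes literally the matrix of the pairing \<open>LL\<close> on cluster
  variables.\<close>

definition rep :: "'f \<Rightarrow> 'o" where "rep u = (SOME S. simple C S \<and> cls S = u)"

definition obj_rep :: "'f \<Rightarrow> 'o" where "obj_rep p = (SOME X. X \<in> Ob C \<and> cls X = p)"

text \<open>The default value 0 outside the simple classes keeps all supports inside them.\<close>

definition mult_in_class :: "'f \<Rightarrow> 'f \<Rightarrow> nat" where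
  "mult_in_class p w = (if w \<in> simple_classes then comp_mult C (obj_rep p) (rep w) else 0)"

lemma cls_short_exact:
  assumes "short_exact C X Y Z"
  shows "cls Y = cls X + cls Z"
proof -
  have "K0_class C X \<in> carrier (K0 C)" "K0_class C Z \<in> carrier (K0 C)"
    using K0_class_carrier short_exact_Ob[OF assms] by auto
  then show ?thesis unfolding cls_def K0_class_short_exact[OF assms] by (rule \<phi>_add)
qed

lemma cls_Tens:
  assumes "M \<in> Ob C" "N \<in> Ob C"
  shows "cls (Tens C M N) = cls M * cls N"
  unfolding cls_def K0_class_Tens[OF K0_ring assms, symmetric]
  by (rule \<phi>_mult[OF K0_class_carrier[OF assms(1)] K0_class_carrier[OF assms(2)]])

lemma comp_mult_cls:
  assumes "X \<in> Ob C" "Y \<in> Ob C" "cls X = cls Y"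
  shows "comp_mult C X T = comp_mult C Y T"
  by (rule comp_mult_K0_class) (use assms \<phi>_inj K0_class_carrier in \<open>auto simp: cls_def inj_on_def\<close>)

lemma cls_comp_series: "comp_series C X Ss \<Longrightarrow> cls X = sum_list (map cls Ss)"
proof (induction rule: comp_series.induct)
  case (zero Z)
  then have Z: "Z \<in> Ob C" unfolding zero_object_def by blast
  have "iso_arrow C Z Z (Id C Z)" unfolding iso_arrow_def using Id_arrow Comp_Id Z by blast
  then obtain W k where W: "W \<in> Ob C" "short_exact C W Z Z" using short_exact_of_epi[OF Z Z iso_arrow_epi[OF Z Z]] by blast
  \<comment> \<open>Cancelling \<open>cls W\<close> in this sequence shows that a zero object has
    class 0.\<close>
  have "short_exact C W W Z"
    by (rule short_exact_iso_middle[OF W(2) isomorphic_sym[OF short_exact_zero_quotient[OF W(2) zero]]])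
  from cls_short_exact[OF this] show ?case by simp
next
  case (step X Ss S Y)
  then show ?case using cls_short_exact by simp
qed

lemma cls_iso:
  assumes "isomorphic C X Y"
  shows "cls X = cls Y"
proof -
  obtain Ss where "comp_series C X Ss" using ex_comp_series assms unfolding isomorphic_def by blast
  then show ?thesis using comp_series_iso assms cls_comp_series by metis
qed

lemma cls_simple_eq:
  assumes "X \<in> Ob C" "simple C S" "cls X = cls S"
  shows "isomorphic C X S"
  by (rule isomorphic_of_comp_mult[OF assms(1,2)]) (rule comp_mult_cls[OF assms(1) simple_Ob[OF assms(2)] assms(3)])

lemma rep:
  assumes "u \<in> simple_classes"
  shows "simple C (rep u)" "cls (rep u) = u" "rep u \<in> Ob C"
proof -
  have "simple C (rep u) \<and> cls (rep u) = u"
    unfolding rep_def by (rule someI_ex) (use assms in \<open>auto simp: simple_classes_def\<close>)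
  then show "simple C (rep u)" "cls (rep u) = u" "rep u \<in> Ob C" using simple_Ob by auto
qed

lemma mult_in_class_cls:
  assumes X: "X \<in> Ob C"
  shows "mult_in_class (cls X) w = (if w \<in> simple_classes then comp_mult C X (rep w) else 0)"
proof -
  have "obj_rep (cls X) \<in> Ob C \<and> cls (obj_rep (cls X)) = cls X"
    unfolding obj_rep_def by (rule someI_ex) (use X in blast)
  then have "comp_mult C (obj_rep (cls X)) T = comp_mult C X T" for T using comp_mult_cls X by blast
  then show ?thesis unfolding mult_in_class_def by simp
qed

lemma isomorphic_rep_iff:
  assumes "simple C S" "w \<in> simple_classes"
  shows "isomorphic C S (rep w) \<longleftrightarrow> w = cls S"
  using cls_iso cls_simple_eq[OF simple_Ob[OF assms(1)] rep(1)[OF assms(2)]] rep(2)[OF assms(2)] by auto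

lemma iso_count_rep:
  assumes Ss: "comp_series C X Ss" and w: "w \<in> simple_classes"
  shows "comp_mult C X (rep w) = length (filter (\<lambda>S. w = cls S) Ss)"
proof -
  have "filter (\<lambda>S. isomorphic C S (rep w)) Ss = filter (\<lambda>S. w = cls S) Ss"
    by (rule filter_cong) (use comp_series_simple[OF Ss] isomorphic_rep_iff w in auto)
  then show ?thesis unfolding comp_mult_eq[OF Ss] iso_count_def by simp
qed

lemma simple_basis: "simple_basis simple_classes object_classes mult_in_class"
proof
  obtain Z where Z: "comp_series C Z []" "Z \<in> Ob C"
    using has_zero_object comp_series_Nil_iff unfolding zero_object_def by auto
  then show "0 \<in> object_classes" using cls_comp_series[OF Z(1)] unfolding object_classes_def by (metis imageI list.simps(8) sum_list.Nil)
  fix p q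
  assume "p \<in> object_classes" "q \<in> object_classes"
  then obtain X Y where XY: "X \<in> Ob C" "Y \<in> Ob C" "p = cls X" "q = cls Y" unfolding object_classes_def by blast
  then obtain P where "biproduct C X Y P" using has_biproducts by blast
  then have se: "short_exact C X P Y" using biproduct_short_exact XY by blast
  have P: "P \<in> Ob C" "cls P = p + q" using cls_short_exact[OF se] short_exact_Ob[OF se] XY by auto
  then show "p + q \<in> object_classes" unfolding object_classes_def by (metis imageI)
  show "p * q \<in> object_classes" unfolding object_classes_def using cls_Tens[OF XY(1,2)] Tens_Ob[OF XY(1,2)] XY by (metis imageI)
  show "mult_in_class (p + q) w = mult_in_class p w + mult_in_class q w" for w
    using mult_in_class_cls[OF P(1)] mult_in_class_cls[OF XY(1)] mult_in_class_cls[OF XY(2)] P XY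
      comp_mult_short_exact(1)[OF se] by simp
next
  fix u assume "u \<in> simple_classes"
  then obtain S where S: "simple C S" "u = cls S" unfolding simple_classes_def by blast
  show "u \<in> object_classes" unfolding object_classes_def using S simple_Ob by blast
  show "mult_in_class u w = (if w = u then 1 else 0)" for w
    unfolding S(2) mult_in_class_cls[OF simple_Ob[OF S(1)]]
    using comp_mult_simple[OF S(1)] isomorphic_rep_iff[OF S(1)] S(1) unfolding simple_classes_def by auto
next
  fix p assume "p \<in> object_classes"
  then obtain X where X: "X \<in> Ob C" "p = cls X" unfolding object_classes_def by blast
  obtain Ss where Ss: "comp_series C X Ss" using ex_comp_series X by blast
  have sS: "cls ` set Ss \<subseteq> simple_classes" using comp_series_simple[OF Ss] unfolding simple_classes_def by blast
  have m: "mult_in_class p w = length (filter (\<lambda>S. w = cls S) Ss)" for w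
  proof (cases "w \<in> simple_classes")
    case True
    then show ?thesis unfolding X(2) mult_in_class_cls[OF X(1)] using iso_count_rep[OF Ss] by simp
  next
    case False
    then have "filter (\<lambda>S. w = cls S) Ss = []" using sS by (auto simp: filter_empty_conv)
    then show ?thesis using False unfolding mult_in_class_def by simp
  qed
  have nz: "{w. mult_in_class p w \<noteq> 0} = cls ` set Ss" unfolding m by (auto simp: filter_empty_conv)
  show "finite {w. mult_in_class p w \<noteq> 0}" unfolding nz by simp
  show "w \<in> simple_classes" if "mult_in_class p w \<noteq> 0" for w using that nz sS by blast
  have sl: "sum_list (map cls Ts) = (\<Sum>w\<in>A. of_nat (length (filter (\<lambda>S. w = cls S) Ts)) * w)"
    if "finite A" "cls ` set Ts \<subseteq> A" for Ts A
    using that(2)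
  proof (induction Ts)
    case (Cons S Ts)
    have "(\<Sum>w\<in>A. of_nat (length (filter (\<lambda>S. w = cls S) (S # Ts))) * w)
        = (\<Sum>w\<in>A. (if w = cls S then w else 0) + of_nat (length (filter (\<lambda>S. w = cls S) Ts)) * w)"
      by (intro sum.cong refl) (simp add: algebra_simps)
    then show ?case using Cons \<open>finite A\<close> by (simp add: sum.distrib)
  qed simp
  have "p = (\<Sum>w\<in>cls ` set Ss. of_nat (length (filter (\<lambda>S. w = cls S) Ss)) * w)"
    unfolding X(2) cls_comp_series[OF Ss] by (rule sl) auto
  then show "p = (\<Sum>w | mult_in_class p w \<noteq> 0. of_nat (mult_in_class p w) * w)"
    unfolding nz unfolding m .
qed

lemma simple_iso:
  assumes S: "simple C S" and iso: "isomorphic C X S"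
  shows "simple C X"
proof -
  obtain i j where X: "X \<in> Ob C" and i: "i \<in> arrows C X S" "j \<in> arrows C S X" "Comp C j i = Id C X" "Comp C i j = Id C S"
    using iso unfolding isomorphic_def iso_arrow_def by blast
  have So: "S \<in> Ob C" using simple_Ob S by blast
  have ia: "iso_arrow C X S i" unfolding iso_arrow_def using i by blast
  have "zero_object C U \<or> iso_arrow C U X f" if U: "U \<in> Ob C" and f: "mono_arrow C U X f" for U f
  proof -
    have fa: "f \<in> arrows C U X" using f unfolding mono_arrow_def by blast
    have "mono_arrow C U S (Comp C i f)" by (rule mono_arrow_Comp[OF U X So f iso_arrow_mono[OF X So ia]])
    then have "zero_object C U \<or> iso_arrow C U S (Comp C i f)" using S U unfolding simple_def by blast
    moreover have "iso_arrow C U X f" if "iso_arrow C U S (Comp C i f)"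
    proof (rule mono_epi_iso[OF U X f], rule epi_arrowI[OF U X fa])
      fix W g assume g: "W \<in> Ob C" "g \<in> arrows C X W" "Comp C g f = zero_arrow C U W"
      have gj: "Comp C g j \<in> arrows C S W" by (rule Comp_arrow[OF So X g(1) i(2) g(2)])
      have "Comp C (Comp C g j) (Comp C i f) = Comp C g (Comp C (Comp C j i) f)"
        using Comp_assoc[OF U X So X fa i(1,2)] Comp_assoc[OF U So X g(1) Comp_arrow[OF U X So fa i(1)] i(2) g(2)] by simp
      also have "\<dots> = zero_arrow C U W" using i(3) Comp_Id[OF U X fa] g(3) by simp
      finally have "Comp C g j = zero_arrow C S W"
        using epi_arrow_cancel_zero[OF iso_arrow_epi[OF U So that] g(1) U So gj] by blast
      then have "Comp C (Comp C g j) i = zero_arrow C X W" using i X So g(1) by simp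
      then show "g = zero_arrow C X W"
        using Comp_assoc[OF X So X g(1) i(1,2) g(2)] i(3) Comp_Id[OF X g(1,2)] by simp
    qed
    ultimately show ?thesis by blast
  qed
  moreover have "\<not> zero_object C X" using zero_object_iso iso S unfolding simple_def by blast
  ultimately show ?thesis unfolding simple_def using X by blast
qed

end

sublocale field_valued_K0 \<subseteq> simple_basis simple_classes object_classes mult_in_class
  by (rule simple_basis)

locale Lambda_category = field_valued_K0 K C \<phi> + Lambda_structure C \<Omega> \<Lambda>
  for K :: "'k ring" and C :: "('o, 'a, 'k) mon_cat"
    and \<phi> :: "('o \<Rightarrow>\<^sub>0 int) set \<Rightarrow> 'f::field_char_0"
    and \<Omega> :: "'o set" and \<Lambda> :: "'o \<Rightarrow> 'o \<Rightarrow> int" +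
  assumes head_simple: "\<lbrakk>simple C M; simple C N; real_simple C M \<or> real_simple C N\<rbrakk> \<Longrightarrow> simple C (head_prod C M N)"
begin

definition LL :: "'f \<Rightarrow> 'f \<Rightarrow> int" where "LL u w = \<Lambda> (rep u) (rep w)"

definition hd :: "'f \<Rightarrow> 'f \<Rightarrow> 'f" where "hd u w = cls (head_prod C (rep u) (rep w))"

lemma cls_simple: "simple C M \<Longrightarrow> cls M \<in> simple_classes"
  unfolding simple_classes_def by blast

lemma rep_iso: "simple C M \<Longrightarrow> isomorphic C M (rep (cls M))"
  by (rule cls_simple_eq[OF simple_Ob rep(1)]) (simp_all add: cls_simple rep(2))

lemma LL_cls: "simple C M \<Longrightarrow> simple C N \<Longrightarrow> LL (cls M) (cls N) = \<Lambda> M N"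
  unfolding LL_def by (rule Lambda_iso[OF Omega_simple Omega_simple rep_iso rep_iso, symmetric])

text \<open>The tensor product has the class of a simple object and is therefore isomorphic to it.
  Simplicity of tensor products, and with it reality, can thus be read off from products in the
  field.\<close>

lemma rep_Tens:
  assumes "u \<in> simple_classes" "w \<in> simple_classes" "u * w \<in> simple_classes"
  shows "simple C (Tens C (rep u) (rep w))" "isomorphic C (Tens C (rep u) (rep w)) (rep (u * w))"
proof -
  have "cls (Tens C (rep u) (rep w)) = cls (rep (u * w))" using cls_Tens rep assms by simp
  then show "isomorphic C (Tens C (rep u) (rep w)) (rep (u * w))" using cls_simple_eq Tens_Ob rep assms by simp
  then show "simple C (Tens C (rep u) (rep w))" using simple_iso rep(1)[OF assms(3)] by blast
qed

lemma real_rep: "\<lbrakk>u \<in> simple_classes; u * u \<in> simple_classes\<rbrakk> \<Longrightarrow> real_simple C (rep u)"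
  unfolding real_simple_def using rep rep_Tens by blast

text \<open>Multiplication in the field is commutative, so the two tensor products have the same
  simple class and are isomorphic.\<close>

lemma strongly_commute_rep:
  assumes "u \<in> simple_classes" "w \<in> simple_classes" "u * w \<in> simple_classes"
  shows "strongly_commute C (rep u) (rep w)"
proof -
  have "isomorphic C (Tens C (rep w) (rep u)) (rep (u * w))" using rep_Tens(2)[OF assms(2,1)] assms(3) by (simp add: mult.commute)
  then show ?thesis unfolding strongly_commute_def
    using rep_Tens[OF assms] rep assms isomorphic_trans isomorphic_sym by blast
qed

lemma head_rep:
  assumes "u \<in> simple_classes" "w \<in> simple_classes" "u * u \<in> simple_classes \<or> w * w \<in> simple_classes"
  shows "simple C (head_prod C (rep u) (rep w))"
  using head_simple[OF rep(1)[OF assms(1)] rep(1)[OF assms(2)]] real_rep[OF assms(1)] real_rep[OF assms(2)] assms(3)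
  by blast

lemma LL_Tens:
  assumes "u \<in> simple_classes" "w \<in> simple_classes" "l \<in> simple_classes"
  shows "\<Lambda> (Tens C (rep u) (rep w)) (rep l) = LL u l + LL w l" "\<Lambda> (rep l) (Tens C (rep u) (rep w)) = LL l u + LL l w"
  unfolding LL_def using Lambda_Tens[of "rep u" "rep w" "rep l"] Omega_simple rep assms by auto

lemma Lambda_basis: "Lambda_basis simple_classes object_classes mult_in_class LL hd"
proof
  fix u w assume u: "u \<in> simple_classes" "w \<in> simple_classes"
  have T: "Tens C (rep u) (rep w) \<in> Ob C" "cls (Tens C (rep u) (rep w)) = u * w" using Tens_Ob cls_Tens rep u by auto
  have TO: "Tens C (rep u) (rep w) \<in> \<Omega>" using Omega_Tens Omega_simple rep u by blast
  {
    assume r: "u * u \<in> simple_classes \<or> w * w \<in> simple_classes"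
    have h: "simple C (head_prod C (rep u) (rep w))" by (rule head_rep[OF u r])
    obtain p where "epi_arrow C (Tens C (rep u) (rep w)) (head_prod C (rep u) (rep w)) p"
      unfolding head_prod_def using head_obj_epi T by blast
    then have "comp_mult C (Tens C (rep u) (rep w)) (head_prod C (rep u) (rep w)) > 0"
      using comp_mult_simple_quotient T h by blast
    then have "mult_in_class (u * w) (hd u w) \<noteq> 0"
      using mult_in_class_cls[OF T(1), of "hd u w"] T(2) comp_mult_cong[OF rep_iso[OF h]] cls_simple[OF h]
      unfolding hd_def by simp
    then show "hd u w \<in> supp (u * w)" unfolding supp_def by simp
  }
  {
    assume "u * u \<in> simple_classes" "w * w \<in> simple_classes" "u * w \<in> simple_classes"
    then have "dfun \<Lambda> (rep u) (rep w) = 0" using Lambda_commute real_rep strongly_commute_rep u by blast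
    then show "LL u w + LL w u = 0" unfolding dfun_def LL_def by (simp flip: of_int_add)
  }
  fix l assume l: "l \<in> simple_classes"
  have lO: "rep l \<in> \<Omega>" using Omega_simple rep l by blast
  {
    assume uw: "u * w \<in> simple_classes"
    show "LL (u * w) l = LL u l + LL w l \<and> LL l (u * w) = LL l u + LL l w"
      using LL_Tens[OF u l] Lambda_iso[OF TO lO rep_Tens(2)[OF u uw] isomorphic_refl]
        Lambda_iso[OF lO TO isomorphic_refl rep_Tens(2)[OF u uw]] rep(3)[OF l]
      unfolding LL_def by simp
  }
  {
    fix z assume z: "z \<in> supp (u * w)"
    then have zS: "z \<in> simple_classes" and pos: "comp_mult C (Tens C (rep u) (rep w)) (rep z) > 0"
      using mult_in_class_cls[OF T(1), of z] T(2) unfolding supp_def by (auto split: if_splits)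
    have sub: "subquotient C (rep z) (Tens C (rep u) (rep w))" "subquotient C (rep l) (rep l)"
      using subquotient_of_comp_mult[OF T(1) rep(1)[OF zS] pos] subquotient_refl rep(3)[OF l] by auto
    have nz: "\<not> zero_object C (rep z)" "\<not> zero_object C (rep l)" using rep(1) zS l unfolding simple_def by auto
    show "LL z l \<le> LL u l + LL w l \<and> LL l z \<le> LL l u + LL l w"
      using Lambda_subquotient[OF TO lO sub(1) nz(1) sub(2) nz(2)] Lambda_subquotient[OF lO TO sub(2) nz(2) sub(1) nz(1)]
        LL_Tens[OF u l] unfolding LL_def by simp
  }
  assume ll: "l * l \<in> simple_classes"
  {
    assume lw: "l * w \<in> simple_classes" and r: "u * u \<in> simple_classes \<or> w * w \<in> simple_classes"
    have "\<Lambda> (head_prod C (rep u) (rep w)) (rep l) = LL u l + LL w l"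
      unfolding LL_def using Lambda_head_left rep u real_rep[OF l ll] strongly_commute_rep[OF l u(2) lw] by blast
    then show "LL (hd u w) l = LL u l + LL w l"
      using LL_cls[OF head_rep[OF u r] rep(1)[OF l]] rep(2)[OF l] unfolding hd_def by simp
  }
  {
    assume lu: "l * u \<in> simple_classes" and r: "u * u \<in> simple_classes \<or> w * w \<in> simple_classes"
    have "\<Lambda> (rep l) (head_prod C (rep u) (rep w)) = LL l u + LL l w"
      unfolding LL_def using Lambda_head_right rep u real_rep[OF l ll] strongly_commute_rep[OF l u(1) lu] by blast
    then show "LL l (hd u w) = LL l u + LL l w"
      using LL_cls[OF rep(1)[OF l] head_rep[OF u r]] rep(2)[OF l] unfolding hd_def by simp
  }
qed

end

section \<open>Trees of seeds\<close>

lemma tree_edge_sym: "tree_edge n k t t' \<Longrightarrow> tree_edge n k t' t"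
  unfolding tree_edge_def by blast

lemma tree_edge_Cons:
  assumes "k # t \<in> tree_vertices n"
  shows "tree_edge n k t (k # t)"
  using assms unfolding tree_edge_def tree_vertices_def by (cases t) auto

lemma root_tree_vertex: "[] \<in> tree_vertices n"
  unfolding tree_vertices_def by simp

text \<open>The tree is connected: deleting initial letters leads to the root, and adding them leads
  back. The edge relation is symmetric, so the single hypothesis covers both directions.\<close>

lemma tree_propagate:
  assumes step: "\<And>k t t'. tree_edge n k t t' \<Longrightarrow> P t \<Longrightarrow> P t'"
    and s: "s \<in> tree_vertices n" "P s" and t: "t \<in> tree_vertices n"
  shows "P t"
proof -
  have tail: "t' \<in> tree_vertices n" if "k # t' \<in> tree_vertices n" for k t'
    using tree_edge_Cons[OF that] unfolding tree_edge_def by blast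
  have "P []" using s
  proof (induction s)
    case (Cons k s)
    then show ?case using step[OF tree_edge_sym[OF tree_edge_Cons]] tail by blast
  qed
  then show ?thesis using t
  proof (induction t)
    case (Cons k t)
    then show ?case using step[OF tree_edge_Cons] tail by blast
  qed
qed

lemma mutation_matrix_diag:
  assumes "mutation_matrix m n A" "k < n"
  shows "A $$ (k, k) = 0"
proof -
  obtain s where s: "\<And>i. i < n \<Longrightarrow> s i > 0" and sk: "skew_symmetric (mat_diag n s * principal_part n A)"
    using assms(1) unfolding mutation_matrix_def by blast
  let ?M = "mat_diag n s * principal_part n A"
  have M: "?M = mat n n (\<lambda>(i, j). s i * A $$ (i, j))"
    by (subst mat_diag_mult_left[of _ _ n]) (auto simp: principal_part_def)
  have "transpose_mat ?M $$ (k, k) = (- ?M) $$ (k, k)" using sk unfolding skew_symmetric_def by simp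
  then have "s k * A $$ (k, k) = - (s k * A $$ (k, k))" using assms(2) unfolding M by simp
  then show ?thesis using s[OF assms(2)] by simp
qed

section \<open>Cluster monomials as simple classes\<close>

locale Lambda_cluster = Lambda_basis Sm Pc coef LL hd
  for Sm Pc :: "'f::field_char_0 set" and coef :: "'f \<Rightarrow> 'f \<Rightarrow> nat"
    and LL :: "'f \<Rightarrow> 'f \<Rightarrow> int" and hd :: "'f \<Rightarrow> 'f \<Rightarrow> 'f" +
  fixes m n :: nat and x :: "nat list \<Rightarrow> nat \<Rightarrow> 'f" and B :: "nat list \<Rightarrow> int mat"
  assumes n_le_m: "n \<le> m"
    and pattern: "cluster_pattern m n x B"
    and cluster_monomials_Sm: "cluster_monomials m n x \<subseteq> Sm"
    and compatible: "\<exists>w \<in> tree_vertices n. \<exists>s.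
          compatible_pair m n (B w) (mat m m (\<lambda>(i, j). LL (x w i) (x w j))) s"
begin

abbreviation "\<T> \<equiv> tree_vertices n"

definition cmon :: "nat list \<Rightarrow> (nat \<Rightarrow> nat) \<Rightarrow> 'f" where
  "cmon t a = (\<Prod>j<m. x t j ^ a j)"

lemma cmon_cong: "(\<And>i. i < m \<Longrightarrow> a i = b i) \<Longrightarrow> cmon t a = cmon t b"
  unfolding cmon_def by (intro prod.cong) auto

lemma cmon_add: "cmon t (\<lambda>i. a i + b i) = cmon t a * cmon t b"
  unfolding cmon_def by (simp add: power_add prod.distrib)

lemma cmon_scale: "cmon t (\<lambda>i. c * a i) = cmon t a ^ c"
  unfolding cmon_def by (simp add: power_mult[symmetric] mult.commute prod_power_distrib)

lemma cmon_zero [simp]: "cmon t (\<lambda>_. 0) = 1"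
  unfolding cmon_def by simp

lemma cmon_single: "i < m \<Longrightarrow> cmon t (\<lambda>j. if j = i then c else 0) = x t i ^ c"
  unfolding cmon_def by (subst prod.remove[of _ i]) (auto intro!: prod.neutral)

lemma cmon_Sm: "t \<in> \<T> \<Longrightarrow> cmon t a \<in> Sm"
  using cluster_monomials_Sm unfolding cluster_monomials_def cmon_def by blast

lemma cmon_Pc: "t \<in> \<T> \<Longrightarrow> cmon t a \<in> Pc"
  using cmon_Sm Sm_Pc by blast

lemma cmon_mult_Sm: "t \<in> \<T> \<Longrightarrow> cmon t a * cmon t b \<in> Sm"
  using cmon_Sm[of t "\<lambda>i. a i + b i"] by (simp add: cmon_add)

lemma var_cmon: "i < m \<Longrightarrow> x t i = cmon t (\<lambda>j. if j = i then 1 else 0)"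
  using cmon_single[of i t 1] by simp

lemma var_Sm: "t \<in> \<T> \<Longrightarrow> i < m \<Longrightarrow> x t i \<in> Sm"
  using var_cmon cmon_Sm by simp

lemma var_cmon_Sm: "t \<in> \<T> \<Longrightarrow> i < m \<Longrightarrow> x t i * cmon t a \<in> Sm"
  by (subst var_cmon) (auto intro: cmon_mult_Sm)

lemma var_sq_Sm: "t \<in> \<T> \<Longrightarrow> i < m \<Longrightarrow> x t i * x t i \<in> Sm"
  using var_cmon_Sm[of t i "\<lambda>j. if j = i then 1 else 0"] var_cmon by simp

lemma one_Sm: "1 \<in> Sm"
  using cmon_Sm[OF root_tree_vertex, of "\<lambda>_. 0"] by simp

lemma seed: "t \<in> \<T> \<Longrightarrow> seed m n (x t) (B t)"
  using pattern unfolding cluster_pattern_def by blast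

text \<open>The difference of the two monomials, as a polynomial with coefficients 1 and -1, would
  vanish on an algebraically independent family.\<close>

lemma cmon_inj:
  assumes t: "t \<in> \<T>" and eq: "cmon t a = cmon t b" and i: "i < m"
  shows "a i = b i"
proof (rule ccontr)
  assume ne: "a i \<noteq> b i"
  \<comment> \<open>Exponents at indices outside the cluster are set to 0, which makes the support
    finite without changing the monomial.\<close>
  define ex where "ex a = Abs_poly_mapping (\<lambda>i. if i < m then a i else (0::nat))" for a
  have lex: "Poly_Mapping.lookup (ex a) = (\<lambda>i. if i < m then a i else 0)" for a
    unfolding ex_def by (rule Abs_poly_mapping_inverse) (auto intro: finite_subset[of _ "{..<m}"])
  have kex: "Poly_Mapping.keys (ex a) \<subseteq> {..<m}" for a
    by (auto simp: in_keys_iff lex split: if_splits)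
  have ev: "(\<Prod>j \<in> Poly_Mapping.keys (ex a). x t j ^ Poly_Mapping.lookup (ex a) j) = cmon t a" for a
  proof -
    have "(\<Prod>j \<in> Poly_Mapping.keys (ex a). x t j ^ Poly_Mapping.lookup (ex a) j)
        = (\<Prod>j<m. x t j ^ Poly_Mapping.lookup (ex a) j)"
      by (rule prod.mono_neutral_left) (use kex in \<open>auto simp: in_keys_iff\<close>)
    then show ?thesis unfolding cmon_def lex by simp
  qed
  have nab: "ex a \<noteq> ex b" using ne i lex by metis
  let ?p = "Poly_Mapping.single (ex a) (1::rat) - Poly_Mapping.single (ex b) 1"
  have lp: "Poly_Mapping.lookup ?p e = (if e = ex a then 1 else if e = ex b then -1 else 0)" for e
    using nab by (auto simp: lookup_minus lookup_single when_def)
  have kp: "Poly_Mapping.keys ?p = {ex a, ex b}" by (auto simp: in_keys_iff lp split: if_splits)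
  have "poly_eval of_rat (x t) ?p = 0"
    unfolding poly_eval_def kp using nab eq by (simp add: lp ev)
  moreover have "poly_in_vars m ?p" unfolding poly_in_vars_def kp using kex by blast
  moreover have "algebraically_independent m (x t)"
    using seed[OF t] unfolding seed_def free_generating_set_def by blast
  ultimately have "?p = 0" unfolding algebraically_independent_def by blast
  then show False using lp[of "ex a"] by simp
qed

text \<open>A vanishing variable would have equal first and second powers, against
  \<open>cmon_inj\<close>.\<close>

lemma var_nonzero:
  assumes "t \<in> \<T>" "i < m"
  shows "x t i \<noteq> 0"
proof
  assume "x t i = 0"
  then have "cmon t (\<lambda>j. if j = i then 1 else 0) = cmon t (\<lambda>j. if j = i then 2 else 0)"
    using assms by (simp add: cmon_single)
  from cmon_inj[OF assms(1) this assms(2)] show False by simp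
qed

lemma cmon_nonzero: "t \<in> \<T> \<Longrightarrow> cmon t a \<noteq> 0"
  unfolding cmon_def using var_nonzero by simp

lemma LL_one: "l \<in> Sm \<Longrightarrow> LL 1 l = 0 \<and> LL l 1 = 0"
  using LL_mult[of 1 1 l] one_Sm by simp

lemma LL_cmon:
  assumes t: "t \<in> \<T>" and l: "l \<in> Sm"
  shows "LL l (cmon t a) = (\<Sum>j<m. int (a j) * LL l (x t j))"
    and "LL (cmon t a) l = (\<Sum>j<m. int (a j) * LL (x t j) l)"
proof -
  have mult: "LL l (cmon t (\<lambda>i. b i + c i)) = LL l (cmon t b) + LL l (cmon t c) \<and>
      LL (cmon t (\<lambda>i. b i + c i)) l = LL (cmon t b) l + LL (cmon t c) l" for b c
    using LL_mult[OF cmon_Sm[OF t] cmon_Sm[OF t] l cmon_mult_Sm[OF t], of b c] by (simp add: cmon_add)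
  have pow: "LL l (cmon t (\<lambda>i. if i = j then c else 0)) = int c * LL l (x t j) \<and>
      LL (cmon t (\<lambda>i. if i = j then c else 0)) l = int c * LL (x t j) l" if "j < m" for j c
  proof (induction c)
    case 0
    then show ?case using LL_one[OF l] by simp
  next
    case (Suc c)
    have "(\<lambda>i. if i = j then Suc c else 0) = (\<lambda>i. (if i = j then c else 0) + (if i = j then 1 else 0))" by auto
    then show ?case using mult Suc var_cmon[OF that, of t] by (simp add: algebra_simps)
  qed
  have "LL l (cmon t (\<lambda>i. if i \<in> J then a i else 0)) = (\<Sum>j\<in>J. int (a j) * LL l (x t j)) \<and>
      LL (cmon t (\<lambda>i. if i \<in> J then a i else 0)) l = (\<Sum>j\<in>J. int (a j) * LL (x t j) l)" if "finite J" "J \<subseteq> {..<m}" for J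
    using that
  proof (induction J rule: finite_induct)
    case empty
    then show ?case using LL_one[OF l] by simp
  next
    case (insert j J)
    have "(\<lambda>i. if i \<in> insert j J then a i else 0) = (\<lambda>i. (if i \<in> J then a i else 0) + (if i = j then a j else 0))"
      using insert(2) by auto
    then show ?case using insert mult pow by simp
  qed
  from this[of "{..<m}"] have "LL l (cmon t (\<lambda>i. if i \<in> {..<m} then a i else 0)) = (\<Sum>j<m. int (a j) * LL l (x t j)) \<and>
      LL (cmon t (\<lambda>i. if i \<in> {..<m} then a i else 0)) l = (\<Sum>j<m. int (a j) * LL (x t j) l)" by simp
  moreover have "cmon t (\<lambda>i. if i \<in> {..<m} then a i else 0) = cmon t a" by (rule cmon_cong) simp
  ultimately show "LL l (cmon t a) = (\<Sum>j<m. int (a j) * LL l (x t j))"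
    and "LL (cmon t a) l = (\<Sum>j<m. int (a j) * LL (x t j) l)" by simp_all
qed

lemma LL_skew:
  assumes "t \<in> \<T>" "i < m" "j < m"
  shows "LL (x t i) (x t j) = - LL (x t j) (x t i)"
proof -
  have "x t i * x t j \<in> Sm" using var_cmon_Sm[OF assms(1,2)] var_cmon[OF assms(3)] by metis
  then show ?thesis using LL_commute[of "x t i" "x t j"] var_Sm var_sq_Sm assms by fastforce
qed

lemma LL_self: "t \<in> \<T> \<Longrightarrow> i < m \<Longrightarrow> LL (x t i) (x t i) = 0"
  using LL_skew[of t i i] by simp

definition X :: "nat list \<Rightarrow> nat \<Rightarrow> 'f" where "X t k = cmon t (pos_col (B t) k)"
definition Y :: "nat list \<Rightarrow> nat \<Rightarrow> 'f" where "Y t k = cmon t (neg_col (B t) k)"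

lemma B_diag: "t \<in> \<T> \<Longrightarrow> k < n \<Longrightarrow> B t $$ (k, k) = 0"
  using seed mutation_matrix_diag unfolding seed_def by blast

lemma edgeD:
  assumes "tree_edge n k t t'"
  shows "t \<in> \<T>" "t' \<in> \<T>" "k < n" "k < m" "B t' = mutate m n k (B t)" "B t = mutate m n k (B t')"
    "\<And>i. i < m \<Longrightarrow> i \<noteq> k \<Longrightarrow> x t' i = x t i" "x t k * x t' k = X t k + Y t k"
proof -
  show *: "t \<in> \<T>" "t' \<in> \<T>" "k < n" using assms unfolding tree_edge_def by auto
  then show "k < m" using n_le_m by simp
  have s: "seed_mutation m n k (x t) (B t) (x t') (B t')" "seed_mutation m n k (x t') (B t') (x t) (B t)"
    using pattern assms tree_edge_sym unfolding cluster_pattern_def by blast+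
  then show "B t' = mutate m n k (B t)" "B t = mutate m n k (B t')"
    "\<And>i. i < m \<Longrightarrow> i \<noteq> k \<Longrightarrow> x t' i = x t i" unfolding seed_mutation_def by auto
  show "x t k * x t' k = X t k + Y t k"
    using s(1) unfolding seed_mutation_def X_def Y_def cmon_def pos_col_def neg_col_def by simp
qed

lemma edge_col:
  assumes "tree_edge n k t t'" "i < m"
  shows "B t' $$ (i, k) = - B t $$ (i, k)" "pos_col (B t') k i = neg_col (B t) k i" "neg_col (B t') k i = pos_col (B t) k i"
proof -
  show "B t' $$ (i, k) = - B t $$ (i, k)"
    using edgeD(3,5)[OF assms(1)] assms(2) unfolding mutate_def by simp
  then show "pos_col (B t') k i = neg_col (B t) k i" "neg_col (B t') k i = pos_col (B t) k i"
    unfolding pos_col_def neg_col_def by simp_all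
qed

lemma col_self:
  assumes "t \<in> \<T>" "k < n"
  shows "pos_col (B t) k k = 0" "neg_col (B t) k k = 0"
  using B_diag[OF assms] unfolding pos_col_def neg_col_def pos_part_def by auto

lemma edge_cmon:
  assumes "tree_edge n k t t'" "a k = 0"
  shows "cmon t' a = cmon t a"
  unfolding cmon_def
proof (rule prod.cong)
  fix j assume "j \<in> {..<m}"
  then show "x t' j ^ a j = x t j ^ a j" using edgeD(7)[OF assms(1), of j] assms(2) by (cases "j = k") auto
qed simp

lemma edge_XY:
  assumes "tree_edge n k t t'"
  shows "X t' k = Y t k" "Y t' k = X t k"
proof -
  note e = edgeD[OF assms]
  have "X t' k = cmon t' (neg_col (B t) k)" "Y t' k = cmon t' (pos_col (B t) k)"
    unfolding X_def Y_def using edge_col(2,3)[OF assms] by (auto intro!: cmon_cong)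
  then show "X t' k = Y t k" "Y t' k = X t k"
    unfolding X_def Y_def using edge_cmon[OF assms] col_self[OF e(1,3)] by auto
qed

lemma X_Sm: "t \<in> \<T> \<Longrightarrow> X t k \<in> Sm" and Y_Sm: "t \<in> \<T> \<Longrightarrow> Y t k \<in> Sm"
  unfolding X_def Y_def by (auto intro: cmon_Sm)

lemma supp_exchange:
  assumes "tree_edge n k t t'"
  shows "supp (x t' k * x t k) = {X t k, Y t k}"
  using edgeD(1,8)[OF assms] supp_add[of "X t k" "Y t k"] X_Sm Y_Sm Sm_Pc supp_simple
  by (simp add: mult.commute insert_commute)

section \<open>Compatibility of \<Lambda> with the exchange matrices at all vertices\<close>

text \<open>The equation B^T \<Lambda> = (S | 0) of a compatible pair, entry by entry.\<close>

definition compat :: "nat list \<Rightarrow> (nat \<Rightarrow> int) \<Rightarrow> bool" where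
  "compat t s \<longleftrightarrow> (\<forall>k<n. s k > 0) \<and> (\<forall>k<n. \<forall>i<m. (\<Sum>j<m. B t $$ (j, k) * LL (x t j) (x t i)) = (if i = k then s k else 0))"

lemma compat_col_comb:
  assumes "compat t s" "i < m"
  shows "(\<Sum>j<m. col_comb n (B t) v j * LL (x t j) (x t i)) = (if i < n then s i * v i else 0)"
proof -
  have "(\<Sum>j<m. col_comb n (B t) v j * LL (x t j) (x t i))
      = (\<Sum>k<n. v k * (\<Sum>j<m. B t $$ (j, k) * LL (x t j) (x t i)))"
    unfolding col_comb_def sum_distrib_left sum_distrib_right by (subst sum.swap) (simp add: algebra_simps)
  also have "\<dots> = (\<Sum>k<n. v k * (if i = k then s k else 0))"
    using assms unfolding compat_def by (intro sum.cong) auto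
  also have "\<dots> = (if i < n then s i * v i else 0)" by (simp add: if_distrib mult.commute cong: if_cong)
  finally show ?thesis .
qed

lemma LL_X_minus_Y:
  assumes "t \<in> \<T>" "l \<in> Sm"
  shows "LL (X t k) l - LL (Y t k) l = (\<Sum>j<m. B t $$ (j, k) * LL (x t j) l)"
    and "LL l (X t k) - LL l (Y t k) = (\<Sum>j<m. B t $$ (j, k) * LL l (x t j))"
  unfolding X_def Y_def using assms
  by (simp_all add: LL_cmon sum_subtractf[symmetric] left_diff_distrib[symmetric] pos_minus_neg_col)

text \<open>The head of the product of \<open>x t' k\<close> and \<open>x t k\<close> is one of the
  two exchange monomials, and by compatibility \<Lambda> against \<open>x t i\<close> takes the same
  value on both. So (a4) fixes \<Lambda> for the new variable before it is known which of them is
  the head.\<close>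

lemma edge_LL:
  assumes e: "tree_edge n k t t'" and c: "compat t s" and i: "i < m" "i \<noteq> k"
  shows "LL (x t' k) (x t i) + LL (x t k) (x t i) = LL (Y t k) (x t i)"
    and "LL (X t k) (x t i) = LL (Y t k) (x t i)"
    and "LL (x t i) (x t' k) + LL (x t i) (x t k) = LL (x t i) (Y t k)"
    and "LL (x t i) (X t k) = LL (x t i) (Y t k)"
proof -
  note D = edgeD[OF e]
  have xs: "x t i \<in> Sm" "x t k \<in> Sm" "x t' k \<in> Sm" "x t i * x t i \<in> Sm" "x t k * x t k \<in> Sm"
    using var_Sm var_sq_Sm D i by auto
  have c1: "x t i * x t k \<in> Sm" using var_cmon_Sm[OF D(1) i(1)] var_cmon[OF D(4)] by metis
  have "x t' i * x t' k \<in> Sm" using var_cmon_Sm[OF D(2) i(1)] var_cmon[OF D(4)] by metis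
  then have c2: "x t i * x t' k \<in> Sm" using D(7) i by simp
  have h: "hd (x t' k) (x t k) \<in> {X t k, Y t k}" using hd_supp[of "x t' k" "x t k"] xs supp_exchange[OF e] by blast
  show a: "LL (X t k) (x t i) = LL (Y t k) (x t i)"
    using LL_X_minus_Y(1)[OF D(1) xs(1), of k] c i D(3) unfolding compat_def by simp
  have "(\<Sum>j<m. B t $$ (j, k) * LL (x t i) (x t j)) = - (\<Sum>j<m. B t $$ (j, k) * LL (x t j) (x t i))"
    unfolding sum_negf[symmetric] by (intro sum.cong refl, subst LL_skew[OF D(1) i(1)]) auto
  then show b: "LL (x t i) (X t k) = LL (x t i) (Y t k)"
    using LL_X_minus_Y(2)[OF D(1) xs(1), of k] c i D(3) unfolding compat_def by simp
  show "LL (x t' k) (x t i) + LL (x t k) (x t i) = LL (Y t k) (x t i)"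
    using LL_hd_left[OF xs(3,2,1,4) c1 disjI2[OF xs(5)]] h a by auto
  show "LL (x t i) (x t' k) + LL (x t i) (x t k) = LL (x t i) (Y t k)"
    using LL_hd_right[OF xs(3,2,1,4) c2 disjI2[OF xs(5)]] h b by auto
qed

text \<open>The matrix B^T \<Lambda> B is skew-symmetric because \<Lambda> is, and compatibility
  identifies it with S times the principal part of B.\<close>

lemma compat_skew_symmetrizable:
  assumes t: "t \<in> \<T>" and c: "compat t s" and pk: "p < n" "k < n"
  shows "s p * B t $$ (p, k) = - s k * B t $$ (k, p)"
proof -
  let ?f = "\<lambda>p k. \<Sum>j<m. \<Sum>i<m. B t $$ (j, p) * LL (x t j) (x t i) * B t $$ (i, k)"
  have f: "?f p k = s p * B t $$ (p, k)" if "p < n" "k < n" for p k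
  proof -
    have "?f p k = (\<Sum>i<m. (\<Sum>j<m. B t $$ (j, p) * LL (x t j) (x t i)) * B t $$ (i, k))"
      unfolding sum_distrib_right by (rule sum.swap)
    also have "\<dots> = (\<Sum>i<m. (if i = p then s p else 0) * B t $$ (i, k))"
      using c that unfolding compat_def by (intro sum.cong) auto
    also have "\<dots> = s p * B t $$ (p, k)" using that n_le_m by (simp add: if_distrib if_distribR cong: if_cong)
    finally show ?thesis .
  qed
  have "?f k p = (\<Sum>j<m. \<Sum>i<m. B t $$ (i, k) * LL (x t i) (x t j) * B t $$ (j, p))" by (rule sum.swap)
  also have "\<dots> = - ?f p k"
    unfolding sum_negf[symmetric] by (intro sum.cong refl, subst LL_skew) (use t in auto)
  finally show ?thesis using f pk by simp
qed

text \<open>Let E be the matrix whose columns are the values of \<open>?E\<close> on unit vectors.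
  Then \<Lambda> at \<open>t'\<close> is E^T \<Lambda> E by \<open>edge_LL\<close>, and E maps each
  column of \<open>B t'\<close> into the column lattice of \<open>B t\<close> by
  \<open>exp_mutate_col\<close>. The equation at \<open>t\<close> leaves a sum of two terms.\<close>

lemma compat_edge:
  assumes e: "tree_edge n k t t'" and c: "compat t s"
  shows "compat t' s"
  unfolding compat_def[of t']
proof (intro conjI allI impI)
  fix p i assume p: "p < n" and i: "i < m"
  note D = edgeD[OF e]
  let ?E = "exp_mutate (B t') k"
  define unit where "unit i = (\<lambda>j. if j = i then 1 else (0::int))" for i :: nat
  have lam: "LL (x t' j) (x t' i) = (\<Sum>q<m. \<Sum>r<m. ?E (unit j) q * ?E (unit i) r * LL (x t q) (x t r))"
    if j: "j < m" and i: "i < m" for i j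
  proof -
    define \<phi> where "\<phi> v w = (\<Sum>q<m. \<Sum>r<m. v q * w r * LL (x t q) (x t r))" for v w :: "nat \<Rightarrow> int"
    \<comment> \<open>\<open>y\<close> is the exponent vector of \<open>Y t k\<close>. It is also
      the positive part of column k of \<open>B t'\<close>, so \<open>?E\<close> sends the k-th unit
      vector to \<open>y\<close> minus that vector.\<close>
    define y where "y = (\<lambda>q. int (neg_col (B t) k q))"
    have Eu: "\<phi> (?E (unit j)) w = (if j = k then \<phi> y w - \<phi> (unit k) w else \<phi> (unit j) w)" for w j
    proof (cases "j = k")
      case True
      have "?E (unit k) q = y q - unit k q" if "q < m" for q
        using edge_col(2)[OF e that] col_self[OF D(1,3)] by (auto simp: exp_mutate_def unit_def y_def)
      then have "\<phi> (?E (unit k)) w = (\<Sum>q<m. \<Sum>r<m. (y q - unit k q) * w r * LL (x t q) (x t r))"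
        unfolding \<phi>_def by (intro sum.cong) auto
      then show ?thesis using True unfolding \<phi>_def by (simp add: left_diff_distrib sum_subtractf)
    next
      case False
      then have "?E (unit j) = unit j" by (auto simp: exp_mutate_def unit_def)
      then show ?thesis using False by simp
    qed
    have Eu': "\<phi> v (?E (unit i)) = (if i = k then \<phi> v y - \<phi> v (unit k) else \<phi> v (unit i))" for v i
    proof (cases "i = k")
      case True
      have "?E (unit k) q = y q - unit k q" if "q < m" for q
        using edge_col(2)[OF e that] col_self[OF D(1,3)] by (auto simp: exp_mutate_def unit_def y_def)
      then have "\<phi> v (?E (unit k)) = (\<Sum>q<m. \<Sum>r<m. v q * (y r - unit k r) * LL (x t q) (x t r))"
        unfolding \<phi>_def by (intro sum.cong) auto
      then show ?thesis using True unfolding \<phi>_def by (simp add: left_diff_distrib right_diff_distrib sum_subtractf)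
    next
      case False
      then have "?E (unit i) = unit i" by (auto simp: exp_mutate_def unit_def)
      then show ?thesis using False by simp
    qed
    have \<phi>_skew: "\<phi> v w = - \<phi> w v" for v w
    proof -
      have "\<phi> v w = (\<Sum>r<m. \<Sum>q<m. v q * w r * LL (x t q) (x t r))" unfolding \<phi>_def by (rule sum.swap)
      also have "\<dots> = - \<phi> w v" unfolding \<phi>_def sum_negf[symmetric]
        by (intro sum.cong refl, subst LL_skew) (use D in auto)
      finally show ?thesis .
    qed
    have uu: "\<phi> (unit j) (unit i) = LL (x t j) (x t i)" if "j < m" "i < m" for i j
    proof -
      have "\<phi> (unit j) (unit i) = (\<Sum>q<m. unit j q * (\<Sum>r<m. if r = i then LL (x t q) (x t r) else 0))"
        unfolding \<phi>_def sum_distrib_left by (intro sum.cong refl) (simp add: unit_def)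
      then show ?thesis using that by (simp add: unit_def if_distrib[of "\<lambda>a. a * _"] cong: if_cong)
    qed
    have yu: "\<phi> y (unit i) = LL (Y t k) (x t i)" if "i < m" for i
    proof -
      have "\<phi> y (unit i) = (\<Sum>q<m. \<Sum>r<m. if r = i then y q * LL (x t q) (x t r) else 0)"
        unfolding \<phi>_def unit_def by (intro sum.cong) (auto intro!: sum.cong)
      then show ?thesis using that LL_cmon(2)[OF D(1) var_Sm[OF D(1) that]] unfolding Y_def y_def by simp
    qed
    have \<phi>_self: "\<phi> v v = 0" for v using \<phi>_skew[of v v] by simp
    have k1: "LL (x t' k) (x t' i) = \<phi> (?E (unit k)) (?E (unit i))" if "i < m" "i \<noteq> k" for i
      using uu[OF D(4) that(1)] yu[OF that(1)] edge_LL(1)[OF e c that] D(7)[OF that] that(2)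
      unfolding Eu Eu' by simp
    have "LL (x t' j) (x t' i) = \<phi> (?E (unit j)) (?E (unit i))"
    proof (cases "j = k")
      case True
      then show ?thesis using k1[OF i] \<phi>_self LL_self[OF D(2,4)] by (cases "i = k") auto
    next
      case j': False
      show ?thesis
      proof (cases "i = k")
        case True
        then show ?thesis using k1[OF j j'] \<phi>_skew[of "?E (unit j)"] LL_skew[OF D(2) j D(4)] by simp
      next
        case False
        then show ?thesis using Eu Eu' uu[OF j i] D(7) i j j' by simp
      qed
    qed
    then show ?thesis unfolding \<phi>_def .
  qed
  have Elin: "(\<Sum>j<m. v j * ?E (unit j) q) = ?E v q" if "q < m" for v q
  proof -
    have "(\<Sum>j<m. v j * ?E (unit j) q) = (\<Sum>j<m. (if j = q then v j * (if q = k then -1 else 1) else 0)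
       + (if j = k then (if q = k then 0 else v j * int (pos_col (B t') k q)) else 0))"
      by (intro sum.cong) (auto simp: exp_mutate_def unit_def)
    then show ?thesis using that D(4) by (simp add: sum.distrib exp_mutate_def)
  qed
  \<comment> \<open>Coefficients of the image of column p in terms of the columns of
    \<open>B t\<close>, from \<open>exp_mutate_col\<close> for the edge read backwards.\<close>
  define w where "w = (\<lambda>l. (if l = p then if p = k then -1 else 1 else 0)
        + (if l = k then pos_part (B t' $$ (k, p)) - B t' $$ (k, p) else (0::int)))"
  have col: "?E (\<lambda>i. B t' $$ (i, p)) q = col_comb n (B t) w q" if "q < m" for q
    using exp_mutate_col[OF D(3) B_diag[OF D(2,3)] p that] D(6) unfolding w_def by simp
  have "(\<Sum>j<m. B t' $$ (j, p) * LL (x t' j) (x t' i))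
      = (\<Sum>j<m. \<Sum>q<m. \<Sum>r<m. B t' $$ (j, p) * ?E (unit j) q * (?E (unit i) r * LL (x t q) (x t r)))"
    using lam i by (simp add: sum_distrib_left mult.assoc)
  also have "\<dots> = (\<Sum>q<m. \<Sum>r<m. \<Sum>j<m. B t' $$ (j, p) * ?E (unit j) q * (?E (unit i) r * LL (x t q) (x t r)))"
    by (rule trans[OF sum.swap], rule sum.cong[OF refl], rule sum.swap)
  also have "\<dots> = (\<Sum>q<m. \<Sum>r<m. col_comb n (B t) w q * (?E (unit i) r * LL (x t q) (x t r)))"
    unfolding sum_distrib_right[symmetric] using Elin[of _ "\<lambda>j. B t' $$ (j, p)"] col by (intro sum.cong) auto
  also have "\<dots> = (\<Sum>r<m. ?E (unit i) r * (\<Sum>q<m. col_comb n (B t) w q * LL (x t q) (x t r)))"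
    unfolding sum_distrib_left by (subst sum.swap) (simp add: mult.left_commute)
  also have "\<dots> = (\<Sum>r<m. if r < n then ?E (unit i) r * (s r * w r) else 0)"
    using compat_col_comb[OF c] by (intro sum.cong) auto
  also have "\<dots> = (\<Sum>r<n. ?E (unit i) r * (s r * w r))"
    by (rule sum.mono_neutral_cong_right) (use n_le_m in auto)
  also have "\<dots> = (\<Sum>r<n. (if r = p then ?E (unit i) r * s r * (if p = k then -1 else 1) else 0)
      + (if r = k then ?E (unit i) r * s r * (pos_part (B t' $$ (k, p)) - B t' $$ (k, p)) else 0))"
    by (intro sum.cong) (auto simp: w_def algebra_simps)
  also have "\<dots> = ?E (unit i) p * s p * (if p = k then -1 else 1)
      + ?E (unit i) k * s k * (pos_part (B t' $$ (k, p)) - B t' $$ (k, p))"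
    using p D(3) by (simp add: sum.distrib)
  also have "\<dots> = (if i = p then s p else 0)"
  \<comment> \<open>The only entry that is not immediate has i = k and p different from k: the two
    terms cancel because skew-symmetrizability gives s_p [-b_pk]_+ = s_k [b_kp]_+.\<close>
  proof (cases "i = k")
    case True
    show ?thesis
    proof (cases "p = k")
      case False
      have Bkp: "B t' $$ (k, p) = - B t $$ (k, p)" using D(3,4,5) p by (simp add: mutate_def)
      have "s p * B t $$ (p, k) = - s k * B t $$ (k, p)" using compat_skew_symmetrizable[OF D(1) c p D(3)] .
      moreover have "pos_col (B t') k p = neg_col (B t) k p" using edge_col(2)[OF e] p n_le_m by simp
      moreover have "int (neg_col (B t) k p) = pos_part (- B t $$ (p, k))" unfolding neg_col_def pos_part_def by simp
      moreover have "pos_part (- a) * s p = pos_part b * s k" if "s p * a = - s k * b" "s p > 0" "s k > 0" for a b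
      proof -
        have "pos_part b * s k = max (b * s k) 0" "pos_part (- a) * s p = max (- a * s p) 0"
          using that(2,3) unfolding pos_part_def by (simp_all add: max_mult_distrib_right)
        then show ?thesis using that(1) by (simp add: mult.commute)
      qed
      moreover have "s p > 0" "s k > 0" using c p D(3) unfolding compat_def by auto
      moreover have "pos_part (- B t $$ (k, p)) + B t $$ (k, p) = pos_part (B t $$ (k, p))" unfolding pos_part_def by auto
      ultimately show ?thesis using True False Bkp col_self[OF D(2,3)]
        by (simp add: exp_mutate_def unit_def)
    qed (use True B_diag[OF D(2,3)] col_self[OF D(2,3)] in \<open>simp add: exp_mutate_def unit_def pos_part_def\<close>)
  qed (use B_diag[OF D(2,3)] in \<open>auto simp: exp_mutate_def unit_def pos_part_def\<close>)
  finally show "(\<Sum>j<m. B t' $$ (j, p) * LL (x t' j) (x t' i)) = (if i = p then s p else 0)" .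
qed (use c in \<open>simp add: compat_def\<close>)

end

lemma col_cong_add_same: "col_cong m n A e e' \<Longrightarrow> col_cong m n A (\<lambda>i. e i + f i) (\<lambda>i. e' i + f i)"
  by (rule col_cong_add[OF _ col_cong_refl[OF refl]])

context Lambda_cluster
begin

lemma ex_compat: "\<exists>s. \<forall>t \<in> \<T>. compat t s"
proof -
  obtain w s where w: "w \<in> \<T>" and c: "compatible_pair m n (B w) (mat m m (\<lambda>(i, j). LL (x w i) (x w j))) s"
    using compatible by blast
  let ?L = "mat m m (\<lambda>(i, j). LL (x w i) (x w j))"
  have Bw: "B w \<in> carrier_mat m n" using c unfolding compatible_pair_def mutation_matrix_def by blast
  have "compat w s" unfolding compat_def
  proof (intro conjI allI impI)
    fix k i assume ki: "k < n" "i < m"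
    have "(transpose_mat (B w) * ?L) $$ (k, i) = (if i = k then s k else 0)"
      using c ki unfolding compatible_pair_def by auto
    moreover have "(transpose_mat (B w) * ?L) $$ (k, i) = (\<Sum>j<m. B w $$ (j, k) * LL (x w j) (x w i))"
      using ki Bw by (auto simp: scalar_prod_def atLeast0LessThan intro!: sum.cong)
    ultimately show "(\<Sum>j<m. B w $$ (j, k) * LL (x w j) (x w i)) = (if i = k then s k else 0)" by simp
  qed (use c in \<open>auto simp: compatible_pair_def\<close>)
  then show ?thesis using tree_propagate[of n "\<lambda>t. compat t s"] compat_edge w by blast
qed

definition sk :: "nat \<Rightarrow> int" where "sk = (SOME s. \<forall>t \<in> \<T>. compat t s)"

lemma compat_sk: "t \<in> \<T> \<Longrightarrow> compat t sk"
  unfolding sk_def using someI_ex[OF ex_compat] by blast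

lemma sk_pos: "k < n \<Longrightarrow> sk k > 0"
  using compat_sk[OF root_tree_vertex] unfolding compat_def by blast

text \<open>The minus sign comes from exchanging the arguments of \<Lambda>. Because of it, large
  values of \<Lambda>(x_i, _) inside a congruence class belong to small coefficients v_i.\<close>

lemma LL_col_comb:
  assumes "t \<in> \<T>" "i < m"
  shows "(\<Sum>j<m. col_comb n (B t) v j * LL (x t i) (x t j)) = (if i < n then - sk i * v i else 0)"
proof -
  have "(\<Sum>j<m. col_comb n (B t) v j * LL (x t i) (x t j)) = - (\<Sum>j<m. col_comb n (B t) v j * LL (x t j) (x t i))"
    unfolding sum_negf[symmetric] by (intro sum.cong refl, subst LL_skew[OF assms]) auto
  then show ?thesis using compat_col_comb[OF compat_sk[OF assms(1)] assms(2)] by simp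
qed

text \<open>Pairing with \<Lambda> multiplies the k-th coefficient by -s_k, so the columns of the
  exchange matrix are linearly independent.\<close>

lemma col_comb_inj:
  assumes "t \<in> \<T>" "\<And>i. i < m \<Longrightarrow> col_comb n (B t) v i = col_comb n (B t) w i" "k < n"
  shows "v k = w k"
proof -
  have km: "k < m" using assms(3) n_le_m by simp
  have "(\<Sum>j<m. col_comb n (B t) v j * LL (x t k) (x t j)) = (\<Sum>j<m. col_comb n (B t) w j * LL (x t k) (x t j))"
    using assms(2) by (intro sum.cong) auto
  then show ?thesis using LL_col_comb[OF assms(1) km] assms(3) sk_pos[OF assms(3)] by simp
qed

lemma LL_col_cong:
  assumes t: "t \<in> \<T>" and i: "i < m" and v: "\<And>j. j < m \<Longrightarrow> int (b j) = int (b' j) + col_comb n (B t) v j"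
  shows "LL (x t i) (cmon t b) = LL (x t i) (cmon t b') - (if i < n then sk i * v i else 0)"
proof -
  have "LL (x t i) (cmon t b) = (\<Sum>j<m. int (b' j) * LL (x t i) (x t j)) + (\<Sum>j<m. col_comb n (B t) v j * LL (x t i) (x t j))"
    unfolding LL_cmon(1)[OF t var_Sm[OF t i]] sum.distrib[symmetric] using v by (intro sum.cong) (auto simp: distrib_right)
  then show ?thesis using LL_col_comb[OF t i] LL_cmon(1)[OF t var_Sm[OF t i]] by simp
qed

text \<open>Inside a congruence class \<Lambda>(x_i, _) is constant for frozen i and determines v_i
  for mutable i.\<close>

lemma cmon_eq_of_LL:
  assumes t: "t \<in> \<T>" and c: "col_cong m n (B t) (\<lambda>j. int (b j)) (\<lambda>j. int (b' j))"
    and eq: "\<And>i. i < n \<Longrightarrow> LL (x t i) (cmon t b) = LL (x t i) (cmon t b')"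
  shows "cmon t b = cmon t b'"
proof -
  obtain v where v: "\<And>j. j < m \<Longrightarrow> int (b j) = int (b' j) + col_comb n (B t) v j"
    using c unfolding col_cong_def by blast
  have "v i = 0" if "i < n" for i
    using LL_col_cong[OF t _ v, of i] eq[OF that] sk_pos[OF that] that n_le_m by simp
  then have "col_comb n (B t) v j = 0" for j unfolding col_comb_def by simp
  then show ?thesis using v by (intro cmon_cong) simp
qed

section \<open>Crossing an edge\<close>

text \<open>Exponents of \<open>x\<^sup>b X\<^sup>i Y\<^sup>q\<^sup>-\<^sup>i\<close>, with the exponent of \<open>x\<^sub>k\<close> replaced by \<open>c\<close>.\<close>

definition mix :: "nat list \<Rightarrow> nat \<Rightarrow> nat \<Rightarrow> nat \<Rightarrow> (nat \<Rightarrow> nat) \<Rightarrow> nat \<Rightarrow> nat \<Rightarrow> nat" where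
  "mix t k q i b c j = (if j = k then c else b j + i * pos_col (B t) k j + (q - i) * neg_col (B t) k j)"

lemma cmon_upd: "k < m \<Longrightarrow> cmon t (b(k := c)) = cmon t (b(k := 0)) * x t k ^ c"
  unfolding cmon_single[symmetric] cmon_add[symmetric] by (rule cmon_cong) auto

lemma cmon_mix:
  assumes e: "tree_edge n k t t'"
  shows "cmon t (mix t k q i b c) = cmon t (b(k := 0)) * X t k ^ i * Y t k ^ (q - i) * x t k ^ c"
    and "cmon t' (mix t k q i b c) = cmon t (b(k := 0)) * X t k ^ i * Y t k ^ (q - i) * x t' k ^ c"
proof -
  note D = edgeD[OF e]
  let ?b0 = "\<lambda>j. (b(k := 0)) j + i * pos_col (B t) k j + (q - i) * neg_col (B t) k j"
  have b0: "?b0 k = 0" using col_self[OF D(1,3)] by simp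
  have 0: "cmon t ?b0 = cmon t (b(k := 0)) * X t k ^ i * Y t k ^ (q - i)"
    unfolding X_def Y_def cmon_scale[symmetric] cmon_add[symmetric] ..
  have "mix t k q i b c = ?b0(k := c)" "?b0(k := 0) = ?b0" using b0 by (auto simp: mix_def fun_eq_iff)
  then show "cmon t (mix t k q i b c) = cmon t (b(k := 0)) * X t k ^ i * Y t k ^ (q - i) * x t k ^ c"
    and "cmon t' (mix t k q i b c) = cmon t (b(k := 0)) * X t k ^ i * Y t k ^ (q - i) * x t' k ^ c"
    using cmon_upd[OF D(4), of t ?b0 c] cmon_upd[OF D(4), of t' ?b0 c] edge_cmon[OF e, of ?b0] b0 0 by metis+
qed

text \<open>Binomial expansion of (x_k x_k')^(b_k): here x_k is used up and the summands are
  monomials at \<open>t'\<close>. In \<open>cmon_power_low\<close> it is x_k' that is used up, and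
  the summands stay at \<open>t\<close>.\<close>

lemma cmon_power_high:
  assumes e: "tree_edge n k t t'" and p: "b k \<le> p"
  shows "cmon t b * x t' k ^ p = (\<Sum>i\<le>b k. of_nat (b k choose i) * cmon t' (mix t k (b k) i b (p - b k)))"
proof -
  note D = edgeD[OF e]
  have "cmon t b * x t' k ^ p = cmon t (b(k := 0)) * (x t k * x t' k) ^ b k * x t' k ^ (p - b k)"
    using cmon_upd[OF D(4), of t b "b k"] p
    by (simp add: power_mult_distrib mult.assoc) (simp add: power_add[symmetric])
  also have "\<dots> = (\<Sum>i\<le>b k. of_nat (b k choose i) * cmon t' (mix t k (b k) i b (p - b k)))"
    unfolding D(8) binomial_ring sum_distrib_left sum_distrib_right cmon_mix(2)[OF e]
    by (intro sum.cong) (auto simp: algebra_simps)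
  finally show ?thesis .
qed

lemma cmon_power_low:
  assumes e: "tree_edge n k t t'" and p: "p \<le> b k"
  shows "cmon t b * x t' k ^ p = (\<Sum>i\<le>p. of_nat (p choose i) * cmon t (mix t k p i b (b k - p)))"
proof -
  note D = edgeD[OF e]
  have "cmon t b * x t' k ^ p = cmon t (b(k := 0)) * (x t k * x t' k) ^ p * x t k ^ (b k - p)"
  proof -
    have "cmon t b = cmon t (b(k := 0)) * (x t k ^ p * x t k ^ (b k - p))"
      using cmon_upd[OF D(4), of t b "b k"] p by (simp add: power_add[symmetric])
    then show ?thesis by (simp add: power_mult_distrib mult.assoc mult.left_commute mult.commute)
  qed
  also have "\<dots> = (\<Sum>i\<le>p. of_nat (p choose i) * cmon t (mix t k p i b (b k - p)))"
    unfolding D(8) binomial_ring sum_distrib_left sum_distrib_right cmon_mix(1)[OF e]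
    by (intro sum.cong) (auto simp: algebra_simps)
  finally show ?thesis .
qed

lemma supp_binomial:
  assumes "\<And>i. f i \<in> Sm"
  shows "supp (\<Sum>i\<le>q. of_nat (q choose i) * f i) = f ` {..q}"
proof -
  have "supp (\<Sum>i\<le>q. of_nat (q choose i) * f i) = (\<Union>i\<in>{..q}. supp (of_nat (q choose i) * f i))"
    by (rule supp_sum) (auto intro: Pc_of_nat_mult Sm_Pc assms)
  also have "\<dots> = (\<Union>i\<in>{..q}. {f i})"
    by (intro SUP_cong) (auto simp: supp_of_nat_mult Sm_Pc assms supp_simple)
  finally show ?thesis by auto
qed

lemma supp_cmon_power_high:
  "tree_edge n k t t' \<Longrightarrow> b k \<le> p \<Longrightarrow>
    supp (cmon t b * x t' k ^ p) = (\<lambda>i. cmon t' (mix t k (b k) i b (p - b k))) ` {..b k}"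
  by (simp add: cmon_power_high supp_binomial cmon_Sm edgeD(2))

lemma supp_cmon_power_low:
  "tree_edge n k t t' \<Longrightarrow> p \<le> b k \<Longrightarrow>
    supp (cmon t b * x t' k ^ p) = (\<lambda>i. cmon t (mix t k p i b (b k - p))) ` {..p}"
  by (simp add: cmon_power_low supp_binomial cmon_Sm edgeD(1))

text \<open>Congruence modulo the columns of the exchange matrix records that the expansion of \<open>u\<close> is a
  monomial times a polynomial in the \<open>yhat\<close>.  In \<open>mixed_data\<close> the class \<open>g\<close> is expressed in the cluster at \<open>t\<close>.\<close>

definition laurent_data :: "nat list \<Rightarrow> 'f \<Rightarrow> (nat \<Rightarrow> nat) \<Rightarrow> (nat \<Rightarrow> int) \<Rightarrow> bool" where
  "laurent_data t u a g \<longleftrightarrow>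
     (\<forall>w \<in> supp (cmon t a * u). \<exists>b. w = cmon t b \<and> col_cong m n (B t) (\<lambda>i. int (b i)) g)"

definition mixed_data :: "nat list \<Rightarrow> nat list \<Rightarrow> nat \<Rightarrow> 'f \<Rightarrow> (nat \<Rightarrow> nat) \<Rightarrow> (nat \<Rightarrow> int) \<Rightarrow> bool" where
  "mixed_data t t' k u a g \<longleftrightarrow> a k = 0 \<and> (\<forall>w \<in> supp (cmon t a * u).
     (\<exists>b. w = cmon t b \<and> col_cong m n (B t) (\<lambda>i. int (b i)) g) \<or>
     (\<exists>b. w = cmon t' b \<and> col_cong m n (B t') (\<lambda>i. int (b i)) (exp_mutate (B t) k g)))"

text \<open>The two substitutions insert X at \<open>t\<close> and X at \<open>t'\<close>, and the
  latter is Y at \<open>t\<close>. The composite therefore adds g_k times the difference of their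
  exponents, which is column k.\<close>

lemma exp_mutate_involution:
  assumes e: "tree_edge n k t t'"
  shows "col_cong m n (B t) (exp_mutate (B t') k (exp_mutate (B t) k g)) g"
  by (rule col_cong_single[OF edgeD(3)[OF e], of _ _ _ "g k"])
    (use edge_col(2)[OF e] pos_minus_neg_col[of "B t" k] col_self[OF edgeD(1,3)[OF e]] B_diag[OF edgeD(1,3)[OF e]] in
      \<open>auto simp: exp_mutate_def algebra_simps\<close>)

lemma mixed_data_sym:
  assumes e: "tree_edge n k t t'" and d: "mixed_data t t' k u a g"
  shows "mixed_data t' t k u a (exp_mutate (B t) k g)"
proof -
  have "cmon t' a = cmon t a" using d edge_cmon[OF e] unfolding mixed_data_def by blast
  then show ?thesis
    using d col_cong_trans[OF _ col_cong_sym[OF exp_mutate_involution[OF e]]] unfolding mixed_data_def by metis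
qed

lemma cmon_mult_Pc: "t \<in> \<T> \<Longrightarrow> u \<in> Sm \<Longrightarrow> cmon t a * u \<in> Pc"
  by (simp add: Pc_mult cmon_Pc Sm_Pc)

lemma var_power_Pc: "t \<in> \<T> \<Longrightarrow> k < m \<Longrightarrow> x t k ^ p \<in> Pc"
  using cmon_Pc[of t] cmon_single[of k t p] by metis

text \<open>Replacing every x_k by X / x_k' is \<open>exp_mutate\<close>; this is the summand i =
  b_k. Each of the b_k - i factors with Y in place of X changes the exponents by column k of
  \<open>B t'\<close>.\<close>

lemma mix_cong_high:
  assumes e: "tree_edge n k t t'" and c: "col_cong m n (B t) (\<lambda>i. int (b i)) g" and i: "i \<le> b k" "b k \<le> p"
  shows "col_cong m n (B t') (\<lambda>j. int (mix t k (b k) i b (p - b k) j))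
     (\<lambda>j. exp_mutate (B t) k g j + (if j = k then int p else 0))"
proof -
  note D = edgeD[OF e]
  have "col_cong m n (B t') (\<lambda>j. int (mix t k (b k) i b (p - b k) j))
     (\<lambda>j. exp_mutate (B t) k (\<lambda>i. int (b i)) j + (if j = k then int p else 0))"
  proof (rule col_cong_single[OF D(3), of _ _ _ "int (b k) - int i"])
    fix j assume j: "j < m"
    show "int (mix t k (b k) i b (p - b k) j) = exp_mutate (B t) k (\<lambda>i. int (b i)) j
        + (if j = k then int p else 0) + (int (b k) - int i) * B t' $$ (j, k)"
      using pos_minus_neg_col[of "B t" k j] edge_col(1)[OF e j] i B_diag[OF D(1,3)] le_Suc_ex[OF i(1)]
      by (auto simp: mix_def exp_mutate_def algebra_simps of_nat_diff)
  qed
  moreover have c': "col_cong m n (B t') (exp_mutate (B t) k (\<lambda>i. int (b i))) (exp_mutate (B t) k g)"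
    using col_cong_mutate[OF D(3) B_diag[OF D(1,3)] n_le_m c] D(5) by simp
  ultimately show ?thesis by (intro col_cong_trans[OF _ col_cong_add_same[OF c']])
qed

lemma mix_cong_low:
  assumes e: "tree_edge n k t t'" and c: "col_cong m n (B t) (\<lambda>i. int (b i)) g" and i: "i \<le> p" "p \<le> b k"
  shows "col_cong m n (B t) (\<lambda>j. int (mix t k p i b (b k - p) j))
     (\<lambda>j. g j + (if j = k then - int p else int p * int (pos_col (B t) k j)))"
proof -
  note D = edgeD[OF e]
  have "col_cong m n (B t) (\<lambda>j. int (mix t k p i b (b k - p) j))
     (\<lambda>j. int (b j) + (if j = k then - int p else int p * int (pos_col (B t) k j)))"
  proof (rule col_cong_single[OF D(3), of _ _ _ "int i - int p"])
    fix j assume j: "j < m"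
    show "int (mix t k p i b (b k - p) j) = int (b j) + (if j = k then - int p else int p * int (pos_col (B t) k j))
        + (int i - int p) * B t $$ (j, k)"
      using pos_minus_neg_col[of "B t" k j] i B_diag[OF D(1,3)] le_Suc_ex[OF i(1)]
      by (auto simp: mix_def algebra_simps of_nat_diff)
  qed
  then show ?thesis by (rule col_cong_trans[OF _ col_cong_add_same[OF c]])
qed

text \<open>\<open>cmon t a * u * x t' k ^ a k\<close> is a sum of products of \<open>u\<close> with monomials, so the support of each such
  product lies in the support of the sum.  The summand used is the one with the power \<open>X t k ^ a k\<close>.\<close>

lemma mixed_of_laurent:
  assumes e: "tree_edge n k t t'" and u: "u \<in> Sm" and d: "laurent_data t u a g"
  shows "\<exists>a' g'. mixed_data t t' k u a' g'"
proof -
  note D = edgeD[OF e]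
  let ?p = "a k"
  let ?a = "mix t k ?p ?p a 0"
  \<comment> \<open>Passing from \<open>a\<close> to \<open>?a\<close> multiplies by (X /
    x_k)^(a_k), and the congruence class is moved by the same exponents.\<close>
  let ?g = "\<lambda>j. g j + (if j = k then - int ?p else int ?p * int (pos_col (B t) k j))"
  have ex: "exp_mutate (B t) k ?g = (\<lambda>j. exp_mutate (B t) k g j + (if j = k then int ?p else 0))"
    by (auto simp: exp_mutate_def fun_eq_iff algebra_simps)
  have xp: "x t' k ^ ?p \<in> Pc" using var_power_Pc D by blast
  have "cmon t ?a = cmon t' ?a" using edge_cmon[OF e, of ?a] by (simp add: mix_def)
  have "cmon t a * u * x t' k ^ ?p = (cmon t a * x t' k ^ ?p) * u" by (simp add: mult_ac)
  also have "\<dots> = (\<Sum>i\<le>?p. of_nat (?p choose i) * (cmon t' (mix t k ?p i a 0) * u))"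
    using cmon_power_high[where b = a and p = "?p", OF e] by (simp add: sum_distrib_right mult.assoc)
  finally have "supp (cmon t a * u * x t' k ^ ?p) = (\<Union>i\<in>{..?p}. supp (of_nat (?p choose i) * (cmon t' (mix t k ?p i a 0) * u)))"
    using supp_sum[of "{..?p}" "\<lambda>i. of_nat (?p choose i) * (cmon t' (mix t k ?p i a 0) * u)"] Pc_of_nat_mult cmon_mult_Pc[OF D(2) u]
    by simp
  moreover have "supp (of_nat (?p choose ?p) * (cmon t' ?a * u)) = supp (cmon t ?a * u)"
    using \<open>cmon t ?a = cmon t' ?a\<close> by simp
  ultimately have "supp (cmon t ?a * u) \<subseteq> supp (cmon t a * u * x t' k ^ ?p)" by (metis (no_types, lifting) UN_upper atMost_iff order_refl)
  also have "\<dots> = (\<Union>w\<in>supp (cmon t a * u). supp (w * x t' k ^ ?p))"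
    by (rule supp_mult[OF cmon_mult_Pc[OF D(1) u] xp])
  finally have sub: "supp (cmon t ?a * u) \<subseteq> (\<Union>w\<in>supp (cmon t a * u). supp (w * x t' k ^ ?p))" .
  have "mixed_data t t' k u ?a ?g" unfolding mixed_data_def
  proof (intro conjI ballI)
    fix z assume "z \<in> supp (cmon t ?a * u)"
    then obtain w where w: "w \<in> supp (cmon t a * u)" "z \<in> supp (w * x t' k ^ ?p)" using sub by blast
    then obtain b where b: "w = cmon t b" "col_cong m n (B t) (\<lambda>i. int (b i)) g" using d unfolding laurent_data_def by blast
    show "(\<exists>b. z = cmon t b \<and> col_cong m n (B t) (\<lambda>i. int (b i)) ?g) \<or>
        (\<exists>b. z = cmon t' b \<and> col_cong m n (B t') (\<lambda>i. int (b i)) (exp_mutate (B t) k ?g))"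
    \<comment> \<open>If x_k' has at least the exponent of x_k, all x_k are exchanged and the result
      is a monomial at \<open>t'\<close>; otherwise x_k' disappears and it remains one at
      \<open>t\<close>. This dichotomy is the source of the two alternatives in
      \<open>mixed_data\<close>.\<close>
    proof (cases "b k \<le> ?p")
      case True
      from w(2) obtain i where i: "i \<le> b k" "z = cmon t' (mix t k (b k) i b (?p - b k))"
        unfolding b(1) supp_cmon_power_high[where b = b and p = ?p, OF e True] by auto
      then show ?thesis unfolding ex using mix_cong_high[where b = b and p = ?p, OF e b(2) i(1) True] by metis
    next
      case False
      then have bp: "?p \<le> b k" by simp
      from w(2) obtain i where i: "i \<le> ?p" "z = cmon t (mix t k ?p i b (b k - ?p))"
        unfolding b(1) supp_cmon_power_low[where b = b and p = ?p, OF e bp] by auto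
      then show ?thesis using mix_cong_low[where b = b and p = ?p, OF e b(2) i(1) bp] by metis
    qed
  qed (simp add: mix_def)
  then show ?thesis by blast
qed

text \<open>Unspecified on classes that are not monomials at \<open>t\<close>; it serves to bound
  the exponents of x_k over a finite support.\<close>

definition kexp :: "nat list \<Rightarrow> nat \<Rightarrow> 'f \<Rightarrow> nat" where
  "kexp t k w = (SOME b. w = cmon t b) k"

lemma kexp_cmon: "t \<in> \<T> \<Longrightarrow> k < m \<Longrightarrow> kexp t k (cmon t b) = b k"
  unfolding kexp_def using someI[of "\<lambda>b'. cmon t b = cmon t b'" b] cmon_inj by metis

text \<open>With \<open>p\<close> above every exponent of x_k, multiplying by x_k'^p exchanges all
  x_k, so monomials at \<open>t\<close> turn into sums of monomials at \<open>t'\<close>, while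
  those already at \<open>t'\<close> stay monomials there.\<close>

lemma laurent_of_mixed:
  assumes e: "tree_edge n k t t'" and u: "u \<in> Sm" and d: "mixed_data t t' k u a g"
    and p: "\<And>w. w \<in> supp (cmon t a * u) \<Longrightarrow> kexp t k w \<le> p"
  shows "laurent_data t' u (\<lambda>j. a j + (if j = k then p else 0))
    (\<lambda>j. exp_mutate (B t) k g j + (if j = k then int p else 0))"
  unfolding laurent_data_def
proof
  note D = edgeD[OF e]
  have xp: "x t' k ^ p \<in> Pc" using var_power_Pc D by blast
  have "cmon t' a = cmon t a" using d edge_cmon[OF e] unfolding mixed_data_def by blast
  then have "cmon t' (\<lambda>j. a j + (if j = k then p else 0)) * u = cmon t a * u * x t' k ^ p"
    by (simp add: cmon_add cmon_single[OF D(4)] mult_ac)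
  then have s: "supp (cmon t' (\<lambda>j. a j + (if j = k then p else 0)) * u) = (\<Union>w\<in>supp (cmon t a * u). supp (w * x t' k ^ p))"
    by (simp only: supp_mult[OF cmon_mult_Pc[OF D(1) u] xp])
  fix z assume "z \<in> supp (cmon t' (\<lambda>j. a j + (if j = k then p else 0)) * u)"
  then obtain w where w: "w \<in> supp (cmon t a * u)" "z \<in> supp (w * x t' k ^ p)" using s by blast
  from d w(1) consider b where "w = cmon t b" "col_cong m n (B t) (\<lambda>i. int (b i)) g"
    | b where "w = cmon t' b" "col_cong m n (B t') (\<lambda>i. int (b i)) (exp_mutate (B t) k g)"
    unfolding mixed_data_def by blast
  then show "\<exists>b. z = cmon t' b \<and> col_cong m n (B t') (\<lambda>i. int (b i)) (\<lambda>j. exp_mutate (B t) k g j + (if j = k then int p else 0))"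
  proof cases
    case 1
    have bp: "b k \<le> p" using p[OF w(1)] 1(1) kexp_cmon[OF D(1,4)] by simp
    from w(2) obtain i where i: "i \<le> b k" "z = cmon t' (mix t k (b k) i b (p - b k))"
      unfolding 1(1) supp_cmon_power_high[where b = b and p = p, OF e bp] by auto
    then show ?thesis using mix_cong_high[where b = b and p = p, OF e 1(2) i(1) bp] by metis
  next
    case 2
    have "w * x t' k ^ p = cmon t' (\<lambda>j. b j + (if j = k then p else 0))"
      using 2 by (simp add: cmon_add cmon_single[OF D(4)])
    then have "z = cmon t' (\<lambda>j. b j + (if j = k then p else 0))" using w(2) supp_simple[OF cmon_Sm[OF D(2)]] by simp
    moreover have "col_cong m n (B t') (\<lambda>j. int (b j + (if j = k then p else 0)))
       (\<lambda>j. exp_mutate (B t) k g j + (if j = k then int p else 0))"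
      using col_cong_add[OF 2(2) col_cong_refl[of m "\<lambda>j. int (if j = k then p else 0)" "\<lambda>j. if j = k then int p else 0"]]
      by simp
    ultimately show ?thesis by blast
  qed
qed

lemma ex_kexp_bound:
  assumes "t \<in> \<T>" "u \<in> Sm"
  obtains p0 where "\<And>w s. w \<in> supp (cmon t a * u) \<Longrightarrow> kexp t1 k w \<le> p0 \<and> kexp t2 k w \<le> p0"
proof -
  let ?S = "supp (cmon t a * u)"
  let ?p = "\<Sum>w\<in>?S. kexp t1 k w + kexp t2 k w"
  have fin: "finite ?S" using supp_finite[OF cmon_mult_Pc] assms by blast
  have "kexp t1 k w \<le> ?p \<and> kexp t2 k w \<le> ?p" if "w \<in> ?S" for w
    using member_le_sum[OF that, of "\<lambda>w. kexp t1 k w + kexp t2 k w"] fin by fastforce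
  then show ?thesis using that by blast
qed

lemma laurent_edge:
  assumes e: "tree_edge n k t t'" and u: "u \<in> Sm" and d: "\<exists>a g. laurent_data t u a g"
  shows "\<exists>a g. laurent_data t' u a g"
proof -
  obtain a g where q: "mixed_data t t' k u a g" using mixed_of_laurent e u d by blast
  obtain p0 where "\<And>w. w \<in> supp (cmon t a * u) \<Longrightarrow> kexp t k w \<le> p0"
    using ex_kexp_bound[OF edgeD(1)[OF e] u] by metis
  then show ?thesis using laurent_of_mixed[OF e u q] by blast
qed

lemma laurent_data_self:
  assumes "s \<in> \<T>"
  shows "laurent_data s (cmon s e) (\<lambda>_. 0) (\<lambda>i. int (e i))"
  unfolding laurent_data_def using supp_simple[OF cmon_Sm[OF assms]] col_cong_refl by auto

lemma ex_laurent_data: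
  assumes s: "s \<in> \<T>" and t: "t \<in> \<T>"
  shows "\<exists>a g. laurent_data t (cmon s e) a g"
  using tree_propagate[of n "\<lambda>t. \<exists>a g. laurent_data t (cmon s e) a g", OF _ s _ t]
    laurent_edge[OF _ cmon_Sm[OF s]] laurent_data_self[OF s] by blast

end

context Lambda_cluster
begin

section \<open>Leading monomials\<close>

lemma hd_cmon_supp:
  assumes "t \<in> \<T>" "u \<in> Sm"
  shows "hd (cmon t a) u \<in> supp (cmon t a * u)"
  by (rule hd_supp) (use assms cmon_Sm cmon_mult_Sm in auto)

lemma LL_hd_cmon:
  assumes "t \<in> \<T>" "u \<in> Sm" "l \<in> Sm" "l * l \<in> Sm" "l * cmon t a \<in> Sm"
  shows "LL l (hd (cmon t a) u) = LL l (cmon t a) + LL l u"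
  by (rule LL_hd_right) (use assms cmon_Sm cmon_mult_Sm in auto)

lemma LL_var_hd_cmon:
  assumes "t \<in> \<T>" "u \<in> Sm" "i < m"
  shows "LL (x t i) (hd (cmon t a) u) = LL (x t i) (cmon t a) + LL (x t i) u"
  by (rule LL_hd_cmon) (use assms var_Sm var_sq_Sm var_cmon_Sm in auto)

text \<open>The future constant term of the F-polynomial.\<close>

definition lead_coef :: "nat list \<Rightarrow> 'f \<Rightarrow> (nat \<Rightarrow> nat) \<Rightarrow> nat" where
  "lead_coef t u a = coef (cmon t a * u) (hd (cmon t a) u)"

lemma laurent_hd:
  assumes "t \<in> \<T>" "u \<in> Sm" "laurent_data t u a g"
  obtains b where "hd (cmon t a) u = cmon t b" "col_cong m n (B t) (\<lambda>i. int (b i)) g"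
  using assms hd_cmon_supp unfolding laurent_data_def by blast

text \<open>The values of \<Lambda>(x_i, _) at mutable i determine a monomial inside its congruence
  class, so a factor attaining the values that (a4) gives for the head is the head. This is the way
  to identify a head without looking into the category.\<close>

lemma laurent_hd_eqI:
  assumes t: "t \<in> \<T>" and u: "u \<in> Sm" and d: "laurent_data t u a g" and z: "z \<in> supp (cmon t a * u)"
    and eq: "\<And>i. i < n \<Longrightarrow> LL (x t i) z = LL (x t i) (cmon t a) + LL (x t i) u"
  shows "hd (cmon t a) u = z"
proof -
  obtain b where b: "hd (cmon t a) u = cmon t b" "col_cong m n (B t) (\<lambda>i. int (b i)) g" using laurent_hd t u d by blast
  obtain b' where b': "z = cmon t b'" "col_cong m n (B t) (\<lambda>i. int (b' i)) g" using z d unfolding laurent_data_def by blast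
  have "cmon t b = cmon t b'"
  proof (rule cmon_eq_of_LL[OF t])
    show "col_cong m n (B t) (\<lambda>j. int (b j)) (\<lambda>j. int (b' j))"
      by (rule col_cong_trans[OF b(2) col_cong_sym[OF b'(2)]])
    show "LL (x t i) (cmon t b) = LL (x t i) (cmon t b')" if "i < n" for i
      using LL_var_hd_cmon[OF t u, of i a] eq[OF that] that n_le_m b b' by simp
  qed
  then show ?thesis using b b' by simp
qed

lemma supp_cmon_shift:
  assumes t: "t \<in> \<T>" and u: "u \<in> Sm" and w: "\<And>w. w \<in> supp (cmon t a * u) \<Longrightarrow> \<exists>b. w = cmon t b"
  shows "supp (cmon t (\<lambda>i. a i + c i) * u) = (\<lambda>w. w * cmon t c) ` supp (cmon t a * u)"
    and "coef (cmon t (\<lambda>i. a i + c i) * u) (z * cmon t c) = coef (cmon t a * u) z"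
proof -
  have s: "w * cmon t c \<in> Sm" if "w \<in> supp (cmon t a * u)" for w
    using w[OF that] cmon_mult_Sm[OF t] by auto
  have eq: "cmon t (\<lambda>i. a i + c i) * u = cmon t a * u * cmon t c" by (simp add: cmon_add mult_ac)
  have P: "cmon t a * u \<in> Pc" "cmon t c \<in> Pc" using cmon_mult_Pc[OF t u] cmon_Pc[OF t] by auto
  show "supp (cmon t (\<lambda>i. a i + c i) * u) = (\<lambda>w. w * cmon t c) ` supp (cmon t a * u)"
    unfolding eq supp_mult[OF P] using supp_simple[OF s] by auto
  have "coef (cmon t a * u * cmon t c) (z * cmon t c)
      = (\<Sum>w\<in>supp (cmon t a * u). coef (cmon t a * u) w * (if w = z then 1 else 0))"
    unfolding coef_mult[OF P] using cmon_nonzero[OF t] by (intro sum.cong refl) (simp add: coef_Sm[OF s])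
  also have "\<dots> = coef (cmon t a * u) z"
    using supp_finite[OF P(1)] by (simp add: if_distrib cong: if_cong) (auto simp: supp_def)
  finally show "coef (cmon t (\<lambda>i. a i + c i) * u) (z * cmon t c) = coef (cmon t a * u) z" unfolding eq .
qed

text \<open>A further monomial factor merely translates the monomials of the expansion. The use is
  \<open>lead_coef_unique\<close>, where two admissible vectors \<open>a\<close> and
  \<open>a'\<close> are compared through their sum.\<close>

lemma laurent_shift:
  assumes t: "t \<in> \<T>" and u: "u \<in> Sm" and d: "laurent_data t u a g"
  shows "laurent_data t u (\<lambda>i. a i + c i) (\<lambda>i. g i + int (c i))"
    and "lead_coef t u (\<lambda>i. a i + c i) = lead_coef t u a"
proof -
  have w: "\<exists>b. w = cmon t b" if "w \<in> supp (cmon t a * u)" for w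
    using that d unfolding laurent_data_def by blast
  have sh: "supp (cmon t (\<lambda>i. a i + c i) * u) = (\<lambda>w. w * cmon t c) ` supp (cmon t a * u)"
    by (rule supp_cmon_shift(1)[OF t u w])
  show d': "laurent_data t u (\<lambda>i. a i + c i) (\<lambda>i. g i + int (c i))"
    unfolding laurent_data_def
  proof
    fix z assume "z \<in> supp (cmon t (\<lambda>i. a i + c i) * u)"
    then obtain w where z: "z = w * cmon t c" "w \<in> supp (cmon t a * u)"
      unfolding sh by blast
    then obtain b where b: "w = cmon t b" "col_cong m n (B t) (\<lambda>i. int (b i)) g" using d unfolding laurent_data_def by blast
    have "z = cmon t (\<lambda>i. b i + c i)" using z b by (simp add: cmon_add)
    moreover have "col_cong m n (B t) (\<lambda>i. int (b i + c i)) (\<lambda>i. g i + int (c i))"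
      using col_cong_add_same[OF b(2), of "\<lambda>i. int (c i)"] by simp
    ultimately show "\<exists>b. z = cmon t b \<and> col_cong m n (B t) (\<lambda>i. int (b i)) (\<lambda>i. g i + int (c i))" by blast
  qed
  have "hd (cmon t (\<lambda>i. a i + c i)) u = hd (cmon t a) u * cmon t c"
  proof (rule laurent_hd_eqI[OF t u d'])
    show "hd (cmon t a) u * cmon t c \<in> supp (cmon t (\<lambda>i. a i + c i) * u)"
      using sh hd_cmon_supp[OF t u] by blast
    fix i assume i: "i < n"
    obtain b where b: "hd (cmon t a) u = cmon t b" using laurent_hd[OF t u d] .
    have im: "i < m" using i n_le_m by simp
    show "LL (x t i) (hd (cmon t a) u * cmon t c) = LL (x t i) (cmon t (\<lambda>i. a i + c i)) + LL (x t i) u"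
      using LL_mult[OF cmon_Sm[OF t] cmon_Sm[OF t] var_Sm[OF t im] cmon_mult_Sm[OF t]]
        LL_var_hd_cmon[OF t u im, of a] b by (simp add: cmon_add)
  qed
  then show "lead_coef t u (\<lambda>i. a i + c i) = lead_coef t u a"
    unfolding lead_coef_def using supp_cmon_shift(2)[OF t u w] by simp
qed

lemma lead_coef_unique:
  assumes t: "t \<in> \<T>" and u: "u \<in> Sm" and d: "laurent_data t u a g" "laurent_data t u a' g'"
  shows "lead_coef t u a = lead_coef t u a'"
proof -
  have "(\<lambda>i. a i + a' i) = (\<lambda>i. a' i + a i)" by (simp add: add.commute)
  then show ?thesis using laurent_shift(2)[OF t u d(1), of a'] laurent_shift(2)[OF t u d(2), of a] by simp
qed

text \<open>The order of the factors decides: \<Lambda>(x_k', _) is larger on X than on Y by s_k. By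
  (a5) it is at most \<Lambda>(x_k', x_k) on X, and by (a4) it equals this on the head, so Y cannot
  be the head.\<close>

lemma exchange_LL:
  assumes e: "tree_edge n k t t'"
  shows "hd (x t' k) (x t k) = X t k"
    and "LL (x t' k) (X t k) = LL (x t' k) (x t k)"
    and "LL (X t k) (x t k) = LL (x t' k) (x t k)"
    and "LL (x t' k) (X t k) - LL (x t' k) (Y t k) = sk k"
proof -
  note D = edgeD(1-4)[OF e]
  have xs: "x t k \<in> Sm" "x t' k \<in> Sm" "x t k * x t k \<in> Sm" "x t' k * x t' k \<in> Sm"
    using var_Sm var_sq_Sm D by auto
  \<comment> \<open>Column k changes sign across the edge, and so does \<Lambda> when its arguments
    are exchanged; the sum is thus a diagonal entry of the compatibility equation at
    \<open>t'\<close>.\<close>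
  have "(\<Sum>j<m. B t $$ (j, k) * LL (x t' k) (x t j)) = (\<Sum>j<m. B t' $$ (j, k) * LL (x t' j) (x t' k))"
  proof (rule sum.cong)
    fix j assume "j \<in> {..<m}"
    then have j: "j < m" by simp
    show "B t $$ (j, k) * LL (x t' k) (x t j) = B t' $$ (j, k) * LL (x t' j) (x t' k)"
    proof (cases "j = k")
      case True
      then show ?thesis using B_diag D by simp
    next
      case False
      then show ?thesis using edgeD(7)[OF e j False] edge_col(1)[OF e j] LL_skew[OF D(2,4) j] by simp
    qed
  qed simp
  also have "\<dots> = sk k" using compat_sk[OF D(2)] D unfolding compat_def by simp
  finally show dif: "LL (x t' k) (X t k) - LL (x t' k) (Y t k) = sk k" using LL_X_minus_Y(2)[OF D(1) xs(2)] by simp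
  have h: "hd (x t' k) (x t k) \<in> {X t k, Y t k}" using hd_supp[of "x t' k" "x t k"] xs supp_exchange[OF e] by blast
  have hr: "LL (x t' k) (hd (x t' k) (x t k)) = LL (x t' k) (x t k)"
    using LL_hd_right[OF xs(2,1,2,4,4) disjI2[OF xs(3)]] LL_self[OF D(2,4)] by simp
  have "LL (x t' k) (X t k) \<le> LL (x t' k) (x t k)"
    using LL_le[OF xs(2,1,2), of "X t k"] supp_exchange[OF e] LL_self[OF D(2,4)] by simp
  then show hX: "hd (x t' k) (x t k) = X t k" using h hr dif sk_pos[OF D(3)] by auto
  show "LL (x t' k) (X t k) = LL (x t' k) (x t k)" using hr hX by simp
  show "LL (X t k) (x t k) = LL (x t' k) (x t k)"
    using LL_hd_left[OF xs(2,1,1,3,3) disjI2[OF xs(3)]] LL_self[OF D(1,4)] hX by simp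
qed

lemma LL_var_exchange:
  assumes e: "tree_edge n k t t'" and i: "i < m" "i \<noteq> k"
  shows "LL (x t i) (X t k) = LL (x t i) (x t k) + LL (x t i) (x t' k)"
    and "LL (X t k) (x t i) = LL (x t k) (x t i) + LL (x t' k) (x t i)"
  using edge_LL[OF e compat_sk[OF edgeD(1)[OF e]] i] by auto

lemma LL_mixed_hd:
  assumes e: "tree_edge n k t t'" and u: "u \<in> Sm" and a: "a k = 0"
  shows "i < m \<Longrightarrow> LL (x t i) (hd (cmon t a) u) = LL (x t i) (cmon t a) + LL (x t i) u"
    and "LL (x t' k) (hd (cmon t a) u) = LL (x t' k) (cmon t a) + LL (x t' k) u"
proof -
  note D = edgeD(1-4)[OF e]
  show "i < m \<Longrightarrow> LL (x t i) (hd (cmon t a) u) = LL (x t i) (cmon t a) + LL (x t i) u"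
    by (rule LL_var_hd_cmon[OF D(1) u])
  have "cmon t' a = cmon t a" using edge_cmon[where a = a, OF e] a by blast
  then show "LL (x t' k) (hd (cmon t a) u) = LL (x t' k) (cmon t a) + LL (x t' k) u"
    using LL_var_hd_cmon[OF D(2) u D(4), of a] by simp
qed

section \<open>The multiplicity of the head on both sides of an edge\<close>

text \<open>Multiplication by x_k^p carries monomials at \<open>t\<close> injectively to monomials
  at \<open>t\<close>. A monomial at \<open>t'\<close> containing x_k' loses powers of x_k in the
  exchange, so it cannot produce the exponent of x_k that the new head has.\<close>

lemma lead_coef_near:
  assumes e: "tree_edge n k t t'" and u: "u \<in> Sm" and d: "mixed_data t t' k u a g"
    and hd: "hd (cmon t a) u = cmon t b0"
    and p: "\<And>w s. w \<in> supp (cmon t a * u) \<Longrightarrow> kexp t' k w \<le> p"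
    and L: "laurent_data t u (\<lambda>j. a j + (if j = k then p else 0)) g'"
  shows "lead_coef t u (\<lambda>j. a j + (if j = k then p else 0)) = coef (cmon t a * u) (cmon t b0)"
proof -
  note D = edgeD(1-4)[OF e]
  note e' = tree_edge_sym[OF e]
  let ?a = "\<lambda>j. a j + (if j = k then p else 0)"
  let ?z = "cmon t b0 * x t k ^ p"
  have xp: "x t k ^ p \<in> Pc" "x t k ^ p = cmon t (\<lambda>j. if j = k then p else 0)"
    using var_power_Pc D cmon_single[OF D(4)] by auto
  have eq: "cmon t ?a * u = cmon t a * u * x t k ^ p" by (simp add: cmon_add xp(2) mult_ac)
  have P: "cmon t a * u \<in> Pc" by (rule cmon_mult_Pc[OF D(1) u])
  have z: "?z = cmon t (\<lambda>j. b0 j + (if j = k then p else 0))" by (simp add: cmon_add xp(2))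
  have zS: "?z \<in> Sm" unfolding z by (rule cmon_Sm[OF D(1)])
  have b0: "cmon t b0 \<in> supp (cmon t a * u)" using hd_cmon_supp[OF D(1) u, of a] hd by simp
  have "hd (cmon t ?a) u = ?z"
  proof (rule laurent_hd_eqI[OF D(1) u L])
    show "?z \<in> supp (cmon t ?a * u)" unfolding eq supp_mult[OF P xp(1)] using b0 supp_simple[OF zS] by blast
    fix i assume "i < n"
    then have i: "i < m" using n_le_m by simp
    show "LL (x t i) ?z = LL (x t i) (cmon t ?a) + LL (x t i) u"
      using LL_var_hd_cmon[OF D(1) u i, of a] LL_mult[OF cmon_Sm[OF D(1)] cmon_Sm[OF D(1)] var_Sm[OF D(1) i] cmon_mult_Sm[OF D(1)]]
      unfolding hd by (simp add: cmon_add xp(2))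
  qed
  then have "lead_coef t u ?a = (\<Sum>w\<in>supp (cmon t a * u). coef (cmon t a * u) w * coef (w * x t k ^ p) ?z)"
    unfolding lead_coef_def by (simp only: eq coef_mult[OF P xp(1)])
  also have "\<dots> = (\<Sum>w\<in>supp (cmon t a * u). coef (cmon t a * u) w * (if w = cmon t b0 then 1 else 0))"
  proof (intro sum.cong refl, rule arg_cong2[of _ _ _ _ "(*)", OF refl])
    fix w assume w: "w \<in> supp (cmon t a * u)"
    have simple: "coef (w * x t k ^ p) ?z = (if w = cmon t b0 then 1 else 0)" if "w = cmon t b" for b
    proof -
      have "w * x t k ^ p \<in> Sm" unfolding that xp(2) by (rule cmon_mult_Sm[OF D(1)])
      then show ?thesis using var_nonzero[OF D(1,4)] by (auto simp: coef_Sm)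
    qed
    from d w consider b where "w = cmon t b" | b where "w = cmon t' b" unfolding mixed_data_def by blast
    then show "coef (w * x t k ^ p) ?z = (if w = cmon t b0 then 1 else 0)"
    proof cases
      case 1
      then show ?thesis by (rule simple)
    next
      case 2
      show ?thesis
      proof (cases "b k = 0")
        case True
        then have "w = cmon t b" using 2 edge_cmon[where a = b, OF e] by simp
        then show ?thesis by (rule simple)
      next
        case False
        have bp: "b k \<le> p" using p[OF w] 2 kexp_cmon[OF D(2,4)] by simp
        \<comment> \<open>A priori \<open>w\<close> could be a monomial of both clusters, so its
          difference from the head needs the same comparison of exponents of x_k.\<close>
        have ne: "w \<noteq> cmon t b0"
        proof
          assume "w = cmon t b0"
          then have eqz: "cmon t' b * x t k ^ p = ?z" using 2 by metis
          have "?z \<in> supp (cmon t' b * x t k ^ p)" unfolding eqz supp_simple[OF zS] by blast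
          then obtain i where i: "?z = cmon t (mix t' k (b k) i b (p - b k))"
            unfolding supp_cmon_power_high[where b = b and p = p, OF e' bp] by auto
          have "b0 k + p = p - b k" using cmon_inj[OF D(1) i[unfolded z] D(4)] by (simp add: mix_def)
          then show False using False bp by simp
        qed
        have "?z \<notin> supp (cmon t' b * x t k ^ p)"
        proof
          assume "?z \<in> supp (cmon t' b * x t k ^ p)"
          then obtain i where i: "?z = cmon t (mix t' k (b k) i b (p - b k))"
            unfolding supp_cmon_power_high[where b = b and p = p, OF e' bp] by auto
          have "b0 k + p = p - b k" using cmon_inj[OF D(1) i[unfolded z] D(4)] by (simp add: mix_def)
          then show False using False bp by simp
        qed
        then show ?thesis using ne 2 unfolding supp_def by simp
      qed
    qed
  qed
  also have "\<dots> = coef (cmon t a * u) (cmon t b0)"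
    using supp_finite[OF P] b0 by (simp add: if_distrib cong: if_cong)
  finally show ?thesis .
qed

text \<open>At the other end the head becomes \<open>?z\<close>, the summand of its binomial
  expansion that takes X each time. The multiplicity is kept because this summand has coefficient 1
  and no other composition factor of \<open>cmon t a * u\<close> yields it; for factors at
  \<open>t\<close> the latter rests on the maximality of \<Lambda>(x_k', _) at the head.\<close>

lemma lead_coef_far:
  assumes e: "tree_edge n k t t'" and u: "u \<in> Sm" and d: "mixed_data t t' k u a g"
    and hd: "hd (cmon t a) u = cmon t b0"
    and p: "\<And>w s. w \<in> supp (cmon t a * u) \<Longrightarrow> kexp t k w \<le> p"
    and L: "laurent_data t' u (\<lambda>j. a j + (if j = k then p else 0)) g'"
  shows "lead_coef t' u (\<lambda>j. a j + (if j = k then p else 0)) = coef (cmon t a * u) (cmon t b0)"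
proof -
  note D = edgeD(1-4)[OF e]
  let ?a = "\<lambda>j. a j + (if j = k then p else 0)"
  have a: "a k = 0" using d unfolding mixed_data_def by blast
  have ca: "cmon t' a = cmon t a" using edge_cmon[where a = a, OF e] a by blast
  let ?z = "cmon t' (mix t k (b0 k) (b0 k) b0 (p - b0 k))"
  have zS: "?z \<in> Sm" by (rule cmon_Sm[OF D(2)])
  have xp: "x t' k ^ p \<in> Pc" "x t' k ^ p = cmon t' (\<lambda>j. if j = k then p else 0)"
    using var_power_Pc D cmon_single[OF D(4)] by auto
  have eq: "cmon t' ?a * u = cmon t a * u * x t' k ^ p" by (simp add: cmon_add xp(2) ca mult_ac)
  have P: "cmon t a * u \<in> Pc" by (rule cmon_mult_Pc[OF D(1) u])
  have b0: "cmon t b0 \<in> supp (cmon t a * u)" using hd_cmon_supp[OF D(1) u, of a] hd by simp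
  have b0p: "b0 k \<le> p" using p[OF b0] kexp_cmon[OF D(1,4)] by simp
  have sz: "?z \<in> supp (cmon t b0 * x t' k ^ p)"
    unfolding supp_cmon_power_high[where b = b0 and p = p, OF e b0p] by auto
  have zval: "LL l ?z = LL l (cmon t b0) + int p * LL l (x t' k)"
    if l: "l \<in> Sm" and lX: "int (b0 k) * LL l (X t k) = int (b0 k) * (LL l (x t k) + LL l (x t' k))" for l
  proof -
    let ?c = "b0(k := 0)"
    have z1: "?z = cmon t (\<lambda>j. ?c j + b0 k * pos_col (B t) k j) * x t' k ^ (p - b0 k)"
      unfolding cmon_mix(2)[OF e] cmon_add cmon_scale X_def by (simp add: fun_upd_def)
    let ?q = "cmon t (\<lambda>j. ?c j + b0 k * pos_col (B t) k j)"
    have "?q = cmon t' (\<lambda>j. ?c j + b0 k * pos_col (B t) k j)"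
      using edge_cmon[where a = "\<lambda>j. ?c j + b0 k * pos_col (B t) k j", OF e] col_self[OF D(1,3)] by simp
    then have qm: "?q * x t' k ^ (p - b0 k) \<in> Sm" using cmon_single[OF D(4), of t' "p - b0 k"] cmon_mult_Sm[OF D(2)] by metis
    have pw: "LL l (x t' k ^ c) = int c * LL l (x t' k)" "x t' k ^ c \<in> Sm" for c
      unfolding cmon_single[OF D(4), symmetric] using LL_cmon(1)[OF D(2) l, of "\<lambda>j. if j = k then c else 0"] D(4) cmon_Sm[OF D(2)]
      by (simp_all add: if_distrib[of int] if_distrib[of "\<lambda>a. a * _"] cong: if_cong)
    have "LL l ?z = LL l ?q + int (p - b0 k) * LL l (x t' k)"
      using LL_mult[OF cmon_Sm[OF D(1)] pw(2) l qm] pw(1) z1 by simp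
    also have "LL l ?q = (\<Sum>j<m. int (?c j) * LL l (x t j)) + int (b0 k) * LL l (X t k)"
      unfolding X_def LL_cmon(1)[OF D(1) l] sum_distrib_left sum.distrib[symmetric] by (intro sum.cong) (auto simp: algebra_simps)
    also have "(\<Sum>j<m. int (?c j) * LL l (x t j)) = LL l (cmon t b0) - int (b0 k) * LL l (x t k)"
    proof -
      have "LL l (cmon t b0) = (\<Sum>j<m. int (?c j) * LL l (x t j) + (if j = k then int (b0 k) * LL l (x t k) else 0))"
        unfolding LL_cmon(1)[OF D(1) l] by (intro sum.cong) auto
      then show ?thesis using D(4) by (simp add: sum.distrib)
    qed
    finally show ?thesis using lX b0p by (simp add: algebra_simps of_nat_diff)
  qed
  have "hd (cmon t' ?a) u = ?z"
  proof (rule laurent_hd_eqI[OF D(2) u L])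
    show "?z \<in> supp (cmon t' ?a * u)" unfolding eq supp_mult[OF P xp(1)] using b0 sz by blast
    fix i assume "i < n"
    then have i: "i < m" using n_le_m by simp
    have l: "x t' i \<in> Sm" using var_Sm[OF D(2) i] .
    have "LL (x t' i) ?z = LL (x t' i) (cmon t b0) + int p * LL (x t' i) (x t' k)"
    proof (rule zval[OF l])
      show "int (b0 k) * LL (x t' i) (X t k) = int (b0 k) * (LL (x t' i) (x t k) + LL (x t' i) (x t' k))"
      proof (cases "i = k")
        case True
        then show ?thesis using exchange_LL(2)[OF e] LL_self[OF D(2,4)] by simp
      next
        case False
        then show ?thesis using LL_var_exchange(1)[OF e i] edgeD(7)[OF e i] by simp
      qed
    qed
    moreover have "LL (x t' i) (cmon t b0) = LL (x t' i) (cmon t a) + LL (x t' i) u"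
      using LL_mixed_hd[where a = a, OF e u a] hd edgeD(7)[OF e i] i by (cases "i = k") auto
    moreover have "LL (x t' i) (cmon t' ?a) = LL (x t' i) (cmon t a) + int p * LL (x t' i) (x t' k)"
      unfolding ca[symmetric] LL_cmon(1)[OF D(2) l]
      using D(4) by (simp add: distrib_right sum.distrib if_distrib[of int] if_distrib[of "\<lambda>a. a * _"] cong: if_cong)
    ultimately show "LL (x t' i) ?z = LL (x t' i) (cmon t' ?a) + LL (x t' i) u" by simp
  qed
  then have "lead_coef t' u ?a = (\<Sum>w\<in>supp (cmon t a * u). coef (cmon t a * u) w * coef (w * x t' k ^ p) ?z)"
    unfolding lead_coef_def by (simp only: eq coef_mult[OF P xp(1)])
  also have "\<dots> = (\<Sum>w\<in>supp (cmon t a * u). coef (cmon t a * u) w * (if w = cmon t b0 then 1 else 0))"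
  proof (intro sum.cong refl, rule arg_cong2[of _ _ _ _ "(*)", OF refl])
    \<comment> \<open>Compatibility rules out a zero column, so the other binomial summands of the
      head differ from \<open>?z\<close>.\<close>
    have nz: "\<not> (\<forall>j<m. B t $$ (j, k) = 0)"
    proof
      assume "\<forall>j<m. B t $$ (j, k) = 0"
      then have "(\<Sum>j<m. B t $$ (j, k) * LL (x t j) (x t k)) = 0" by simp
      then show False using compat_sk[OF D(1)] D sk_pos[OF D(3)] unfolding compat_def by simp
    qed
    fix w assume w: "w \<in> supp (cmon t a * u)"
    have one: "coef (cmon t b0 * x t' k ^ p) ?z = 1"
    proof -
      have "coef (cmon t b0 * x t' k ^ p) ?z
          = (\<Sum>i\<le>b0 k. (b0 k choose i) * coef (cmon t' (mix t k (b0 k) i b0 (p - b0 k))) ?z)"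
        unfolding cmon_power_high[where b = b0 and p = p, OF e b0p]
        by (subst coef_sum) (auto simp: coef_of_nat_mult Pc_of_nat_mult cmon_Pc[OF D(2)])
      also have "\<dots> = (\<Sum>i\<le>b0 k. if i = b0 k then 1 else 0)"
      proof (rule sum.cong[OF refl])
        fix i assume i: "i \<in> {..b0 k}"
        have "cmon t' (mix t k (b0 k) i b0 (p - b0 k)) \<noteq> ?z" if "i \<noteq> b0 k"
        proof
          assume eq: "cmon t' (mix t k (b0 k) i b0 (p - b0 k)) = ?z"
          have "B t $$ (j, k) = 0" if j: "j < m" for j
          proof (cases "j = k")
            case False
            from cmon_inj[OF D(2) eq j] have "i * pos_col (B t) k j + (b0 k - i) * neg_col (B t) k j = b0 k * pos_col (B t) k j"
              using False by (simp add: mix_def)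
            moreover obtain c where c: "b0 k = i + c" using i le_Suc_ex by auto
            ultimately have "c * neg_col (B t) k j = c * pos_col (B t) k j" by (simp add: algebra_simps)
            moreover have "c \<noteq> 0" using \<open>i \<noteq> b0 k\<close> c by simp
            ultimately show ?thesis using pos_minus_neg_col[of "B t" k j] by simp
          qed (use B_diag D in simp)
          then show False using nz by blast
        qed
        then show "(b0 k choose i) * coef (cmon t' (mix t k (b0 k) i b0 (p - b0 k))) ?z = (if i = b0 k then 1 else 0)"
          using coef_Sm[OF cmon_Sm[OF D(2)], of "mix t k (b0 k) i b0 (p - b0 k)" ?z] by auto
      qed
      finally show ?thesis by simp
    qed
    have neq: "w = cmon t b0" if zw: "?z \<in> supp (w * x t' k ^ p)"
    proof -
      from d w consider b where "w = cmon t b" | b where "w = cmon t' b" unfolding mixed_data_def by blast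
      then show ?thesis
      proof cases
        case 1
        have bp: "b k \<le> p" using p[OF w] 1 kexp_cmon[OF D(1,4)] by simp
        obtain i where i: "i \<le> b k" "cmon t' (mix t k (b k) i b (p - b k)) = ?z"
          using zw unfolding 1 supp_cmon_power_high[where b = b and p = p, OF e bp] by auto
        have bk: "b k = b0 k" using cmon_inj[OF D(2) i(2) D(4)] bp b0p unfolding mix_def by simp
        obtain c where c: "b k = i + c" using i le_Suc_ex by auto
        have bj: "int (b j) = int (b0 j) + int c * B t $$ (j, k)" if j: "j < m" for j
        proof (cases "j = k")
          case True
          then show ?thesis using bk B_diag D by simp
        next
          case False
          have "b j + i * pos_col (B t) k j + c * neg_col (B t) k j = b0 j + (i + c) * pos_col (B t) k j"
            using cmon_inj[OF D(2) i(2) j] False c bk by (simp add: mix_def)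
          then have "b j + c * neg_col (B t) k j = b0 j + c * pos_col (B t) k j" by (simp add: algebra_simps)
          then have "int (b j) + int c * int (neg_col (B t) k j) = int (b0 j) + int c * int (pos_col (B t) k j)"
            by (metis of_nat_add of_nat_mult)
          then show ?thesis unfolding pos_minus_neg_col[symmetric] by (simp add: algebra_simps)
        qed
        have l: "x t' k \<in> Sm" "x t' k * x t' k \<in> Sm" using var_Sm var_sq_Sm D by auto
        have "LL (x t' k) w \<le> LL (x t' k) (cmon t a) + LL (x t' k) u"
          using LL_le[OF cmon_Sm[OF D(1)] u l(1) w] by simp
        then have "LL (x t' k) (cmon t b) \<le> LL (x t' k) (cmon t b0)"
          using LL_mixed_hd(2)[where a = a, OF e u a] hd 1 by simp
        moreover have "LL (x t' k) (cmon t b) = LL (x t' k) (cmon t b0) + int c * (\<Sum>j<m. B t $$ (j, k) * LL (x t' k) (x t j))"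
          unfolding LL_cmon(1)[OF D(1) l(1)] sum_distrib_left sum.distrib[symmetric]
          by (intro sum.cong refl) (simp add: bj algebra_simps)
        \<comment> \<open>A factor differing from the head by c times column k has \<Lambda>(x_k',
          _) larger by c s_k, so c = 0 by maximality.\<close>
        ultimately have "int c * sk k \<le> 0"
          using LL_X_minus_Y(2)[OF D(1) l(1), of k] exchange_LL(4)[OF e] by simp
        then have "c = 0" using sk_pos[OF D(3)] by (simp add: mult_le_0_iff)
        then show ?thesis using 1 bj by (auto intro: cmon_cong)
      next
        case 2
        have "w * x t' k ^ p = cmon t' (\<lambda>j. b j + (if j = k then p else 0))" using 2 by (simp add: cmon_add xp(2))
        then have eq2: "cmon t' (\<lambda>j. b j + (if j = k then p else 0)) = ?z" using zw supp_simple[OF cmon_Sm[OF D(2)]] by auto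
        \<comment> \<open>The exponents of x_k' on both sides; since p bounds b0_k, the equality
          leaves no x_k' in \<open>w\<close> and no x_k in the head.\<close>
        have "b k + p = p - b0 k" using cmon_inj[OF D(2) eq2 D(4)] by (simp add: mix_def)
        then have 0: "b k = 0" "b0 k = 0" using b0p by auto
        have "b j = b0 j" if "j < m" for j
          using cmon_inj[OF D(2) eq2 that] 0 by (cases "j = k") (auto simp: mix_def)
        then have "cmon t' b = cmon t' b0" by (rule cmon_cong)
        then show ?thesis using 2 edge_cmon[where a = b0, OF e 0(2)] by simp
      qed
    qed
    show "coef (w * x t' k ^ p) ?z = (if w = cmon t b0 then 1 else 0)"
    proof (cases "w = cmon t b0")
      case True
      then show ?thesis using one by metis
    next
      case False
      then have "?z \<notin> supp (w * x t' k ^ p)" using neq by blast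
      then show ?thesis using False unfolding supp_def by simp
    qed
  qed
  also have "\<dots> = coef (cmon t a * u) (cmon t b0)"
    using supp_finite[OF P] b0 by (simp add: if_distrib cong: if_cong)
  finally show ?thesis .
qed

end

lemma poly_mapping_of_exponents:
  fixes n :: nat
  obtains v where "Poly_Mapping.keys v \<subseteq> {..<n}" "\<And>k. k < n \<Longrightarrow> Poly_Mapping.lookup v k = (f k :: nat)"
proof -
  have "finite {k. (if k < n then f k else 0) \<noteq> 0}" by (rule finite_subset[of _ "{..<n}"]) auto
  then have l: "Poly_Mapping.lookup (Abs_poly_mapping (\<lambda>k. if k < n then f k else 0)) = (\<lambda>k. if k < n then f k else 0)"
    by (simp add: Abs_poly_mapping_inverse)
  show ?thesis
    by (rule that[of "Abs_poly_mapping (\<lambda>k. if k < n then f k else 0)"])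
      (auto simp: in_keys_iff l split: if_splits)
qed

context Lambda_cluster
begin

text \<open>The head of the mixed product is a monomial at one of the two ends. Both
  \<open>lead_coef_near\<close> and \<open>lead_coef_far\<close> take it at \<open>t\<close>; the
  other case is the same edge read backwards.\<close>

lemma lead_coef_edge:
  assumes e: "tree_edge n k t t'" and u: "u \<in> Sm" and d: "laurent_data t u a g" and d': "laurent_data t' u a' g'"
  shows "lead_coef t u a = lead_coef t' u a'"
proof -
  have aux: "lead_coef t u a = lead_coef t' u a'"
    if e: "tree_edge n k t t'" and d: "laurent_data t u a g" and d': "laurent_data t' u a' g'"
      and q: "mixed_data t t' k u a2 g2" and hd: "hd (cmon t a2) u = cmon t b0"
    for t t' a g a' g' a2 g2 b0
  proof -
    note D = edgeD(1-4)[OF e]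
    obtain p where p: "\<And>w s. w \<in> supp (cmon t a2 * u) \<Longrightarrow> kexp t k w \<le> p \<and> kexp t' k w \<le> p"
      using ex_kexp_bound[OF D(1) u] by metis
    let ?a = "\<lambda>j. a2 j + (if j = k then p else 0)"
    have ca: "cmon t' a2 = cmon t a2" using edge_cmon[where a = a2, OF e] q unfolding mixed_data_def by simp
    obtain h where h: "laurent_data t u ?a h"
      using laurent_of_mixed[OF tree_edge_sym[OF e] u mixed_data_sym[OF e q], of p] p unfolding ca by blast
    obtain h' where h': "laurent_data t' u ?a h'" using laurent_of_mixed[OF e u q, of p] p by blast
    have "lead_coef t u a = lead_coef t u ?a" by (rule lead_coef_unique[OF D(1) u d h])
    also have "\<dots> = coef (cmon t a2 * u) (cmon t b0)" using lead_coef_near[OF e u q hd _ h] p by blast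
    also have "\<dots> = lead_coef t' u ?a" using lead_coef_far[OF e u q hd _ h'] p by simp
    also have "\<dots> = lead_coef t' u a'" by (rule lead_coef_unique[OF D(2) u h' d'])
    finally show ?thesis .
  qed
  note D = edgeD(1-4)[OF e]
  obtain a2 g2 where q: "mixed_data t t' k u a2 g2" using mixed_of_laurent[OF e u d] by blast
  have "hd (cmon t a2) u \<in> supp (cmon t a2 * u)" by (rule hd_cmon_supp[OF D(1) u])
  then consider b where "hd (cmon t a2) u = cmon t b" | b where "hd (cmon t a2) u = cmon t' b"
    using q unfolding mixed_data_def by blast
  then show ?thesis
  proof cases
    case 1
    then show ?thesis by (rule aux[OF e d d' q])
  next
    case 2
    have ca: "cmon t' a2 = cmon t a2" using edge_cmon[where a = a2, OF e] q unfolding mixed_data_def by simp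
    have "lead_coef t' u a' = lead_coef t u a"
      by (rule aux[OF tree_edge_sym[OF e] d' d mixed_data_sym[OF e q]]) (simp add: ca 2)
    then show ?thesis ..
  qed
qed

lemma lead_coef_cluster_monomial:
  assumes s: "s \<in> \<T>" and t: "t \<in> \<T>" and d: "laurent_data t (cmon s e) a g"
  shows "lead_coef t (cmon s e) a = 1"
proof -
  let ?u = "cmon s e"
  have u: "?u \<in> Sm" by (rule cmon_Sm[OF s])
  let ?P = "\<lambda>t. \<exists>a g. laurent_data t ?u a g \<and> lead_coef t ?u a = 1"
  have "hd 1 ?u = ?u" using hd_cmon_supp[OF s u, of "\<lambda>_. 0"] supp_simple[OF u] by simp
  then have "lead_coef s ?u (\<lambda>_. 0) = 1" using coef_Sm[OF u] unfolding lead_coef_def by simp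
  then have Ps: "?P s" using laurent_data_self[OF s] by blast
  have "?P t'" if e: "tree_edge n k t t'" and P: "?P t" for k t t'
  proof -
    obtain a g where a: "laurent_data t ?u a g" "lead_coef t ?u a = 1" using P by blast
    obtain a' g' where a': "laurent_data t' ?u a' g'" using laurent_edge[OF e u] a(1) by blast
    then show ?thesis using lead_coef_edge[OF e u a(1) a'] a(2) by auto
  qed
  then have "?P t" by (rule tree_propagate[where P = ?P, OF _ s Ps t])
  then show ?thesis using lead_coef_unique[OF t u d] by auto
qed

lemma pointed_expansion:
  assumes s: "s \<in> \<T>" and t: "t \<in> \<T>" and u: "u = cmon s e"
  obtains a b0 where
    "\<forall>w \<in> supp (cmon t a * u). \<exists>b v. w = cmon t b \<and> (\<forall>i<m. int (b i) = int (b0 i) + col_comb n (B t) (\<lambda>k. int (v k)) i)"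
    "coef (cmon t a * u) (cmon t b0) = 1"
    "\<forall>i<m. LL (x t i) u = (\<Sum>j<m. LL (x t i) (x t j) * (int (b0 j) - int (a j)))"
proof -
  have uS: "u \<in> Sm" unfolding u by (rule cmon_Sm[OF s])
  obtain a g where d: "laurent_data t u a g" using ex_laurent_data[OF s t] u by blast
  obtain b0 where b0: "hd (cmon t a) u = cmon t b0" "col_cong m n (B t) (\<lambda>i. int (b0 i)) g"
    using laurent_hd[OF t uS d] .
  have LLb0: "LL (x t i) (cmon t b0) = LL (x t i) (cmon t a) + LL (x t i) u" if "i < m" for i
    using LL_var_hd_cmon[OF t uS that, of a] b0 by simp
  show ?thesis
  proof (rule that, intro ballI)
    show "coef (cmon t a * u) (cmon t b0) = 1"
      using lead_coef_cluster_monomial[OF s t] d u b0 unfolding lead_coef_def by metis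
    show "\<forall>i<m. LL (x t i) u = (\<Sum>j<m. LL (x t i) (x t j) * (int (b0 j) - int (a j)))"
      using LLb0 LL_cmon(1)[OF t var_Sm[OF t]] by (simp add: sum_subtractf algebra_simps)
    fix w assume w: "w \<in> supp (cmon t a * u)"
    then obtain b where b: "w = cmon t b" "col_cong m n (B t) (\<lambda>i. int (b i)) g" using d unfolding laurent_data_def by blast
    obtain v where v: "\<And>i. i < m \<Longrightarrow> int (b i) = int (b0 i) + col_comb n (B t) v i"
      using col_cong_trans[OF b(2) col_cong_sym[OF b0(2)]] unfolding col_cong_def by blast
    have "v i \<ge> 0" if i: "i < n" for i
    proof -
      have im: "i < m" using i n_le_m by simp
      have "LL (x t i) w \<le> LL (x t i) (cmon t b0)"
        using LL_le[OF cmon_Sm[OF t] uS var_Sm[OF t im] w] LLb0[OF im] by simp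
      then have "sk i * v i \<ge> 0" using LL_col_cong[OF t im v] b(1) i by simp
      then show ?thesis using sk_pos[OF i] by (simp add: zero_le_mult_iff)
    qed
    then have "col_comb n (B t) v i = col_comb n (B t) (\<lambda>k. int (nat (v k))) i" for i
      unfolding col_comb_def by (intro sum.cong) auto
    then have "\<forall>i<m. int (b i) = int (b0 i) + col_comb n (B t) (\<lambda>k. int (nat (v k))) i" using v by simp
    then show "\<exists>b v. w = cmon t b \<and> (\<forall>i<m. int (b i) = int (b0 i) + col_comb n (B t) (\<lambda>k. int (v k)) i)"
      using b(1) by (intro exI[of _ b] exI[of _ "\<lambda>k. nat (v k)"]) simp
  qed
qed

section \<open>The tropical exchange relation\<close>

text \<open>Both X and Y are composition factors of the product of x_k' and x_k, so (a5) gives one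
  inequality. For the other, \<Lambda>(x_k, _) + \<Lambda>(x_k', _) agrees with \<Lambda>(X, _) on
  monomials at \<open>t\<close>, hence on \<open>u\<close> when the head is such a monomial; a head
  at \<open>t'\<close> gives Y by symmetry.\<close>

lemma LL_exchange_max:
  assumes e: "tree_edge n k t t'" and s: "s \<in> \<T>" and u: "u = cmon s f"
  shows "LL (x t k) u + LL (x t' k) u = max (LL (X t k) u) (LL (Y t k) u)"
proof -
  have uS: "u \<in> Sm" unfolding u by (rule cmon_Sm[OF s])
  have aux: "LL (x t k) u + LL (x t' k) u = LL (X t k) u"
    if e: "tree_edge n k t t'" and a: "a k = 0" and hd: "hd (cmon t a) u = cmon t b0" for t t' a b0
  proof -
    note D = edgeD(1-4)[OF e]
    have xs: "x t k \<in> Sm" "x t' k \<in> Sm" using var_Sm D by auto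
    have l1: "LL (x t i) u = LL (x t i) (cmon t b0) - LL (x t i) (cmon t a)" if "i < m" for i
      using LL_mixed_hd(1)[where a = a, OF e uS a that] hd by simp
    have l2: "LL (x t' k) u = LL (x t' k) (cmon t b0) - LL (x t' k) (cmon t a)"
      using LL_mixed_hd(2)[where a = a, OF e uS a] hd by simp
    have "LL (X t k) u = (\<Sum>j<m. int (pos_col (B t) k j) * (LL (x t j) (cmon t b0) - LL (x t j) (cmon t a)))"
      unfolding X_def LL_cmon(2)[OF D(1) uS] using l1 by (intro sum.cong) auto
    also have "\<dots> = LL (X t k) (cmon t b0) - LL (X t k) (cmon t a)"
      unfolding X_def LL_cmon(2)[OF D(1) cmon_Sm[OF D(1)]] by (simp add: right_diff_distrib sum_subtractf)
    finally have l3: "LL (X t k) u = LL (X t k) (cmon t b0) - LL (X t k) (cmon t a)" .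
    have ex: "LL (x t k) (x t j) + LL (x t' k) (x t j) = LL (X t k) (x t j)" if "j < m" for j
      using LL_var_exchange(2)[OF e that] exchange_LL(3)[OF e] LL_self[OF D(1,4)] by (cases "j = k") auto
    have "LL (x t k) (cmon t b) + LL (x t' k) (cmon t b) = LL (X t k) (cmon t b)" for b
      unfolding LL_cmon(1)[OF D(1) xs(1)] LL_cmon(1)[OF D(1) xs(2)] LL_cmon(1)[OF D(1) X_Sm[OF D(1)]] sum.distrib[symmetric]
      by (intro sum.cong refl) (simp add: ex[symmetric] algebra_simps)
    from this[of b0] this[of a] show ?thesis using l1[OF D(4)] l2 l3 by linarith
  qed
  note D = edgeD(1-4)[OF e]
  have le: "LL z u \<le> LL (x t k) u + LL (x t' k) u" if "z \<in> {X t k, Y t k}" for z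
    using LL_le[OF var_Sm[OF D(2,4)] var_Sm[OF D(1,4)] uS] supp_exchange[OF e] that by fastforce
  have "\<exists>a g. laurent_data t u a g" using ex_laurent_data[OF s D(1)] u by blast
  then obtain a g where q: "mixed_data t t' k u a g" using mixed_of_laurent[OF e uS] by blast
  have a: "a k = 0" using q unfolding mixed_data_def by blast
  have ca: "cmon t' a = cmon t a" using edge_cmon[where a = a, OF e] a by blast
  have "hd (cmon t a) u \<in> supp (cmon t a * u)" by (rule hd_cmon_supp[OF D(1) uS])
  then consider b where "hd (cmon t a) u = cmon t b" | b where "hd (cmon t a) u = cmon t' b"
    using q unfolding mixed_data_def by blast
  then have "LL (x t k) u + LL (x t' k) u \<in> {LL (X t k) u, LL (Y t k) u}"
  proof cases
    case 1
    then show ?thesis using aux[where a = a, OF e a] by auto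
  next
    case 2
    then have "LL (x t' k) u + LL (x t k) u = LL (X t' k) u"
      using aux[where a = a, OF tree_edge_sym[OF e] a] ca by simp
    then show ?thesis using edge_XY(1)[OF e] by (simp add: add.commute)
  qed
  then show ?thesis using le by fastforce
qed

section \<open>The pair of g-vector and F-polynomial\<close>

definition imon :: "nat list \<Rightarrow> (nat \<Rightarrow> int) \<Rightarrow> 'f" where
  "imon t e = (\<Prod>j<m. x t j powi e j)"

lemma imon_add: "t \<in> \<T> \<Longrightarrow> imon t (\<lambda>i. e i + e' i) = imon t e * imon t e'"
  unfolding imon_def by (subst prod.distrib[symmetric], intro prod.cong refl) (simp add: power_int_add var_nonzero)

lemma imon_nonneg: "(\<And>i. i < m \<Longrightarrow> e i \<ge> 0) \<Longrightarrow> imon t e = cmon t (\<lambda>i. nat (e i))"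
  unfolding imon_def cmon_def by (intro prod.cong refl) (simp add: power_int_def)

lemma imon_of_nat: "imon t (\<lambda>i. int (a i)) = cmon t a"
  by (simp add: imon_nonneg)

text \<open>The exponent vector, in the cluster at \<open>t\<close>, of the monomial with exponents
  \<open>v\<close> in the \<open>yhat\<close>.\<close>

definition vcol :: "nat list \<Rightarrow> (nat \<Rightarrow>\<^sub>0 nat) \<Rightarrow> nat \<Rightarrow> int" where
  "vcol t v = col_comb n (B t) (\<lambda>k. int (Poly_Mapping.lookup v k))"

lemma prod_yhat:
  assumes t: "t \<in> \<T>" and v: "Poly_Mapping.keys v \<subseteq> {..<n}"
  shows "(\<Prod>k \<in> Poly_Mapping.keys v. yhat m x B t k ^ Poly_Mapping.lookup v k) = imon t (vcol t v)"
proof -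
  have "(\<Prod>k \<in> Poly_Mapping.keys v. yhat m x B t k ^ Poly_Mapping.lookup v k)
      = (\<Prod>k<n. yhat m x B t k ^ Poly_Mapping.lookup v k)"
    by (rule prod.mono_neutral_left) (use v in \<open>auto simp: in_keys_iff\<close>)
  also have "\<dots> = (\<Prod>k<n. \<Prod>j<m. x t j powi (B t $$ (j, k) * int (Poly_Mapping.lookup v k)))"
    unfolding yhat_def prod_power_distrib by (intro prod.cong refl) (simp add: power_int_mult)
  also have "\<dots> = (\<Prod>j<m. \<Prod>k<n. x t j powi (B t $$ (j, k) * int (Poly_Mapping.lookup v k)))"
    by (rule prod.swap)
  also have "\<dots> = imon t (vcol t v)"
    unfolding imon_def vcol_def col_comb_def
  proof (intro prod.cong refl)
    fix j assume "j \<in> {..<m}"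
    then have "x t j \<noteq> 0" using var_nonzero[OF t] by simp
    then show "(\<Prod>k<n. x t j powi (B t $$ (j, k) * int (Poly_Mapping.lookup v k)))
        = x t j powi (\<Sum>k<n. B t $$ (j, k) * int (Poly_Mapping.lookup v k))"
      by (induction n) (auto simp: power_int_add)
  qed
  finally show ?thesis .
qed

lemma poly_eval_yhat:
  assumes t: "t \<in> \<T>" and F: "poly_in_vars n F"
  shows "poly_eval of_nat (yhat m x B t) F
    = (\<Sum>v \<in> Poly_Mapping.keys F. of_nat (Poly_Mapping.lookup F v) * imon t (vcol t v))"
  unfolding poly_eval_def
  by (intro sum.cong refl arg_cong2[of _ _ _ _ "(*)"] prod_yhat[OF t]) (use F in \<open>auto simp: poly_in_vars_def\<close>)

lemma vcol_inj:
  assumes t: "t \<in> \<T>" and k: "Poly_Mapping.keys v \<subseteq> {..<n}" "Poly_Mapping.keys w \<subseteq> {..<n}"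
    and eq: "\<And>i. i < m \<Longrightarrow> vcol t v i = vcol t w i"
  shows "v = w"
proof (rule poly_mapping_eqI)
  fix k0
  show "Poly_Mapping.lookup v k0 = Poly_Mapping.lookup w k0"
  proof (cases "k0 < n")
    case True
    then show ?thesis using col_comb_inj[OF t eq[unfolded vcol_def]] by auto
  next
    case False
    then have "k0 \<notin> Poly_Mapping.keys v" "k0 \<notin> Poly_Mapping.keys w" using k by auto
    then show ?thesis by (simp add: in_keys_iff)
  qed
qed

lemma ex_gF_expression:
  assumes s: "s \<in> \<T>" and t: "t \<in> \<T>" and u: "u = cmon s e"
  shows "\<exists>g F. gF_expression m n x B t u g F \<and> (\<forall>i<m. LL (x t i) u = (\<Sum>j<m. LL (x t i) (x t j) * g $ j))"
proof -
  have uS: "u \<in> Sm" unfolding u by (rule cmon_Sm[OF s])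
  obtain a b0 where *: "\<forall>w \<in> supp (cmon t a * u). \<exists>b v. w = cmon t b \<and> (\<forall>i<m. int (b i) = int (b0 i) + col_comb n (B t) (\<lambda>k. int (v k)) i)"
    and one: "coef (cmon t a * u) (cmon t b0) = 1"
    and LLu: "\<forall>i<m. LL (x t i) u = (\<Sum>j<m. LL (x t i) (x t j) * (int (b0 j) - int (a j)))"
    by (rule pointed_expansion[OF s t u]) blast
  let ?p = "cmon t a * u"
  have P: "?p \<in> Pc" by (rule cmon_mult_Pc[OF t uS])
  define good where "good v \<longleftrightarrow> Poly_Mapping.keys v \<subseteq> {..<n} \<and> (\<forall>i<m. 0 \<le> int (b0 i) + vcol t v i)" for v
  define E where "E v = cmon t (\<lambda>i. nat (int (b0 i) + vcol t v i))" for v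
  define V where "V = {v. good v \<and> E v \<in> supp ?p}"
  have inj: "inj_on E V"
  proof (rule inj_onI)
    fix v w assume vw: "v \<in> V" "w \<in> V" "E v = E w"
    have "vcol t v i = vcol t w i" if "i < m" for i
    proof -
      have "0 \<le> int (b0 i) + vcol t v i" "0 \<le> int (b0 i) + vcol t w i"
        using vw(1,2) that unfolding V_def good_def by auto
      then show ?thesis using cmon_inj[OF t vw(3)[unfolded E_def] that] by linarith
    qed
    then show "v = w" using vcol_inj[OF t] vw unfolding V_def good_def by blast
  qed
  have im: "E ` V = supp ?p"
  proof
    show "supp ?p \<subseteq> E ` V"
    proof
      fix w assume w: "w \<in> supp ?p"
      then obtain b v where b: "w = cmon t b" "\<And>i. i < m \<Longrightarrow> int (b i) = int (b0 i) + col_comb n (B t) (\<lambda>k. int (v k)) i"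
        using * by blast
      obtain v' where v': "Poly_Mapping.keys v' \<subseteq> {..<n}" "\<And>k. k < n \<Longrightarrow> Poly_Mapping.lookup v' k = v k"
        using poly_mapping_of_exponents by blast
      have "vcol t v' = col_comb n (B t) (\<lambda>k. int (v k))"
        unfolding vcol_def col_comb_def using v'(2) by (intro ext sum.cong) auto
      then have bi: "int (b i) = int (b0 i) + vcol t v' i" if "i < m" for i using b(2)[OF that] by simp
      then have "E v' = w" unfolding E_def b(1) by (intro cmon_cong) (metis nat_int)
      moreover have "good v'" unfolding good_def using v'(1) bi by (metis of_nat_0_le_iff)
      ultimately show "w \<in> E ` V" unfolding V_def using w by blast
    qed
  qed (auto simp: V_def)
  have "finite V" using inj im supp_finite[OF P] finite_imageD by metis
  define cf where "cf v = (if good v then coef ?p (E v) else 0)" for v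
  have V: "{v. cf v \<noteq> 0} = V" unfolding cf_def V_def supp_def by auto
  define F where "F = Abs_poly_mapping cf"
  have lF: "Poly_Mapping.lookup F = cf" unfolding F_def
    by (rule Abs_poly_mapping_inverse) (use \<open>finite V\<close> V in simp)
  have kF: "Poly_Mapping.keys F = V" unfolding V[symmetric] by (auto simp: in_keys_iff lF)
  have Fv: "poly_in_vars n F" unfolding poly_in_vars_def kF by (auto simp: V_def good_def)
  have v0: "vcol t 0 i = 0" for i unfolding vcol_def col_comb_def by simp
  have F0: "Poly_Mapping.lookup F 0 = 1" unfolding lF cf_def good_def E_def using one by (simp add: v0)
  \<comment> \<open>The head has exponents \<open>b0\<close>, and the factor \<open>cmon t a\<close>
    has to be divided out again.\<close>
  let ?g = "vec m (\<lambda>i. int (b0 i) - int (a i))"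
  have "?p = (\<Sum>w\<in>E ` V. of_nat (coef ?p w) * w)" unfolding im by (rule expand[OF P])
  also have "\<dots> = (\<Sum>v\<in>V. of_nat (cf v) * E v)"
    unfolding sum.reindex[OF inj] by (intro sum.cong refl) (simp add: cf_def V_def)
  also have "\<dots> = (\<Sum>v\<in>V. of_nat (cf v) * (cmon t b0 * imon t (vcol t v)))"
  proof (intro sum.cong refl)
    fix v assume "v \<in> V"
    then have "E v = imon t (\<lambda>i. int (b0 i) + vcol t v i)" unfolding E_def V_def good_def by (subst imon_nonneg) auto
    then show "of_nat (cf v) * E v = of_nat (cf v) * (cmon t b0 * imon t (vcol t v))"
      by (simp add: imon_add[OF t] imon_of_nat)
  qed
  also have "\<dots> = cmon t b0 * poly_eval of_nat (yhat m x B t) F"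
    unfolding poly_eval_yhat[OF t Fv] kF lF sum_distrib_left by (simp add: mult.left_commute)
  finally have p: "?p = cmon t b0 * poly_eval of_nat (yhat m x B t) F" .
  have "cmon t b0 = cmon t a * (\<Prod>j<m. x t j powi (?g $ j))"
  proof -
    have "cmon t b0 = imon t (\<lambda>i. int (a i) + (int (b0 i) - int (a i)))" by (simp add: imon_of_nat)
    also have "\<dots> = cmon t a * imon t (\<lambda>i. int (b0 i) - int (a i))" by (simp only: imon_add[OF t] imon_of_nat)
    finally show ?thesis unfolding imon_def by simp
  qed
  then have "u = (\<Prod>j<m. x t j powi (?g $ j)) * poly_eval of_nat (yhat m x B t) F"
    using p cmon_nonzero[OF t, of a] by (simp add: mult.assoc)
  then have "gF_expression m n x B t u ?g F" unfolding gF_expression_def using Fv F0 by simp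
  moreover have "\<forall>i<m. LL (x t i) u = (\<Sum>j<m. LL (x t i) (x t j) * ?g $ j)" using LLu by simp
  ultimately show ?thesis by blast
qed

text \<open>Multiplying by x^d clears the denominators, and the expression for \<open>u\<close>
  becomes an expansion in the basis of simple classes, whose coefficients can be compared.\<close>

lemma gF_expression_coef:
  fixes g :: "int vec"
  assumes t: "t \<in> \<T>" and gF: "gF_expression m n x B t u g F"
    and d: "\<And>v i. v \<in> Poly_Mapping.keys F \<Longrightarrow> i < m \<Longrightarrow> 0 \<le> int (d i) + g $ i + vcol t v i"
  shows "coef (cmon t d * u) (cmon t b)
    = (\<Sum>v \<in> Poly_Mapping.keys F. if \<forall>i<m. int (b i) = int (d i) + g $ i + vcol t v i then Poly_Mapping.lookup F v else 0)"
proof -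
  have Fv: "poly_in_vars n F" using gF unfolding gF_expression_def by blast
  let ?E = "\<lambda>v. cmon t (\<lambda>i. nat (int (d i) + g $ i + vcol t v i))"
  have "cmon t d * u = (\<Sum>v \<in> Poly_Mapping.keys F. of_nat (Poly_Mapping.lookup F v) * (cmon t d * imon t (\<lambda>i. g $ i) * imon t (vcol t v)))"
    using gF unfolding gF_expression_def poly_eval_yhat[OF t Fv] imon_def[symmetric]
    by (simp add: sum_distrib_left mult.left_commute mult.assoc imon_def)
  also have "\<dots> = (\<Sum>v \<in> Poly_Mapping.keys F. of_nat (Poly_Mapping.lookup F v) * ?E v)"
  proof (intro sum.cong refl)
    fix v assume v: "v \<in> Poly_Mapping.keys F"
    have "?E v = imon t (\<lambda>i. int (d i) + g $ i + vcol t v i)" by (subst imon_nonneg) (use d[OF v] in auto)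
    then show "of_nat (Poly_Mapping.lookup F v) * (cmon t d * imon t (\<lambda>i. g $ i) * imon t (vcol t v))
        = of_nat (Poly_Mapping.lookup F v) * ?E v"
      by (simp add: imon_add[OF t] imon_of_nat)
  qed
  finally have "coef (cmon t d * u) (cmon t b)
      = (\<Sum>v \<in> Poly_Mapping.keys F. Poly_Mapping.lookup F v * coef (?E v) (cmon t b))"
    by (simp add: coef_sum Pc_of_nat_mult cmon_Pc[OF t] coef_of_nat_mult)
  also have "\<dots> = (\<Sum>v \<in> Poly_Mapping.keys F. if \<forall>i<m. int (b i) = int (d i) + g $ i + vcol t v i then Poly_Mapping.lookup F v else 0)"
  proof (intro sum.cong refl)
    fix v assume v: "v \<in> Poly_Mapping.keys F"
    have "cmon t b = ?E v \<longleftrightarrow> (\<forall>i<m. int (b i) = int (d i) + g $ i + vcol t v i)"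
    proof
      assume eq: "cmon t b = ?E v"
      show "\<forall>i<m. int (b i) = int (d i) + g $ i + vcol t v i"
        using cmon_inj[OF t eq] d[OF v] by simp
    next
      assume "\<forall>i<m. int (b i) = int (d i) + g $ i + vcol t v i"
      then show "cmon t b = ?E v" by (intro cmon_cong) (metis nat_int)
    qed
    then show "Poly_Mapping.lookup F v * coef (?E v) (cmon t b)
        = (if \<forall>i<m. int (b i) = int (d i) + g $ i + vcol t v i then Poly_Mapping.lookup F v else 0)"
      by (auto simp: coef_Sm[OF cmon_Sm[OF t]])
  qed
  finally show ?thesis .
qed

text \<open>Every exponent vector of one expression occurs in the other. For the constant terms this
  gives g = g' + B v and g' = g + B w with nonnegative v and w. The columns of B are independent, so
  v + w = 0 and hence v = 0.\<close>

lemma gF_expression_unique: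
  fixes g g' :: "int vec"
  assumes t: "t \<in> \<T>" and 1: "gF_expression m n x B t u g F" and 2: "gF_expression m n x B t u g' F'"
  shows "g = g' \<and> F = F'"
proof -
  note K = 1[unfolded gF_expression_def] 2[unfolded gF_expression_def]
  \<comment> \<open>Large enough to clear the denominators of both expressions at once.\<close>
  define d where "d i = nat (\<Sum>v \<in> Poly_Mapping.keys F. \<bar>g $ i + vcol t v i\<bar>) + nat (\<Sum>v \<in> Poly_Mapping.keys F'. \<bar>g' $ i + vcol t v i\<bar>)" for i
  have bound: "\<bar>h v\<bar> \<le> (\<Sum>v \<in> A. \<bar>h v\<bar>)" if "finite A" "v \<in> A" for h :: "(nat \<Rightarrow>\<^sub>0 nat) \<Rightarrow> int" and v A
    using member_le_sum[OF that(2), of "\<lambda>v. \<bar>h v\<bar>"] that by simp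
  have di: "int (d i) = (\<Sum>v \<in> Poly_Mapping.keys F. \<bar>g $ i + vcol t v i\<bar>) + (\<Sum>v \<in> Poly_Mapping.keys F'. \<bar>g' $ i + vcol t v i\<bar>)"
    "0 \<le> (\<Sum>v \<in> Poly_Mapping.keys F. \<bar>g $ i + vcol t v i\<bar>)" "0 \<le> (\<Sum>v \<in> Poly_Mapping.keys F'. \<bar>g' $ i + vcol t v i\<bar>)" for i
    unfolding d_def by (simp_all add: sum_nonneg)
  have d1: "0 \<le> int (d i) + g $ i + vcol t v i" if "v \<in> Poly_Mapping.keys F" for v i
    using bound[OF finite_keys that, of "\<lambda>v. g $ i + vcol t v i"] di[of i] by linarith
  have d2: "0 \<le> int (d i) + g' $ i + vcol t v i" if "v \<in> Poly_Mapping.keys F'" for v i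
    using bound[OF finite_keys that, of "\<lambda>v. g' $ i + vcol t v i"] di[of i] by linarith
  have ex: "\<exists>v' \<in> Poly_Mapping.keys F2. (\<forall>i<m. g1 $ i + vcol t v i = g2 $ i + vcol t v' i) \<and>
      (g1 = g2 \<longrightarrow> Poly_Mapping.lookup F1 v = Poly_Mapping.lookup F2 v)"
    if gF1: "gF_expression m n x B t u g1 F1" and gF2: "gF_expression m n x B t u g2 F2"
      and b1: "\<And>v i. v \<in> Poly_Mapping.keys F1 \<Longrightarrow> 0 \<le> int (d i) + g1 $ i + vcol t v i"
      and b2: "\<And>v i. v \<in> Poly_Mapping.keys F2 \<Longrightarrow> 0 \<le> int (d i) + g2 $ i + vcol t v i"
      and v: "v \<in> Poly_Mapping.keys F1" for g1 g2 :: "int vec" and F1 F2 v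
  proof -
    define b where "b i = nat (int (d i) + g1 $ i + vcol t v i)" for i
    have bi: "int (b i) = int (d i) + g1 $ i + vcol t v i" for i unfolding b_def using b1[OF v] by simp
    have kv: "\<And>v. v \<in> Poly_Mapping.keys F1 \<Longrightarrow> Poly_Mapping.keys v \<subseteq> {..<n}" "\<And>v. v \<in> Poly_Mapping.keys F2 \<Longrightarrow> Poly_Mapping.keys v \<subseteq> {..<n}"
      using gF1 gF2 unfolding gF_expression_def poly_in_vars_def by auto
    have inj: "v' = v" if "v' \<in> Poly_Mapping.keys F1 \<union> Poly_Mapping.keys F2" "\<And>i. i < m \<Longrightarrow> vcol t v' i = vcol t v i" for v'
      using vcol_inj[OF t _ kv(1)[OF v] that(2)] kv that(1) by blast
    have e1: "coef (cmon t d * u) (cmon t b) = (\<Sum>v \<in> Poly_Mapping.keys F1.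
        if \<forall>i<m. int (b i) = int (d i) + g1 $ i + vcol t v i then Poly_Mapping.lookup F1 v else 0)"
      by (rule gF_expression_coef[OF t gF1 b1])
    have e2: "coef (cmon t d * u) (cmon t b) = (\<Sum>v \<in> Poly_Mapping.keys F2.
        if \<forall>i<m. int (b i) = int (d i) + g2 $ i + vcol t v i then Poly_Mapping.lookup F2 v else 0)"
      by (rule gF_expression_coef[OF t gF2 b2])
    have c1: "coef (cmon t d * u) (cmon t b) = Poly_Mapping.lookup F1 v"
    proof -
      have "coef (cmon t d * u) (cmon t b) = (\<Sum>v' \<in> Poly_Mapping.keys F1. if v' = v then Poly_Mapping.lookup F1 v' else 0)"
        unfolding e1 bi by (intro sum.cong refl if_cong) (use inj in auto)
      then show ?thesis using v by simp
    qed
    have c2: "coef (cmon t d * u) (cmon t b) = (\<Sum>v' \<in> Poly_Mapping.keys F2.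
        if \<forall>i<m. g1 $ i + vcol t v i = g2 $ i + vcol t v' i then Poly_Mapping.lookup F2 v' else 0)"
      unfolding e2 bi by (intro sum.cong refl if_cong) (auto simp: add.assoc)
    have "coef (cmon t d * u) (cmon t b) \<noteq> 0" using c1 v by (simp add: in_keys_iff)
    then obtain v' where v': "v' \<in> Poly_Mapping.keys F2" "\<forall>i<m. g1 $ i + vcol t v i = g2 $ i + vcol t v' i"
      unfolding c2 by (rule sum.not_neutral_contains_not_neutral) (metis (no_types, lifting))
    moreover have "Poly_Mapping.lookup F1 v = Poly_Mapping.lookup F2 v" if "g1 = g2"
    proof -
      have "v' = v" using inj[of v'] v' that by simp
      have "coef (cmon t d * u) (cmon t b) = (\<Sum>v' \<in> Poly_Mapping.keys F2. if v' = v then Poly_Mapping.lookup F2 v' else 0)"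
        unfolding c2 that by (intro sum.cong refl if_cong) (use inj in auto)
      then show ?thesis using c1 v' \<open>v' = v\<close> by simp
    qed
    ultimately show ?thesis by blast
  qed
  have 0: "0 \<in> Poly_Mapping.keys F" "0 \<in> Poly_Mapping.keys F'" using K by (auto simp: in_keys_iff)
  have v0: "vcol t 0 i = 0" for i unfolding vcol_def col_comb_def by simp
  obtain v where v: "v \<in> Poly_Mapping.keys F'" "\<And>i. i < m \<Longrightarrow> g $ i = g' $ i + vcol t v i"
    using ex[OF 1 2 d1 d2 0(1)] v0 by auto
  obtain w where w: "w \<in> Poly_Mapping.keys F" "\<And>i. i < m \<Longrightarrow> g' $ i = g $ i + vcol t w i"
    using ex[OF 2 1 d2 d1 0(2)] v0 by auto
  have kv: "Poly_Mapping.keys v \<subseteq> {..<n}" using v K unfolding poly_in_vars_def by blast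
  have "col_comb n (B t) (\<lambda>k. int (Poly_Mapping.lookup v k) + int (Poly_Mapping.lookup w k)) i = col_comb n (B t) (\<lambda>k. 0) i" if "i < m" for i
    using v(2)[OF that] w(2)[OF that] unfolding vcol_def by (simp add: col_comb_add) (simp add: col_comb_def)
  then have "Poly_Mapping.lookup v k = 0" if "k < n" for k
    using col_comb_inj[OF t, of "\<lambda>k. int (Poly_Mapping.lookup v k) + int (Poly_Mapping.lookup w k)" "\<lambda>k. 0" k] that by simp
  then have "vcol t v i = 0" for i unfolding vcol_def col_comb_def by simp
  then have g: "g = g'" using v(2) K by (intro eq_vecI) auto
  have "Poly_Mapping.lookup F v = Poly_Mapping.lookup F' v" for v
  proof (cases "v \<in> Poly_Mapping.keys F \<or> v \<in> Poly_Mapping.keys F'")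
    case True
    then show ?thesis using ex[OF 1 2 d1 d2] ex[OF 2 1 d2 d1] g by metis
  qed (auto simp: in_keys_iff)
  then show ?thesis using g poly_mapping_eqI by blast
qed

lemma LL_g_vector:
  assumes s: "s \<in> \<T>" and t: "t \<in> \<T>" and u: "u = cmon s e"
  shows "g_vector m n x B t u \<in> carrier_vec m"
    and "i < m \<Longrightarrow> LL (x t i) u = (\<Sum>j<m. LL (x t i) (x t j) * g_vector m n x B t u $ j)"
proof -
  obtain g :: "int vec" and F where gF: "gF_expression m n x B t u g F" "\<forall>i<m. LL (x t i) u = (\<Sum>j<m. LL (x t i) (x t j) * g $ j)"
    using ex_gF_expression[OF s t u] by blast
  have "(THE (g, F). gF_expression m n x B t u g F) = (g, F)"
  proof (rule the_equality)
    show "p = (g, F)" if "case p of (g, F) \<Rightarrow> gF_expression m n x B t u g F" for p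
      using gF_expression_unique[OF t _ gF(1), of "fst p" "snd p"] that by (cases p) simp
  qed (use gF(1) in simp)
  then have eq: "g_vector m n x B t u = g" unfolding g_vector_def by simp
  show "g_vector m n x B t u \<in> carrier_vec m"
    using gF(1) unfolding eq gF_expression_def by (rule conjunct1)
  show "LL (x t i) u = (\<Sum>j<m. LL (x t i) (x t j) * g_vector m n x B t u $ j)" if "i < m"
    using gF(2) that unfolding eq by blast
qed

end

section \<open>Tropical points\<close>

text \<open>Division in a field type is total with value 0 at 0, so the rule for quotients relies on
  no subtraction-free element being zero.\<close>

lemma max_plus_hom_facts:
  fixes z :: "nat \<Rightarrow> 'f::field_char_0"
  assumes b: "b \<in> max_plus_homs (subtraction_free m z)" and nz: "\<And>r. r \<in> subtraction_free m z \<Longrightarrow> r \<noteq> 0"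
  shows "b 1 = 0"
    and "\<lbrakk>p \<in> subtraction_free m z; q \<in> subtraction_free m z\<rbrakk> \<Longrightarrow> b (p / q) = b p - b q"
    and "p \<in> subtraction_free m z \<Longrightarrow> p ^ c \<in> subtraction_free m z \<and> b (p ^ c) = int c * b p"
    and "\<lbrakk>finite J; \<And>j. j \<in> J \<Longrightarrow> f j \<in> subtraction_free m z\<rbrakk> \<Longrightarrow>
      prod f J \<in> subtraction_free m z \<and> b (prod f J) = (\<Sum>j\<in>J. b (f j))"
proof -
  have mult: "b (p * q) = b p + b q" if "p \<in> subtraction_free m z" "q \<in> subtraction_free m z" for p q
    using b that unfolding max_plus_homs_def by blast
  show b1: "b 1 = 0" using mult[OF subtraction_free.one subtraction_free.one] by simp
  show "b (p / q) = b p - b q" if "p \<in> subtraction_free m z" "q \<in> subtraction_free m z"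
    using mult[OF subtraction_free.divide[OF that] that(2)] nz[OF that(2)] by simp
  show "p ^ c \<in> subtraction_free m z \<and> b (p ^ c) = int c * b p" if "p \<in> subtraction_free m z"
  proof (induction c)
    case (Suc c)
    then show ?case using mult[OF that, of "p ^ c"] subtraction_free.mult[OF that, of "p ^ c"] by (simp add: algebra_simps)
  qed (simp add: b1 subtraction_free.one)
  show "prod f J \<in> subtraction_free m z \<and> b (prod f J) = (\<Sum>j\<in>J. b (f j))"
    if "finite J" "\<And>j. j \<in> J \<Longrightarrow> f j \<in> subtraction_free m z"
    using that by (induction J rule: finite_induct) (simp_all add: b1 subtraction_free.one subtraction_free.mult mult)
qed

lemma max_plus_hom_unique:
  fixes z :: "nat \<Rightarrow> 'f::field_char_0"
  assumes b: "b \<in> max_plus_homs (subtraction_free m z)" and b': "b' \<in> max_plus_homs (subtraction_free m z)"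
    and nz: "\<And>r. r \<in> subtraction_free m z \<Longrightarrow> r \<noteq> 0" and eq: "\<And>i. i < m \<Longrightarrow> b (z i) = b' (z i)"
  shows "b = b'"
proof
  fix r
  have "b r = b' r" if "r \<in> subtraction_free m z"
    using that
  proof induction
    case one
    then show ?case using max_plus_hom_facts(1)[OF b nz] max_plus_hom_facts(1)[OF b' nz] by simp
  next
    case (divide p q)
    then show ?case using max_plus_hom_facts(2)[OF b nz] max_plus_hom_facts(2)[OF b' nz] by simp
  qed (use b b' eq in \<open>auto simp: max_plus_homs_def\<close>)
  moreover have "b r = b' r" if "r \<notin> subtraction_free m z"
    using that b b' unfolding max_plus_homs_def by (auto simp: extensional_def)
  ultimately show "b r = b' r" by blast
qed

section \<open>Tropical evaluation of subtraction-free fractions\<close>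

context Lambda_cluster
begin

abbreviation "SF \<equiv> subtraction_free m (x [])"

text \<open>The nonzero polynomials in the initial cluster with nonnegative integer coefficients,
  described through the basis of simple classes.\<close>

definition pos_poly :: "'f set" where
  "pos_poly = {p \<in> Pc. supp p \<noteq> {} \<and> (\<forall>w \<in> supp p. \<exists>b. w = cmon [] b)}"

definition trop :: "'f \<Rightarrow> 'f \<Rightarrow> int" where
  "trop u p = Max ((\<lambda>w. LL w u) ` supp p)"

lemma pos_poly_nonzero: "p \<in> pos_poly \<Longrightarrow> p \<noteq> 0"
  unfolding pos_poly_def supp_def by (auto simp: coef_zero)

lemma cmon_pos_poly: "cmon [] b \<in> pos_poly" and trop_cmon: "trop u (cmon [] b) = LL (cmon [] b) u"
  unfolding pos_poly_def trop_def using supp_simple[OF cmon_Sm[OF root_tree_vertex]] cmon_Pc[OF root_tree_vertex] by auto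

lemma pos_poly_add:
  assumes "p \<in> pos_poly" "q \<in> pos_poly"
  shows "p + q \<in> pos_poly" and "trop u (p + q) = max (trop u p) (trop u q)"
proof -
  have pq: "p \<in> Pc" "q \<in> Pc" "supp p \<noteq> {}" "supp q \<noteq> {}" using assms unfolding pos_poly_def by auto
  have s: "supp (p + q) = supp p \<union> supp q" by (rule supp_add[OF pq(1,2)])
  have "\<forall>w \<in> supp p \<union> supp q. \<exists>b. w = cmon [] b" using assms unfolding pos_poly_def by blast
  then show "p + q \<in> pos_poly" using pq Pc_add[OF pq(1,2)] unfolding pos_poly_def mem_Collect_eq s by blast
  show "trop u (p + q) = max (trop u p) (trop u q)"
    unfolding trop_def s image_Un by (rule Max_Un) (use pq supp_finite in auto)
qed

text \<open>Without cancellation the support of the product consists of all products of two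
  monomials, and a maximum over sums of independent choices splits.\<close>

lemma pos_poly_mult:
  assumes p: "p \<in> pos_poly" and q: "q \<in> pos_poly" and u: "u \<in> Sm"
  shows "p * q \<in> pos_poly" and "trop u (p * q) = trop u p + trop u q"
proof -
  have pq: "p \<in> Pc" "q \<in> Pc" "supp p \<noteq> {}" "supp q \<noteq> {}" using p q unfolding pos_poly_def by auto
  have c: "\<exists>b. w = cmon [] b" if "w \<in> supp p \<union> supp q" for w using that p q unfolding pos_poly_def by auto
  note T = root_tree_vertex[of n]
  have wz: "w * z \<in> Sm \<and> LL (w * z) u = LL w u + LL z u" if wz: "w \<in> supp p" "z \<in> supp q" for w z
  proof -
    obtain b b' where "w = cmon [] b" "z = cmon [] b'" using c wz by blast
    then show ?thesis using cmon_mult_Sm[OF T] LL_mult[OF cmon_Sm[OF T] cmon_Sm[OF T] u] by simp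
  qed
  have "supp (w * q) = (\<lambda>z. w * z) ` supp q" if w: "w \<in> supp p" for w
  proof -
    have "w \<in> Pc" using supp_Sm[OF pq(1) w] Sm_Pc by blast
    then have "supp (q * w) = (\<Union>z\<in>supp q. supp (z * w))" by (rule supp_mult[OF pq(2)])
    also have "\<dots> = (\<Union>z\<in>supp q. {w * z})"
      using wz[OF w] supp_simple by (intro SUP_cong refl) (metis mult.commute)
    finally show ?thesis by (auto simp: mult.commute)
  qed
  then have s: "supp (p * q) = (\<Union>w\<in>supp p. (\<lambda>z. w * z) ` supp q)"
    unfolding supp_mult[OF pq(1,2)] by (intro SUP_cong refl)
  have "\<exists>b. v = cmon [] b" if v: "v \<in> supp (p * q)" for v
  proof -
    obtain w z where "w \<in> supp p" "z \<in> supp q" "v = w * z" using v s by blast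
    then show ?thesis using c cmon_add by (metis UnCI)
  qed
  moreover have ne: "supp (p * q) \<noteq> {}" unfolding s using pq by auto
  ultimately show "p * q \<in> pos_poly" unfolding pos_poly_def using Pc_mult[OF pq(1,2)] by blast
  have fin: "finite (supp p)" "finite (supp q)" "finite (supp (p * q))" using supp_finite pq Pc_mult by auto
  have le: "LL w u \<le> trop u r" if "w \<in> supp r" "finite (supp r)" for r w unfolding trop_def using that by simp
  have att: "\<exists>w \<in> supp r. trop u r = LL w u" if "supp r \<noteq> {}" "finite (supp r)" for r
  proof -
    have "trop u r \<in> (\<lambda>w. LL w u) ` supp r" unfolding trop_def by (rule Max_in) (use that in auto)
    then show ?thesis by blast
  qed
  obtain v where v: "v \<in> supp (p * q)" "trop u (p * q) = LL v u" using att ne fin by blast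
  then obtain w z where "w \<in> supp p" "z \<in> supp q" "v = w * z" using s by blast
  then have "trop u (p * q) \<le> trop u p + trop u q" using v wz le fin by (smt (verit))
  moreover obtain w z where "w \<in> supp p" "trop u p = LL w u" "z \<in> supp q" "trop u q = LL z u" using att pq fin by metis
  then have "trop u p + trop u q \<le> trop u (p * q)" using wz[of w z] le[of "w * z" "p * q"] fin s by auto
  ultimately show "trop u (p * q) = trop u p + trop u q" by simp
qed

text \<open>Common denominators keep numerator and denominator positive and nonzero. This yields the
  nonvanishing of subtraction-free elements and a form in which \<open>trop\<close> can evaluate
  them.\<close>

lemma SF_fraction:
  assumes "r \<in> SF"
  shows "\<exists>p q. p \<in> pos_poly \<and> q \<in> pos_poly \<and> r = p / q"
  using assms
proof induction
  case one
  then show ?case using cmon_pos_poly[of "\<lambda>_. 0"] by (intro exI[of _ 1]) simp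
next
  case (var i)
  then show ?case
    using cmon_pos_poly[of "\<lambda>j. if j = i then 1 else 0"] cmon_pos_poly[of "\<lambda>_. 0"] var_cmon[OF var, of "[]"]
    by (intro exI[of _ "x [] i"] exI[of _ 1]) simp
next
  case (add r r')
  then obtain p q p' q' where *: "p \<in> pos_poly" "q \<in> pos_poly" "r = p / q" "p' \<in> pos_poly" "q' \<in> pos_poly" "r' = p' / q'" by blast
  then have "r + r' = (p * q' + p' * q) / (q * q')" using pos_poly_nonzero by (simp add: add_frac_eq)
  then show ?case using * pos_poly_mult(1)[OF _ _ one_Sm] pos_poly_add(1) by metis
next
  case (mult r r')
  then obtain p q p' q' where *: "p \<in> pos_poly" "q \<in> pos_poly" "r = p / q" "p' \<in> pos_poly" "q' \<in> pos_poly" "r' = p' / q'" by blast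
  then have "r * r' = (p * p') / (q * q')" by simp
  then show ?case using * pos_poly_mult(1)[OF _ _ one_Sm] by metis
next
  case (divide r r')
  then obtain p q p' q' where *: "p \<in> pos_poly" "q \<in> pos_poly" "r = p / q" "p' \<in> pos_poly" "q' \<in> pos_poly" "r' = p' / q'" by blast
  then have "r / r' = (p * q') / (q * p')" by simp
  then show ?case using * pos_poly_mult(1)[OF _ _ one_Sm] by metis
qed

lemma SF_nonzero: "r \<in> SF \<Longrightarrow> r \<noteq> 0"
  using SF_fraction pos_poly_nonzero by (metis divide_eq_0_iff)

definition beta :: "'f \<Rightarrow> 'f \<Rightarrow> int" where
  "beta u = restrict (\<lambda>r. THE c. \<exists>p q. p \<in> pos_poly \<and> q \<in> pos_poly \<and> r = p / q \<and> c = trop u p - trop u q) SF"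

text \<open>Two fractions p / q and p' / q' with the same value satisfy p q' = p' q, and
  \<open>trop\<close> is additive on products; so the definite description in \<open>beta\<close> is
  well defined.\<close>

lemma beta_eq:
  assumes r: "r \<in> SF" and p: "p \<in> pos_poly" and q: "q \<in> pos_poly" and e: "r = p / q" and u: "u \<in> Sm"
  shows "beta u r = trop u p - trop u q"
proof -
  have "(THE c. \<exists>p q. p \<in> pos_poly \<and> q \<in> pos_poly \<and> r = p / q \<and> c = trop u p - trop u q) = trop u p - trop u q"
  proof (rule the_equality)
    show "\<exists>p' q'. p' \<in> pos_poly \<and> q' \<in> pos_poly \<and> r = p' / q' \<and> trop u p - trop u q = trop u p' - trop u q'"
      using p q e by blast
    fix c assume "\<exists>p' q'. p' \<in> pos_poly \<and> q' \<in> pos_poly \<and> r = p' / q' \<and> c = trop u p' - trop u q'"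
    then obtain p' q' where *: "p' \<in> pos_poly" "q' \<in> pos_poly" "r = p' / q'" "c = trop u p' - trop u q'" by blast
    have "p * q' = p' * q" using e * pos_poly_nonzero q by (simp add: frac_eq_eq)
    then have "trop u p + trop u q' = trop u p' + trop u q" using pos_poly_mult(2)[OF _ _ u] p q * by metis
    then show "c = trop u p - trop u q" using * by simp
  qed
  then show ?thesis unfolding beta_def using r by simp
qed

lemma beta_hom:
  assumes u: "u \<in> Sm"
  shows "beta u \<in> max_plus_homs SF"
proof -
  have "beta u (r * r') = beta u r + beta u r' \<and> beta u (r + r') = max (beta u r) (beta u r')" if r: "r \<in> SF" "r' \<in> SF" for r r'
  proof -
    obtain p q p' q' where *: "p \<in> pos_poly" "q \<in> pos_poly" "r = p / q" "p' \<in> pos_poly" "q' \<in> pos_poly" "r' = p' / q'"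
      using SF_fraction r by metis
    note m = pos_poly_mult[OF _ _ u]
    have e: "r * r' = (p * p') / (q * q')" "r + r' = (p * q' + p' * q) / (q * q')"
      using * pos_poly_nonzero by (simp_all add: add_frac_eq)
    have b: "beta u r = trop u p - trop u q" "beta u r' = trop u p' - trop u q'"
      using beta_eq[OF r(1) *(1,2,3) u] beta_eq[OF r(2) *(4,5,6) u] .
    have "beta u (r * r') = trop u (p * p') - trop u (q * q')"
      by (rule beta_eq[OF subtraction_free.mult[OF r] m(1) m(1) e(1) u]) (use * in auto)
    moreover have "beta u (r + r') = trop u (p * q' + p' * q) - trop u (q * q')"
      by (rule beta_eq[OF subtraction_free.add[OF r] pos_poly_add(1)[OF m(1) m(1)] m(1) e(2) u]) (use * in auto)
    ultimately show ?thesis using b * pos_poly_add(2)[OF m(1)[OF *(1,5)] m(1)[OF *(4,2)], of u] m(2) by (simp add: max_def)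
  qed
  then show ?thesis unfolding max_plus_homs_def beta_def by (simp add: Ball_def)
qed

lemma beta_root_var:
  assumes u: "u \<in> Sm" and i: "i < m"
  shows "beta u (x [] i) = LL (x [] i) u"
proof -
  let ?b = "\<lambda>j. if j = i then 1 else (0::nat)"
  have "beta u (x [] i) = trop u (cmon [] ?b) - trop u (cmon [] (\<lambda>_. 0))"
    by (rule beta_eq[OF subtraction_free.var[OF i] cmon_pos_poly cmon_pos_poly _ u]) (simp add: cmon_single[OF i])
  then show ?thesis using trop_cmon[of u ?b] trop_cmon[of u "\<lambda>_. 0"] LL_one[OF u] cmon_single[OF i, of "[]" 1] by simp
qed

lemma max_plus_hom_cmon:
  assumes b: "b \<in> max_plus_homs SF" and v: "\<And>j. j < m \<Longrightarrow> x t j \<in> SF"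
  shows "cmon t a \<in> SF" and "b (cmon t a) = (\<Sum>j<m. int (a j) * b (x t j))"
proof -
  note f = max_plus_hom_facts[OF b SF_nonzero]
  have pw: "x t j ^ a j \<in> SF" "b (x t j ^ a j) = int (a j) * b (x t j)" if "j < m" for j
    using f(3)[OF _ v[OF that]] by auto
  have *: "cmon t a \<in> SF \<and> b (cmon t a) = (\<Sum>j<m. b (x t j ^ a j))"
    unfolding cmon_def using f(4)[of "{..<m}" "\<lambda>j. x t j ^ a j"] pw by simp
  then show "cmon t a \<in> SF" by blast
  show "b (cmon t a) = (\<Sum>j<m. int (a j) * b (x t j))" using * pw by simp
qed

lemma beta_var:
  assumes s: "s \<in> \<T>" and t: "t \<in> \<T>" and u: "u = cmon s e"
  shows "\<forall>i<m. x t i \<in> SF \<and> beta u (x t i) = LL (x t i) u" (is "?P t")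
proof (rule tree_propagate[of n ?P, OF _ root_tree_vertex _ t])
  have uS: "u \<in> Sm" unfolding u by (rule cmon_Sm[OF s])
  show "?P []" using beta_root_var[OF uS] subtraction_free.var by blast
  fix k t t' assume e: "tree_edge n k t t'" and P: "?P t"
  note D = edgeD(1-4)[OF e]
  note f = max_plus_hom_facts[OF beta_hom[OF uS] SF_nonzero]
  have c: "cmon t a \<in> SF" "beta u (cmon t a) = LL (cmon t a) u" for a
    using max_plus_hom_cmon[OF beta_hom[OF uS], of t a] P LL_cmon(2)[OF D(1) uS] by auto
  have XY: "X t k + Y t k \<in> SF" using c(1) subtraction_free.add unfolding X_def Y_def by blast
  have b: "beta u (X t k + Y t k) = max (LL (X t k) u) (LL (Y t k) u)"
    using beta_hom[OF uS] c unfolding X_def Y_def max_plus_homs_def by simp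
  have xk: "x t k \<in> SF" "beta u (x t k) = LL (x t k) u" using P D(4) by auto
  \<comment> \<open>Solved for the new variable, the exchange relation is subtraction-free, so
    \<open>beta\<close> turns it into the maximum that \<open>LL_exchange_max\<close>
    computes.\<close>
  have eq: "x t' k = (X t k + Y t k) / x t k"
    using edgeD(8)[OF e] var_nonzero[OF D(1,4)] by (simp add: field_simps)
  have "x t' k \<in> SF" unfolding eq by (rule subtraction_free.divide[OF XY xk(1)])
  moreover have "beta u (x t' k) = LL (x t' k) u"
    using f(2)[OF _ XY xk(1)] LL_exchange_max[OF e s u] b xk(2) unfolding eq[symmetric] by simp
  ultimately show "?P t'" using P edgeD(7)[OF e] by metis
qed

text \<open>A homomorphism is determined by its values on the initial cluster, so uniqueness follows
  from the defining equation at the root. Existence is where all vertices enter, through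
  \<open>beta_var\<close>.\<close>

lemma trop_point_eq:
  assumes s: "s \<in> \<T>" and u: "u = cmon s e"
    and L: "\<And>t. t \<in> \<T> \<Longrightarrow> L t = mat m m (\<lambda>(i, j). LL (x t i) (x t j))"
  shows "trop_point m n x B L u = beta u"
  unfolding trop_point_def
proof (rule the_equality)
  have uS: "u \<in> Sm" unfolding u by (rule cmon_Sm[OF s])
  have rhs: "L t *\<^sub>v g_vector m n x B t u = vec m (\<lambda>i. LL (x t i) u)" if t: "t \<in> \<T>" for t
    using LL_g_vector[OF s t u] unfolding L[OF t]
    by (intro eq_vecI) (auto simp: scalar_prod_def atLeast0LessThan intro!: sum.cong)
  show "beta u \<in> max_plus_homs SF \<and> (\<forall>t\<in>\<T>. vec m (\<lambda>i. beta u (x t i)) = L t *\<^sub>v g_vector m n x B t u)"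
    using beta_hom[OF uS] beta_var[OF s _ u] rhs by (auto intro!: eq_vecI)
  fix b assume b: "b \<in> max_plus_homs SF \<and> (\<forall>t\<in>\<T>. vec m (\<lambda>i. b (x t i)) = L t *\<^sub>v g_vector m n x B t u)"
  then have "vec m (\<lambda>i. b (x [] i)) = vec m (\<lambda>i. LL (x [] i) u)" using rhs root_tree_vertex by metis
  then have "b (x [] i) = LL (x [] i) u" if "i < m" for i using that by (metis index_vec)
  then show "b = beta u" using max_plus_hom_unique[of b m "x []" "beta u"] b beta_hom[OF uS] SF_nonzero beta_root_var[OF uS] by metis
qed

theorem trop_point_cluster_monomial:
  assumes s: "s \<in> \<T>" "t \<in> \<T>"
    and L: "\<And>t. t \<in> \<T> \<Longrightarrow> L t = mat m m (\<lambda>(i, j). LL (x t i) (x t j))"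
  shows "trop_point m n x B L (cmon s e) (cmon t f) = LL (cmon t f) (cmon s e)"
proof -
  let ?u = "cmon s e"
  have uS: "?u \<in> Sm" by (rule cmon_Sm[OF s(1)])
  have "beta ?u (cmon t f) = (\<Sum>j<m. int (f j) * beta ?u (x t j))"
    by (rule max_plus_hom_cmon(2)[OF beta_hom[OF uS]]) (use beta_var[OF s refl] in blast)
  also have "\<dots> = LL (cmon t f) ?u"
    unfolding LL_cmon(2)[OF s(2) uS] using beta_var[OF s refl] by (intro sum.cong) auto
  finally show ?thesis using trop_point_eq[OF s(1) refl L] by simp
qed

end

section \<open>Reachable simple objects\<close>

lemma Lambda_category_of_categorification:
  assumes "Lambda_monoidal_categorification m n x B K C \<phi> \<Omega> \<Lambda>"
  shows "Lambda_category K C \<phi> \<Omega> \<Lambda>"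
proof -
  from assms have mc: "linear_monoidal_abelian_category K C" "\<And>X. X \<in> Ob C \<Longrightarrow> finite_length C X" "ring (K0 C)"
      "\<phi> \<in> ring_iso (K0 C) (cluster_algebra m n x)"
    and ls: "Lambda_structure C \<Omega> \<Lambda>"
    and c1: "\<And>M N. \<lbrakk>simple C M; simple C N; real_simple C M \<or> real_simple C N\<rbrakk> \<Longrightarrow> simple C (head_prod C M N)"
    unfolding Lambda_monoidal_categorification_def monoidal_categorification_def by blast+
  interpret linear_monoidal_abelian_category K C by (rule mc(1))
  interpret Lambda_structure C \<Omega> \<Lambda> by (rule ls)
  interpret K0: ring "K0 C" by (rule mc(3))
  note iso = ring_iso_memE[OF mc(4)]
  show ?thesis
  proof unfold_locales
    show "\<phi> (p \<oplus>\<^bsub>K0 C\<^esub> q) = \<phi> p + \<phi> q" if "p \<in> carrier (K0 C)" "q \<in> carrier (K0 C)" for p q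
      using iso(3)[OF that] by (simp add: cluster_algebra_def ring_of_type_algebra_def)
    show "\<phi> (p \<otimes>\<^bsub>K0 C\<^esub> q) = \<phi> p * \<phi> q" if "p \<in> carrier (K0 C)" "q \<in> carrier (K0 C)" for p q
      using iso(2)[OF that] by (simp add: cluster_algebra_def ring_of_type_algebra_def)
    show "inj_on \<phi> (carrier (K0 C))" using iso(5) by (rule bij_betw_imp_inj_on)
  qed (fact mc(2) c1)+
qed

theorem corollary1p10:
  fixes m n :: nat
    and x :: "nat list \<Rightarrow> nat \<Rightarrow> 'f::field_char_0"
    and B :: "nat list \<Rightarrow> int mat"
    and K :: "'k ring"
    and C :: "('o, 'a, 'k) mon_cat"
    and \<phi> :: "('o \<Rightarrow>\<^sub>0 int) set \<Rightarrow> 'f"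
    and \<Omega> :: "'o set"
    and \<Lambda> :: "'o \<Rightarrow> 'o \<Rightarrow> int"
    and M N :: 'o
  assumes "0 < n" and "n \<le> m"
    and "cluster_pattern m n x B"
    and "Lambda_monoidal_categorification m n x B K C \<phi> \<Omega> \<Lambda>"
    and "reachable m n x C \<phi> M"
    and "reachable m n x C \<phi> N"
  shows "\<Lambda> M N = trop_pairing m n x B (Lambda_mat m x C \<phi> \<Lambda>)
                   (\<phi> (K0_class C M)) (\<phi> (K0_class C N)) \<and>
         2 * dfun \<Lambda> M N = of_int (F_pairing m n x B (Lambda_mat m x C \<phi> \<Lambda>)
                   (\<phi> (K0_class C M)) (\<phi> (K0_class C N)))"
proof -
  let ?L = "Lambda_mat m x C \<phi> \<Lambda>"
  interpret cat: Lambda_category K C \<phi> \<Omega> \<Lambda> by (rule Lambda_category_of_categorification[OF assms(4)])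
  have L: "?L t = mat m m (\<lambda>(i, j). cat.LL (x t i) (x t j))" for t
    unfolding Lambda_mat_def monoidal_cluster_def cat.LL_def cat.rep_def cat.cls_def ..
  interpret basis: Lambda_basis cat.simple_classes cat.object_classes cat.mult_in_class cat.LL cat.hd
    by (rule cat.Lambda_basis)
  interpret Lambda_cluster cat.simple_classes cat.object_classes cat.mult_in_class cat.LL cat.hd m n x B
  proof
    show "n \<le> m" "cluster_pattern m n x B" by (fact assms)+
    show "cluster_monomials m n x \<subseteq> cat.simple_classes"
    proof
      fix u assume "u \<in> cluster_monomials m n x"
      then obtain S where "simple C S" "\<phi> (K0_class C S) = u"
        using assms(4) unfolding Lambda_monoidal_categorification_def monoidal_categorification_def by blast
      then show "u \<in> cat.simple_classes" unfolding cat.simple_classes_def cat.cls_def by blast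
    qed
    show "\<exists>w \<in> tree_vertices n. \<exists>s. compatible_pair m n (B w) (mat m m (\<lambda>(i, j). cat.LL (x w i) (x w j))) s"
      using assms(4) unfolding Lambda_monoidal_categorification_def L[symmetric] by blast
  qed
  have monomial: "\<exists>s e. s \<in> tree_vertices n \<and> cat.cls A = cmon s e" if "reachable m n x C \<phi> A" for A
    using that unfolding reachable_def cluster_monomials_def cmon_def cat.cls_def by blast
  have trop: "trop_point m n x B ?L (cat.cls A) (cat.cls A') = \<Lambda> A' A"
    if A: "reachable m n x C \<phi> A" "reachable m n x C \<phi> A'" for A A'
  proof -
    obtain s e t f where "s \<in> tree_vertices n" "cat.cls A = cmon s e" "t \<in> tree_vertices n" "cat.cls A' = cmon t f"
      using monomial A by metis
    then have "trop_point m n x B ?L (cat.cls A) (cat.cls A') = cat.LL (cat.cls A') (cat.cls A)"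
      using trop_point_cluster_monomial L by simp
    also have "\<dots> = \<Lambda> A' A" by (rule cat.LL_cls) (use A in \<open>auto simp: reachable_def\<close>)
    finally show ?thesis .
  qed
  show ?thesis
    unfolding trop_pairing_def F_pairing_def dfun_def
    \<comment> \<open>The tropical point belongs to the second argument of
      \<open>trop_pairing\<close>, hence the reversed order of the assumptions.\<close>
    using trop[OF assms(6,5)] trop[OF assms(5,6)] unfolding cat.cls_def by simp
qed

end
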